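(* Let $p$ be an odd prime. Perron's mod-$p$ Johnson filtration and the Zassenhaus mod-$p$ Johnson filtration of $Mod_{g,1}$ coincide: $\mathcal{I}_{g,1}^P(k)=\mathcal{I}_{g,1}^Z(k)$ for all $k\geq 1$.
   Context: $\Sigma_{g,1}$ is a compact connected orientable surface of genus $g$ with one boundary component. $Mod_{g,1}$ is its mapping class group: orientation-preserving homeomorphisms of $\Sigma_{g,1}$ fixing the boundary pointwise, modulo isotopy relative to the boundary. $\Gamma=\pi_1(\Sigma_{g,1})$ with basepoint on the boundary; it is free with basis $\{x_1,\dots,x_{2g}\}$ and $Mod_{g,1}$ acts on it. Zassenhaus filtration: for a group $G$, $G^m$ is the subgroup generated by $m$-th powers. With the lower central series $\Gamma_1=\Gamma$, $\Gamma_k=[\Gamma,\Gamma_{k-1}]$, put $\Gamma_k^Z=\prod_{ip^j\geq k}(\Gamma_i)^{p^j}$ (over $i\ge 1$, $j\ge 0$) and $\mathcal{I}_{g,1}^Z(k)=\{f\in Mod_{g,1}\mid f(x)x^{-1}\in\Gamma_{k+1}^Z\text{ for all }x\in\Gamma\}$. Fox calculus: $\epsilon:\mathbf{Z}[\Gamma]\to\mathbf{Z}$ is the augmentation. The Fox derivatives $\partial/\partial x_j:\mathbf{Z}[\Gamma]\to\mathbf{Z}[\Gamma]$ are the additive maps determined by $\partial x_i/\partial x_j=\delta_{ij}$ and $\frac{\partial (uv)}{\partial x_j}=\epsilon(v)\frac{\partial u}{\partial x_j}+u\frac{\partial v}{\partial x_j}$. Write $\overline{\sum n_ig_i}=\sum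 n_ig_i^{-1}$. The Fox matrix of $f\in Mod_{g,1}$ is $B(f)=\left(\overline{\partial f(x_j)/\partial x_i}\right)_{ij}\in GL_{2g}(\mathbf{Z}[\Gamma])$, and $B^{(p)}(f)\in GL_{2g}(\mathbf{F}_p[\Gamma])$ is its reduction modulo $p$. Taylor expansion: an element $u$ of the group ring is expanded in noncommuting variables $w_1,\dots,w_{2g}$ as $u\mapsto\sum_{l\geq 0}\sum_{1\leq j_1,\dots,j_l\leq 2g}\epsilon\left(\frac{\partial^l u}{\partial x_{j_l}\cdots\partial x_{j_1}}\right)w_{j_l}\cdots w_{j_1}$, where $\frac{\partial^l u}{\partial x_{j_l}\cdots\partial x_{j_1}}=\frac{\partial}{\partial x_{j_l}}\cdots\frac{\partial}{\partial x_{j_1}}u$, so $\partial/\partial x_{j_1}$ is applied first; coefficients are taken modulo $p$ over $\mathbf{F}_p$. Expanding the entries gives $B^{(p)}(f)\mapsto B_0^{(p)}(f)+B_1^{(p)}(f)+\cdots$, where $B_l^{(p)}(f)$ is the matrix of homogeneous degree-$l$ parts. Perron's filtration: $\mathcal{I}_{g,1}^P(k)=\{f\in Mod_{g,1}\mid B_0^{(p)}(f)=Id,\ B_l^{(p)}(f)=0\text{ for }l=1,\dots,k-1\}$. *)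

theory Defs
  imports "HOL-Analysis.Analysis" "HOL-Homology.Homology" "HOL-Algebra.Ring" "HOL-Algebra.Generated_Groups"
    "HOL-Computational_Algebra.Primes"
begin

section \<open>Surfaces with boundary\<close>

definition half_plane :: "complex set" where
  "half_plane = {z. 0 \<le> Im z}"

definition surface_chart :: "'a::topological_space set \<Rightarrow> 'a set \<Rightarrow> ('a \<Rightarrow> complex) \<Rightarrow> bool" where
  "surface_chart S U h \<longleftrightarrow> openin (top_of_set S) U \<and>
     (\<exists>V k. openin (top_of_set half_plane) V \<and> homeomorphism U V h k)"

definition surface_with_boundary :: "'a::topological_space set \<Rightarrow> bool" where
  "surface_with_boundary S \<longleftrightarrow>
     Hausdorff_space (top_of_set S) \<and> second_countable (top_of_set S) \<and>
     (\<forall>x\<in>S. \<exists>U h. x \<in> U \<and> surface_chart S U h)"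

definition surface_boundary :: "'a::topological_space set \<Rightarrow> 'a set" where
  "surface_boundary S = {x \<in> S. \<exists>U h. x \<in> U \<and> surface_chart S U h \<and> Im (h x) = 0}"

definition surface_interior :: "'a::topological_space set \<Rightarrow> 'a set" where
  "surface_interior S = S - surface_boundary S"

text \<open>An orientation of a 2-manifold \<open>M\<close> without boundary is a choice of generators
  of the infinite cyclic local homology groups \<open>H_2(M, M - {x})\<close> that is locally induced by
  a single class of \<open>H_2(M, M - B)\<close>, with \<open>B\<close> a neighbourhood.  A surface with boundary
  is oriented by orienting its interior.\<close>

definition surface_orientation ::
    "'a::topological_space set \<Rightarrow> ('a \<Rightarrow> 'a chain set) \<Rightarrow> bool" where
  "surface_orientation S \<mu> \<longleftrightarrow> (let M = surface_interior S; X = top_of_set M in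
     (\<forall>x\<in>M. \<mu> x \<in> carrier (relative_homology_group 2 X (M - {x})) \<and>
        generate (relative_homology_group 2 X (M - {x})) {\<mu> x}
          = carrier (relative_homology_group 2 X (M - {x}))) \<and>
     (\<forall>x\<in>M. \<exists>B \<nu>. openin X B \<and> x \<in> B \<and>
        \<nu> \<in> carrier (relative_homology_group 2 X (M - B)) \<and>
        (\<forall>y\<in>B. hom_induced 2 X (M - B) X (M - {y}) id \<nu> = \<mu> y)))"

definition orientable_surface :: "'a::topological_space set \<Rightarrow> bool" where
  "orientable_surface S \<longleftrightarrow> (\<exists>\<mu>. surface_orientation S \<mu>)"

text \<open>Meant for self-homeomorphisms of \<open>S\<close>, which preserve the interior.  On a connected
  surface there are only the two orientations \<open>\<mu>\<close> and \<open>-\<mu>\<close>, so the quantifier is harmless.\<close>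

definition orientation_preserving :: "'a::topological_space set \<Rightarrow> ('a \<Rightarrow> 'a) \<Rightarrow> bool" where
  "orientation_preserving S f \<longleftrightarrow> (let M = surface_interior S; X = top_of_set M in
     \<forall>\<mu>. surface_orientation S \<mu> \<longrightarrow>
       (\<forall>x\<in>M. hom_induced 2 X (M - {x}) X (M - {f x}) f (\<mu> x) = \<mu> (f x)))"

text \<open>The genus is the largest number of disjoint simple closed curves in the interior
  whose union does not separate the surface.\<close>

definition nonseparating_curves :: "'a::topological_space set \<Rightarrow> nat \<Rightarrow> bool" where
  "nonseparating_curves S n \<longleftrightarrow> (\<exists>c :: nat \<Rightarrow> real \<Rightarrow> 'a.
     (\<forall>i<n. simple_path (c i) \<and> pathfinish (c i) = pathstart (c i) \<and>
        path_image (c i) \<subseteq> surface_interior S) \<and>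
     (\<forall>i<n. \<forall>j<n. i \<noteq> j \<longrightarrow> path_image (c i) \<inter> path_image (c j) = {}) \<and>
     connected (S - (\<Union>i<n. path_image (c i))))"

definition surface_genus_is :: "'a::topological_space set \<Rightarrow> nat \<Rightarrow> bool" where
  "surface_genus_is S g \<longleftrightarrow>
     nonseparating_curves S g \<and> (\<forall>n. nonseparating_curves S n \<longrightarrow> n \<le> g)"

text \<open>\<open>S\<close> is a \<open>\<Sigma>\<^bsub>g,1\<^esub>\<close>.\<close>

definition surface_one_boundary :: "'a::topological_space set \<Rightarrow> nat \<Rightarrow> bool" where
  "surface_one_boundary S g \<longleftrightarrow>
     surface_with_boundary S \<and> compact S \<and> connected S \<and> orientable_surface S \<and>
     surface_genus_is S g \<and> card (components (surface_boundary S)) = 1"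


section \<open>Mapping class group and fundamental group\<close>

definition rel_boundary_homeo :: "'a::topological_space set \<Rightarrow> ('a \<Rightarrow> 'a) \<Rightarrow> bool" where
  "rel_boundary_homeo S f \<longleftrightarrow>
     (\<exists>f'. homeomorphism S S f f') \<and> (\<forall>x\<in>surface_boundary S. f x = x)"

definition mcg_homeos :: "'a::topological_space set \<Rightarrow> ('a \<Rightarrow> 'a) set" where
  "mcg_homeos S = {f. rel_boundary_homeo S f \<and> orientation_preserving S f}"

text \<open>Isotopy relative to the boundary: a homotopy through homeomorphisms fixing the boundary.
  Values of the maps outside \<open>S\<close> play no role.\<close>

definition isotopy_rel :: "'a::topological_space set \<Rightarrow> (('a \<Rightarrow> 'a) \<times> ('a \<Rightarrow> 'a)) set" where
  "isotopy_rel S = {(f, f'). f \<in> mcg_homeos S \<and> f' \<in> mcg_homeos S \<and>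
     homotopic_with (rel_boundary_homeo S) (top_of_set S) (top_of_set S) f f'}"

definition mapping_class_group :: "'a::topological_space set \<Rightarrow> ('a \<Rightarrow> 'a) set monoid" where
  "mapping_class_group S =
     \<lparr> carrier = mcg_homeos S // isotopy_rel S,
       mult = (\<lambda>\<phi> \<psi>. {h. \<exists>f\<in>\<phi>. \<exists>f'\<in>\<psi>. (f \<circ> f', h) \<in> isotopy_rel S}),
       one = isotopy_rel S `` {id} \<rparr>"

definition loops_at :: "'a::topological_space set \<Rightarrow> 'a \<Rightarrow> (real \<Rightarrow> 'a) set" where
  "loops_at S b = {\<gamma>. path \<gamma> \<and> path_image \<gamma> \<subseteq> S \<and> pathstart \<gamma> = b \<and> pathfinish \<gamma> = b}"

definition fundamental_group ::
    "'a::topological_space set \<Rightarrow> 'a \<Rightarrow> (real \<Rightarrow> 'a) set monoid" where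
  "fundamental_group S b =
     \<lparr> carrier = loops_at S b // {(\<gamma>, \<delta>). \<gamma> \<in> loops_at S b \<and> homotopic_paths S \<gamma> \<delta>},
       mult = (\<lambda>A B. {\<delta>. \<exists>\<alpha>\<in>A. \<exists>\<beta>\<in>B. homotopic_paths S (\<alpha> +++ \<beta>) \<delta>}),
       one = {\<delta>. homotopic_paths S (\<lambda>_. b) \<delta>} \<rparr>"

text \<open>Action of a mapping class on the class of a loop based on the boundary.\<close>

definition mcg_action ::
    "'a::topological_space set \<Rightarrow> ('a \<Rightarrow> 'a) set \<Rightarrow> (real \<Rightarrow> 'a) set \<Rightarrow> (real \<Rightarrow> 'a) set" where
  "mcg_action S \<phi> A = {\<delta>. \<exists>f\<in>\<phi>. \<exists>\<gamma>\<in>A. homotopic_paths S (f \<circ> \<gamma>) \<delta>}"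


section \<open>Free bases\<close>

text \<open>A letter \<open>(i, True)\<close> stands for \<open>x i\<close> and \<open>(i, False)\<close> for its inverse.  A family is a
  free basis if every element is the value of exactly one reduced word.\<close>

definition word_value ::
    "('g, 'm) monoid_scheme \<Rightarrow> ('i \<Rightarrow> 'g) \<Rightarrow> ('i \<times> bool) list \<Rightarrow> 'g" where
  "word_value G x w =
     foldr (\<lambda>(i, s) a. (if s then x i else inv\<^bsub>G\<^esub> (x i)) \<otimes>\<^bsub>G\<^esub> a) w \<one>\<^bsub>G\<^esub>"

definition reduced_word :: "('i \<times> bool) list \<Rightarrow> bool" where
  "reduced_word w \<longleftrightarrow> successively (\<lambda>(i, s) (j, t). i = j \<longrightarrow> s = t) w"

definition free_basis :: "('g, 'm) monoid_scheme \<Rightarrow> 'i set \<Rightarrow> ('i \<Rightarrow> 'g) \<Rightarrow> bool" where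
  "free_basis G I x \<longleftrightarrow> x \<in> I \<rightarrow> carrier G \<and>
     bij_betw (word_value G x) {w. set w \<subseteq> I \<times> UNIV \<and> reduced_word w} (carrier G)"


section \<open>Zassenhaus filtration\<close>

text \<open>The series is indexed from 1; the value at index 0 is not used.\<close>

fun lower_central :: "('g, 'm) monoid_scheme \<Rightarrow> nat \<Rightarrow> 'g set" where
  "lower_central G 0 = carrier G"
| "lower_central G (Suc 0) = carrier G"
| "lower_central G (Suc (Suc k)) =
     generate G {a \<otimes>\<^bsub>G\<^esub> c \<otimes>\<^bsub>G\<^esub> inv\<^bsub>G\<^esub> a \<otimes>\<^bsub>G\<^esub> inv\<^bsub>G\<^esub> c | a c. a \<in> carrier G \<and> c \<in> lower_central G (Suc k)}"

definition power_subgroup :: "('g, 'm) monoid_scheme \<Rightarrow> 'g set \<Rightarrow> nat \<Rightarrow> 'g set" where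
  "power_subgroup G H m = generate G {h [^]\<^bsub>G\<^esub> m | h. h \<in> H}"

text \<open>The product of a family of normal subgroups is the subgroup generated by their union.\<close>

definition zassenhaus_subgroup :: "('g, 'm) monoid_scheme \<Rightarrow> nat \<Rightarrow> nat \<Rightarrow> 'g set" where
  "zassenhaus_subgroup G p k =
     generate G (\<Union>{power_subgroup G (lower_central G i) (p ^ j) | i j. 1 \<le> i \<and> k \<le> i * p ^ j})"

definition zassenhaus_johnson ::
    "'a::topological_space set \<Rightarrow> 'a \<Rightarrow> nat \<Rightarrow> nat \<Rightarrow> ('a \<Rightarrow> 'a) set set" where
  "zassenhaus_johnson S b p k = (let \<Gamma> = fundamental_group S b in
     {\<phi> \<in> carrier (mapping_class_group S).
        \<forall>y\<in>carrier \<Gamma>. mcg_action S \<phi> y \<otimes>\<^bsub>\<Gamma>\<^esub> inv\<^bsub>\<Gamma>\<^esub> y \<in> zassenhaus_subgroup \<Gamma> p (k + 1)})"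


section \<open>Fox calculus\<close>

text \<open>Elements of the integral group ring are finitely supported functions, zero off the carrier.\<close>

definition group_ring :: "('g, 'm) monoid_scheme \<Rightarrow> ('g \<Rightarrow> int) ring" where
  "group_ring G =
     \<lparr> carrier = {u. finite {h. u h \<noteq> 0} \<and> {h. u h \<noteq> 0} \<subseteq> carrier G},
       mult = (\<lambda>u v h. if h \<in> carrier G
                       then \<Sum>a | u a \<noteq> 0. u a * v (inv\<^bsub>G\<^esub> a \<otimes>\<^bsub>G\<^esub> h) else 0),
       one = (\<lambda>h. if h = \<one>\<^bsub>G\<^esub> then 1 else 0),
       zero = (\<lambda>h. 0),
       add = (\<lambda>u v h. u h + v h) \<rparr>"

definition group_ring_elt :: "'g \<Rightarrow> 'g \<Rightarrow> int" where
  "group_ring_elt a = (\<lambda>h. if h = a then 1 else 0)"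

definition augmentation :: "('g \<Rightarrow> int) \<Rightarrow> int" where
  "augmentation u = (\<Sum>h | u h \<noteq> 0. u h)"

definition group_ring_conj :: "('g, 'm) monoid_scheme \<Rightarrow> ('g \<Rightarrow> int) \<Rightarrow> 'g \<Rightarrow> int" where
  "group_ring_conj G u = (\<lambda>h. if h \<in> carrier G then u (inv\<^bsub>G\<^esub> h) else 0)"

definition is_fox_derivative ::
    "('g, 'm) monoid_scheme \<Rightarrow> nat \<Rightarrow> (nat \<Rightarrow> 'g) \<Rightarrow> nat \<Rightarrow> (('g \<Rightarrow> int) \<Rightarrow> 'g \<Rightarrow> int) \<Rightarrow> bool" where
  "is_fox_derivative G n x j D \<longleftrightarrow> (let R = group_ring G in
     D \<in> carrier R \<rightarrow> carrier R \<and>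
     (\<forall>u\<in>carrier R. \<forall>v\<in>carrier R. D (u \<oplus>\<^bsub>R\<^esub> v) = D u \<oplus>\<^bsub>R\<^esub> D v) \<and>
     (\<forall>i\<in>{1..n}. D (group_ring_elt (x i)) = (if i = j then \<one>\<^bsub>R\<^esub> else \<zero>\<^bsub>R\<^esub>)) \<and>
     (\<forall>u\<in>carrier R. \<forall>v\<in>carrier R.
        D (u \<otimes>\<^bsub>R\<^esub> v) = (\<lambda>h. augmentation v * D u h) \<oplus>\<^bsub>R\<^esub> (u \<otimes>\<^bsub>R\<^esub> D v)))"

text \<open>If \<open>x\<close> is a free basis indexed by \<open>{1..n}\<close>, these rules determine the derivative on the
  group ring; extensionality fixes its irrelevant values elsewhere.\<close>

definition fox_derivative ::
    "('g, 'm) monoid_scheme \<Rightarrow> nat \<Rightarrow> (nat \<Rightarrow> 'g) \<Rightarrow> nat \<Rightarrow> ('g \<Rightarrow> int) \<Rightarrow> 'g \<Rightarrow> int" where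
  "fox_derivative G n x j =
     (THE D. is_fox_derivative G n x j D \<and> D \<in> extensional (carrier (group_ring G)))"

text \<open>Here \<open>n\<close> is the rank \<open>2g\<close>; matrix indices range over \<open>{1..n}\<close>.\<close>

definition fox_matrix ::
    "'a::topological_space set \<Rightarrow> 'a \<Rightarrow> nat \<Rightarrow> (nat \<Rightarrow> (real \<Rightarrow> 'a) set) \<Rightarrow> ('a \<Rightarrow> 'a) set
      \<Rightarrow> nat \<Rightarrow> nat \<Rightarrow> (real \<Rightarrow> 'a) set \<Rightarrow> int" where
  "fox_matrix S b n x \<phi> i j = (let \<Gamma> = fundamental_group S b in
     group_ring_conj \<Gamma> (fox_derivative \<Gamma> n x i (group_ring_elt (mcg_action S \<phi> (x j)))))"

text \<open>Elements of the field with \<open>p\<close> elements are represented by \<open>0, \<dots>, p - 1\<close>, and elements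
  of the mod \<open>p\<close> group ring by integral elements with such coefficients.\<close>

definition fox_matrix_mod ::
    "'a::topological_space set \<Rightarrow> 'a \<Rightarrow> nat \<Rightarrow> (nat \<Rightarrow> (real \<Rightarrow> 'a) set) \<Rightarrow> nat \<Rightarrow> ('a \<Rightarrow> 'a) set
      \<Rightarrow> nat \<Rightarrow> nat \<Rightarrow> (real \<Rightarrow> 'a) set \<Rightarrow> int" where
  "fox_matrix_mod S b n x p \<phi> i j = (\<lambda>h. fox_matrix S b n x \<phi> i j h mod int p)"

text \<open>A noncommutative power series maps the monomial \<open>w\<^bsub>i\<^sub>1\<^esub> \<dots> w\<^bsub>i\<^sub>l\<^esub>\<close>, given as the list
  \<open>[i\<^sub>1, \<dots>, i\<^sub>l]\<close>, to its coefficient.  In the iterated derivative the last index of the list is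
  applied first.  Modulo \<open>p\<close> the coefficient depends only on \<open>u\<close> modulo \<open>p\<close>.\<close>

definition taylor_mod ::
    "('g, 'm) monoid_scheme \<Rightarrow> nat \<Rightarrow> (nat \<Rightarrow> 'g) \<Rightarrow> nat \<Rightarrow> ('g \<Rightarrow> int) \<Rightarrow> nat list \<Rightarrow> int" where
  "taylor_mod G n x p u w =
     (if set w \<subseteq> {1..n} then augmentation (foldr (fox_derivative G n x) w u) mod int p else 0)"

definition homogeneous_part :: "nat \<Rightarrow> (nat list \<Rightarrow> int) \<Rightarrow> nat list \<Rightarrow> int" where
  "homogeneous_part l s = (\<lambda>w. if length w = l then s w else 0)"

definition fox_matrix_part ::
    "'a::topological_space set \<Rightarrow> 'a \<Rightarrow> nat \<Rightarrow> (nat \<Rightarrow> (real \<Rightarrow> 'a) set) \<Rightarrow> nat \<Rightarrow> nat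
      \<Rightarrow> ('a \<Rightarrow> 'a) set \<Rightarrow> nat \<Rightarrow> nat \<Rightarrow> nat list \<Rightarrow> int" where
  "fox_matrix_part S b n x p l \<phi> i j =
     homogeneous_part l (taylor_mod (fundamental_group S b) n x p (fox_matrix_mod S b n x p \<phi> i j))"

definition perron_johnson ::
    "'a::topological_space set \<Rightarrow> 'a \<Rightarrow> nat \<Rightarrow> (nat \<Rightarrow> (real \<Rightarrow> 'a) set) \<Rightarrow> nat \<Rightarrow> nat
      \<Rightarrow> ('a \<Rightarrow> 'a) set set" where
  "perron_johnson S b n x p k =
     {\<phi> \<in> carrier (mapping_class_group S).
        (\<forall>i\<in>{1..n}. \<forall>j\<in>{1..n}.
           fox_matrix_part S b n x p 0 \<phi> i j = (\<lambda>w. if i = j \<and> w = [] then 1 else 0)) \<and>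
        (\<forall>l\<in>{1..k-1}. \<forall>i\<in>{1..n}. \<forall>j\<in>{1..n}.
           fox_matrix_part S b n x p l \<phi> i j = (\<lambda>w. 0))}"

end

theory Submission
  imports Defs "HOL-Library.List_Lexorder" "HOL-Library.Sublist"
begin

text \<open>
  The Taylor expansion by Fox derivatives is the Magnus expansion \<open>x\<^sub>i \<mapsto> 1 + w\<^sub>i\<close>, so Perron's
  condition says that \<open>f(x\<^sub>j)\<close> and \<open>x\<^sub>j\<close> have the same Magnus expansion modulo \<open>p\<close> and degree \<open>k + 1\<close>;
  the conjugation of the group ring does not matter because it respects the degree filtration.
  It remains to see that \<open>\<Gamma>\<^sub>k\<^sup>Z\<close> consists of the elements whose expansion is \<open>1\<close> modulo \<open>p\<close> and degree \<open>k\<close>.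
  Modulo \<open>\<Gamma>\<^sub>k\<close> every element is a product of powers \<open>c\<^sub>w\<^sup>e\<close> of the bracketings \<open>c\<^sub>w\<close> of distinct Lyndon
  words \<open>w\<close>.  If \<open>q\<close> is the largest power of \<open>p\<close> dividing \<open>e\<close>, then the expansion of \<open>c\<^sub>w\<^sup>e\<close> modulo \<open>p\<close> is
  \<open>1\<close> plus a nonzero multiple of the word \<open>w\<^sup>q\<close> plus words that are longer, or of the same length and
  lexicographically larger.  The words \<open>w\<^sup>q\<close> are distinct, so the first one survives in the product,
  and all of them have length at least \<open>k\<close> when the product is \<open>1\<close> modulo degree \<open>k\<close>.
\<close>

section \<open>Lyndon words\<close>

text \<open>Only the spanning half of the Lyndon basis theorem is proved by commutator calculus, one
  layer of the lower central series at a time; leading words do the work of independence. Two orders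
  on words are in play: the lexicographic \<open><\<close> governs Lyndon words and the rewriting of
  brackets, whereas leading terms are taken in the shortlex order \<open>word_before\<close>. The
  powers w^q come from Frobenius: with e = q e', the expansion of c_w^q modulo p is 1 plus the q-th
  power of a series beginning with w, and raising to the power e' multiplies the leading coefficient
  by e', a unit modulo p. That the leading word has length q |w| at least k is precisely the
  condition k <= i p^j with i = |w| and p^j = q under which c_w^q is a listed generator of the
  Zassenhaus subgroup, so bounding leading words already proves membership. The shift between degree
  k of the matrices and degree k + 1 of group elements comes from the fundamental formula of Fox
  calculus, g - 1 = sum of (dg/dx_j)(x_j - 1), whose second factor has degree one.\<close>

lemma less_append_left_iff [simp]:
  fixes s :: "'a::order list"
  shows "s @ a < s @ b \<longleftrightarrow> a < b"
  by (induction s) auto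

lemma le_append_self [simp]:
  fixes s :: "'a::linorder list"
  shows "s \<le> s @ a"
  by (induction s) auto

text \<open>\<open>u\<close> and \<open>s\<close> first differ at a letter inside both of them, so
  the comparison is settled before the appended words begin.\<close>

lemma less_append_of_not_prefix:
  fixes u s :: "'a::linorder list"
  assumes "u < s" "\<not> prefix u s"
  shows "u @ a < s @ b"
  using assms
proof (induction u arbitrary: s)
  case (Cons x u)
  then show ?case by (cases s) auto
qed auto

lemma append_less_append_eq_length:
  fixes u u' :: "'a::linorder list"
  assumes "length u = length u'" "u < u'"
  shows "u @ a < u' @ b"
  using assms by (intro less_append_of_not_prefix) (auto simp: prefix_def)

lemma append_le_append_eq_length:
  fixes u u' :: "'a::linorder list"
  assumes "length u = length u'" "u \<le> u'" "v \<le> v'"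
  shows "u @ v \<le> u' @ v'"
  using assms append_less_append_eq_length[of u u' v v'] by (auto simp: le_less)

definition lyndon :: "'a::linorder list \<Rightarrow> bool" where
  "lyndon w \<longleftrightarrow> w \<noteq> [] \<and> (\<forall>u v. w = u @ v \<and> u \<noteq> [] \<and> v \<noteq> [] \<longrightarrow> w < v)"

lemma lyndon_nonempty: "lyndon w \<Longrightarrow> w \<noteq> []"
  by (simp add: lyndon_def)

lemma lyndon_less_suffix: "lyndon (u @ v) \<Longrightarrow> u \<noteq> [] \<Longrightarrow> v \<noteq> [] \<Longrightarrow> u @ v < v"
  by (simp add: lyndon_def)

lemma lyndon_singleton [simp]: "lyndon [a]"
  by (auto simp: lyndon_def Cons_eq_append_conv)

lemma lyndon_append:
  assumes u: "lyndon u" and v: "lyndon v" and "u < v"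
  shows "lyndon (u @ v)"
proof -
  \<comment> \<open>The suffix \<open>v\<close> is the critical one: a longer suffix
    \<open>t @ v\<close> is settled by comparing \<open>u\<close> with \<open>t\<close>, and a
    shorter one lies above \<open>v\<close>.\<close>
  have uv: "u @ v < v"
  proof (cases "prefix u v")
    case True
    then obtain t where t: "v = u @ t" by (auto simp: prefix_def)
    with \<open>u < v\<close> have "t \<noteq> []" by auto
    then have "v < t" using v t u lyndon_less_suffix lyndon_nonempty by blast
    then show ?thesis using t by (metis less_append_left_iff)
  next
    case False
    then show ?thesis using less_append_of_not_prefix[OF \<open>u < v\<close>, of v "[]"] by simp
  qed
  show ?thesis unfolding lyndon_def
  proof (intro conjI allI impI)
    show "u @ v \<noteq> []" using u lyndon_nonempty by auto
    fix a s assume "u @ v = a @ s \<and> a \<noteq> [] \<and> s \<noteq> []"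
    then have e: "u @ v = a @ s" and ne: "a \<noteq> []" "s \<noteq> []" by auto
    from e obtain t where "u = a @ t \<and> t @ v = s \<or> u @ t = a \<and> v = t @ s"
      by (auto simp: append_eq_append_conv2)
    then show "u @ v < s"
    proof
      assume t: "u = a @ t \<and> t @ v = s"
      show ?thesis
      proof (cases "t = []")
        case True
        then show ?thesis using t uv by auto
      next
        case False
        then have "u < t" using u t ne lyndon_less_suffix by blast
        moreover have "\<not> prefix u t" using t ne by (auto dest: prefix_length_le)
        ultimately show ?thesis using t less_append_of_not_prefix by blast
      qed
    next
      assume t: "u @ t = a \<and> v = t @ s"
      show ?thesis
      proof (cases "t = []")
        case True
        then show ?thesis using t uv by auto
      next
        case False
        then have "v < s" using v t ne lyndon_less_suffix by blast
        then show ?thesis using uv by auto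
      qed
    qed
  qed
qed

section \<open>The standard factorization of a Lyndon word\<close>

definition proper_suffixes :: "'a list \<Rightarrow> 'a list set" where
  "proper_suffixes w = {v. v \<noteq> [] \<and> (\<exists>u. u \<noteq> [] \<and> w = u @ v)}"

text \<open>For words of length at least 2 the least proper suffix \<open>v\<close> is also the
  longest proper Lyndon suffix, since a longer one \<open>t @ v\<close> lies above its own suffix
  \<open>v\<close>. Together with \<open>std_prefix\<close> it gives the classical standard
  factorization.\<close>

definition std_suffix :: "'a::linorder list \<Rightarrow> 'a list" where
  "std_suffix w = Min (proper_suffixes w)"

definition std_prefix :: "'a::linorder list \<Rightarrow> 'a list" where
  "std_prefix w = take (length w - length (std_suffix w)) w"

lemma finite_proper_suffixes: "finite (proper_suffixes w)"
proof (rule finite_subset)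
  show "proper_suffixes w \<subseteq> set (suffixes w)"
    by (auto simp: proper_suffixes_def suffix_def)
qed simp

lemma std_suffix_in:
  assumes "2 \<le> length w"
  shows "std_suffix w \<in> proper_suffixes w"
  unfolding std_suffix_def
proof (rule Min_in[OF finite_proper_suffixes])
  have "w = [hd w] @ tl w" "tl w \<noteq> []" using assms by (cases w; auto simp: Suc_le_eq)+
  then show "proper_suffixes w \<noteq> {}" unfolding proper_suffixes_def by blast
qed

lemma std_suffix_le: "v \<in> proper_suffixes w \<Longrightarrow> std_suffix w \<le> v"
  unfolding std_suffix_def by (rule Min_le[OF finite_proper_suffixes])

lemma std_factorization:
  assumes "2 \<le> length w"
  shows "w = std_prefix w @ std_suffix w" "std_prefix w \<noteq> []" "std_suffix w \<noteq> []"
proof -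
  obtain u where "u \<noteq> []" "w = u @ std_suffix w" "std_suffix w \<noteq> []"
    using std_suffix_in[OF assms] by (auto simp: proper_suffixes_def)
  moreover from this have "std_prefix w = u"
    unfolding std_prefix_def by (metis append_eq_conv_conj diff_add_inverse2 length_append)
  ultimately show "w = std_prefix w @ std_suffix w" "std_prefix w \<noteq> []" "std_suffix w \<noteq> []"
    by auto
qed

lemma length_std_factors:
  assumes "2 \<le> length w"
  shows "length (std_prefix w) < length w" "length (std_suffix w) < length w"
    "length (std_prefix w) + length (std_suffix w) = length w"
  using std_factorization[OF assms] by (metis length_append length_greater_0_conv less_add_same_cancel1 less_add_same_cancel2)+

text \<open>Proper suffixes of the least proper suffix are again proper suffixes of
  \<open>w\<close>, hence larger.\<close>

lemma lyndon_std_suffix: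
  assumes "2 \<le> length w"
  shows "lyndon (std_suffix w)"
  unfolding lyndon_def
proof (intro conjI allI impI)
  note f = std_factorization[OF assms]
  show "std_suffix w \<noteq> []" by (rule f(3))
  fix u v assume uv: "std_suffix w = u @ v \<and> u \<noteq> [] \<and> v \<noteq> []"
  then have "w = (std_prefix w @ u) @ v" using f(1) by simp
  then have "v \<in> proper_suffixes w" using uv unfolding proper_suffixes_def by blast
  then have "std_suffix w \<le> v" by (rule std_suffix_le)
  moreover have "std_suffix w \<noteq> v" using uv by auto
  ultimately show "std_suffix w < v" by simp
qed

lemma std_prefix_less:
  assumes "lyndon w" "2 \<le> length w"
  shows "std_prefix w < std_suffix w"
proof -
  note f = std_factorization[OF assms(2)]
  have "w < std_suffix w" using f assms(1) by (metis lyndon_less_suffix)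
  moreover have "std_prefix w \<le> w" using f(1) le_append_self by metis
  ultimately show ?thesis by simp
qed

text \<open>Suppose a proper suffix \<open>s\<close> of the prefix \<open>u\<close> were smaller
  than \<open>u\<close>. If \<open>s\<close> is no prefix of \<open>u\<close>, then
  \<open>s @ v < w\<close>, against the Lyndon property of \<open>w\<close>. If
  \<open>u = s @ t\<close>, cancelling \<open>s\<close> in \<open>w < s @ v\<close> gives
  \<open>t @ v < v\<close>, against the minimality of \<open>v\<close>.\<close>

lemma lyndon_std_prefix:
  assumes "lyndon w" "2 \<le> length w"
  shows "lyndon (std_prefix w)"
  unfolding lyndon_def
proof (intro conjI allI impI)
  define v where "v = std_suffix w"
  define u where "u = std_prefix w"
  have f: "w = u @ v" "u \<noteq> []" "v \<noteq> []" using std_factorization[OF assms(2)] unfolding u_def v_def by auto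
  show "std_prefix w \<noteq> []" using f(2) by (simp add: u_def)
  fix a s assume as: "std_prefix w = a @ s \<and> a \<noteq> [] \<and> s \<noteq> []"
  then have u: "u = a @ s" "a \<noteq> []" "s \<noteq> []" by (auto simp: u_def)
  have ws: "w < s @ v" using lyndon_less_suffix[of a "s @ v"] assms(1) f u by auto
  have "u < s"
  proof (rule ccontr)
    assume "\<not> u < s"
    moreover have "u \<noteq> s" using u by auto
    ultimately have su: "s < u" by simp
    show False
    proof (cases "prefix s u")
      case True
      then obtain t where t: "u = s @ t" by (auto simp: prefix_def)
      then have "t \<noteq> []" using su by auto
      have "t @ v < v" using ws t f by simp
      moreover have "v \<le> t @ v"
        unfolding v_def
      proof (rule std_suffix_le)
        show "t @ std_suffix w \<in> proper_suffixes w"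
          using t f u unfolding proper_suffixes_def v_def by auto
      qed
      ultimately show False by simp
    next
      case False
      then show False using less_append_of_not_prefix[OF su False, of v v] ws f by simp
    qed
  qed
  then show "std_prefix w < s" by (simp add: u_def)
qed

text \<open>A criterion for the commutator of the bracketings of \<open>u\<close> and
  \<open>v\<close> to be itself a bracketing, namely that of \<open>u @ v\<close>.\<close>

lemma std_suffix_append:
  assumes "lyndon v" "u \<noteq> []" "length u = 1 \<or> 2 \<le> length u \<and> v \<le> std_suffix u"
  shows "std_suffix (u @ v) = v"
  unfolding std_suffix_def
proof (rule Min_eqI[OF finite_proper_suffixes])
  show "v \<in> proper_suffixes (u @ v)"
    using assms lyndon_nonempty by (auto simp: proper_suffixes_def)
  fix y assume "y \<in> proper_suffixes (u @ v)"
  then obtain a where a: "y \<noteq> []" "a \<noteq> []" "u @ v = a @ y" by (auto simp: proper_suffixes_def)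
  then obtain t where "u = a @ t \<and> t @ v = y \<or> u @ t = a \<and> v = t @ y"
    by (auto simp: append_eq_append_conv2)
  then show "v \<le> y"
  proof
    assume t: "u = a @ t \<and> t @ v = y"
    show ?thesis
    proof (cases "t = []")
      case False
      then have "t \<in> proper_suffixes u" using t a by (auto simp: proper_suffixes_def)
      moreover have "2 \<le> length u" using t a False by (cases a; cases t) auto
      ultimately have "v \<le> t" using assms(3) std_suffix_le[of t u] by auto
      also have "t \<le> y" using t le_append_self by blast
      finally show ?thesis .
    qed (use t in auto)
  next
    assume t: "u @ t = a \<and> v = t @ y"
    then show ?thesis using lyndon_less_suffix[of t y] assms(1) a by (cases "t = []") auto
  qed
qed

lemma std_prefix_append:
  assumes "std_suffix (u @ v) = v"
  shows "std_prefix (u @ v) = u"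
  by (simp add: std_prefix_def assms)

section \<open>Powers of words\<close>

definition word_power :: "'a list \<Rightarrow> nat \<Rightarrow> 'a list" where
  "word_power w n = concat (replicate n w)"

lemma word_power_0 [simp]: "word_power w 0 = []"
  and word_power_Suc [simp]: "word_power w (Suc n) = w @ word_power w n"
  by (simp_all add: word_power_def)

lemma length_word_power [simp]: "length (word_power w n) = n * length w"
  by (induction n) auto

lemma set_word_power: "set (word_power w n) \<subseteq> set w"
  by (induction n) auto

lemma word_power_add: "word_power w (m + n) = word_power w m @ word_power w n"
  by (induction m) auto

lemma word_power_mult: "word_power w (m * n) = word_power (word_power w m) n"
  by (induction n) (auto simp: word_power_add)

lemma word_power_inj:
  assumes "word_power u n = word_power v n" "0 < n"
  shows "u = v"
proof -
  have "length u = length v" using arg_cong[OF assms(1), of length] assms(2) by simp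
  moreover obtain m where "n = Suc m" using assms(2) by (cases n) auto
  ultimately show ?thesis using assms(1) by simp
qed

text \<open>The last factor \<open>w\<close> is a proper suffix, yet it is also a prefix and so
  cannot be larger.\<close>

lemma not_lyndon_word_power:
  assumes "2 \<le> n" "w \<noteq> []"
  shows "\<not> lyndon (word_power w n)"
proof
  assume l: "lyndon (word_power w n)"
  obtain m where m: "n = Suc (Suc m)" using assms(1) by (metis add_2_eq_Suc le_Suc_ex)
  have c: "word_power w n = word_power w (Suc m) @ w" using word_power_add[of w "Suc m" 1] m by simp
  then have "word_power w n < w" using l assms(2) lyndon_less_suffix[of "word_power w (Suc m)" w] by simp
  moreover have "w \<le> word_power w n" using m le_append_self by simp
  ultimately show False by simp
qed

text \<open>Cancelling the smaller exponent presents one word as a power of the other, and a Lyndon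
  word is not a proper power. This keeps the leading words of different factors apart.\<close>

lemma lyndon_word_power_eq:
  assumes "lyndon u" "lyndon v" "2 \<le> (q::nat)" "word_power u (q ^ i) = word_power v (q ^ j)"
  shows "u = v"
proof -
  have *: "u = v" if "lyndon u" "lyndon v" "i \<le> j" "word_power u (q ^ i) = word_power v (q ^ j)"
    for u v :: "'a list" and i j
  proof -
    have "q ^ j = q ^ (j - i) * q ^ i" using that(3) by (simp flip: power_add)
    then have "word_power u (q ^ i) = word_power (word_power v (q ^ (j - i))) (q ^ i)"
      using that(4) by (simp add: word_power_mult)
    then have eq: "u = word_power v (q ^ (j - i))"
      by (rule word_power_inj) (use assms(3) in auto)
    have "j - i = 0"
    proof (rule ccontr)
      assume "j - i \<noteq> 0"
      then have "q ^ 1 \<le> q ^ (j - i)" using assms(3) by (intro power_increasing) auto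
      then have "2 \<le> q ^ (j - i)" using assms(3) by simp
      then show False using not_lyndon_word_power eq that(1,2) lyndon_nonempty by metis
    qed
    then show ?thesis using eq by simp
  qed
  show ?thesis
  proof (cases "i \<le> j")
    case True
    then show ?thesis using *[of u v i j] assms by blast
  next
    case False
    then show ?thesis using *[of v u j i] assms by (metis nat_le_linear)
  qed
qed


section \<open>Noncommutative power series\<close>

text \<open>Coefficients stay in the integers, so that one type serves every prime; congruences
  modulo \<open>p\<close> are expressed by \<open>ncps_ideal\<close> and
  \<open>leads\<close>.\<close>

typedef 'a ncps = "UNIV :: ('a list \<Rightarrow> int) set"
  morphisms ncps_nth Abs_ncps by simp

setup_lifting type_definition_ncps

lemma ncps_eqI: "(\<And>w. ncps_nth f w = ncps_nth g w) \<Longrightarrow> f = g"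
  by (simp add: ncps_nth_inject[symmetric] ext)

text \<open>Both sides sum over the ways to cut a word at two places; this yields associativity of
  the product of series.\<close>

lemma sum_splits_reindex:
  fixes F :: "nat \<Rightarrow> nat \<Rightarrow> 'b::comm_monoid_add"
  shows "(\<Sum>i\<le>n. \<Sum>j\<le>i. F j i) = (\<Sum>j\<le>n. \<Sum>k\<le>n - j. F j (j + k))"
proof -
  have "(\<Sum>i\<le>n. \<Sum>j\<le>i. F j i) = (\<Sum>j\<le>n. \<Sum>i\<in>{j..n}. F j i)"
    unfolding sum.Sigma[OF finite_atMost ballI[OF finite_atMost]]
      sum.Sigma[OF finite_atMost ballI[OF finite_atLeastAtMost]]
    by (rule sum.reindex_bij_witness[of _ "\<lambda>(j, i). (i, j)" "\<lambda>(i, j). (j, i)"]) auto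
  also have "\<dots> = (\<Sum>j\<le>n. \<Sum>k\<le>n - j. F j (j + k))"
  proof (rule sum.cong[OF refl])
    fix j assume "j \<in> {..n}"
    then show "(\<Sum>i\<in>{j..n}. F j i) = (\<Sum>k\<le>n - j. F j (j + k))"
      by (intro sum.reindex_bij_witness[of _ "\<lambda>k. j + k" "\<lambda>i. i - j"]) auto
  qed
  finally show ?thesis .
qed

instantiation ncps :: (type) ring_1
begin

lift_definition zero_ncps :: "'a ncps" is "\<lambda>w. 0" .
lift_definition one_ncps :: "'a ncps" is "\<lambda>w. if w = [] then 1 else 0" .
lift_definition plus_ncps :: "'a ncps \<Rightarrow> 'a ncps \<Rightarrow> 'a ncps" is "\<lambda>f g w. f w + g w" .
lift_definition minus_ncps :: "'a ncps \<Rightarrow> 'a ncps \<Rightarrow> 'a ncps" is "\<lambda>f g w. f w - g w" .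
lift_definition uminus_ncps :: "'a ncps \<Rightarrow> 'a ncps" is "\<lambda>f w. - f w" .
lift_definition times_ncps :: "'a ncps \<Rightarrow> 'a ncps \<Rightarrow> 'a ncps" is
  "\<lambda>f g w. \<Sum>i\<le>length w. f (take i w) * g (drop i w)" .

instance
proof
  fix a b c :: "'a ncps"
  show "a + b + c = a + (b + c)" "a + b = b + a" "0 + a = a" "- a + a = 0" "a - b = a + - b"
    by (transfer; simp add: fun_eq_iff)+
  show "a * b * c = a * (b * c)"
  proof (transfer, rule ext)
    fix f g h :: "'a list \<Rightarrow> int" and w
    have "(\<Sum>i\<le>length w. (\<Sum>j\<le>length (take i w). f (take j (take i w)) * g (drop j (take i w))) * h (drop i w))
      = (\<Sum>i\<le>length w. \<Sum>j\<le>i. f (take j w) * g (take (i - j) (drop j w)) * h (drop i w))"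
      by (intro sum.cong refl) (auto simp: sum_distrib_right min_def drop_take intro!: sum.cong)
    also have "\<dots> = (\<Sum>j\<le>length w. \<Sum>k\<le>length w - j. f (take j w) * g (take k (drop j w)) * h (drop (j + k) w))"
      by (subst sum_splits_reindex) simp
    also have "\<dots> = (\<Sum>j\<le>length w. f (take j w) * (\<Sum>k\<le>length (drop j w). g (take k (drop j w)) * h (drop k (drop j w))))"
      by (intro sum.cong refl) (auto simp: sum_distrib_left mult.assoc add.commute)
    finally show "(\<Sum>i\<le>length w. (\<Sum>j\<le>length (take i w). f (take j (take i w)) * g (drop j (take i w))) * h (drop i w))
      = (\<Sum>j\<le>length w. f (take j w) * (\<Sum>k\<le>length (drop j w). g (take k (drop j w)) * h (drop k (drop j w))))" .
  qed
  show "1 * a = a"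
  proof (transfer, rule ext)
    fix f :: "'a list \<Rightarrow> int" and w
    have "(\<Sum>i\<le>length w. (if take i w = [] then 1 else 0) * f (drop i w))
      = (\<Sum>i\<in>{0}. (if take i w = [] then 1 else 0) * f (drop i w))"
      by (rule sum.mono_neutral_right) auto
    then show "(\<Sum>i\<le>length w. (if take i w = [] then 1 else 0) * f (drop i w)) = f w" by simp
  qed
  show "a * 1 = a"
  proof (transfer, rule ext)
    fix f :: "'a list \<Rightarrow> int" and w
    have "(\<Sum>i\<le>length w. f (take i w) * (if drop i w = [] then 1 else 0))
      = (\<Sum>i\<in>{length w}. f (take i w) * (if drop i w = [] then 1 else 0))"
      by (rule sum.mono_neutral_right) auto
    then show "(\<Sum>i\<le>length w. f (take i w) * (if drop i w = [] then 1 else 0)) = f w" by simp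
  qed
  show "(a + b) * c = a * c + b * c"
    by (transfer, rule ext) (simp add: distrib_right sum.distrib)
  show "a * (b + c) = a * b + a * c"
    by (transfer, rule ext) (simp add: distrib_left sum.distrib)
  show "0 \<noteq> (1 :: 'a ncps)"
    by transfer (auto simp: fun_eq_iff)
qed

end

lemma ncps_nth_0 [simp]: "ncps_nth 0 w = 0"
  and ncps_nth_1: "ncps_nth 1 w = (if w = [] then 1 else 0)"
  and ncps_nth_add [simp]: "ncps_nth (f + g) w = ncps_nth f w + ncps_nth g w"
  and ncps_nth_diff [simp]: "ncps_nth (f - g) w = ncps_nth f w - ncps_nth g w"
  and ncps_nth_uminus [simp]: "ncps_nth (- f) w = - ncps_nth f w"
  by (transfer; simp)+

lemma ncps_nth_mult:
  "ncps_nth (f * g) w = (\<Sum>i\<le>length w. ncps_nth f (take i w) * ncps_nth g (drop i w))"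
  by transfer simp

lemma ncps_nth_sum [simp]: "ncps_nth (sum f A) w = (\<Sum>a\<in>A. ncps_nth (f a) w)"
  by (induction A rule: infinite_finite_induct) auto

lemma ncps_nth_of_nat: "ncps_nth (of_nat n) w = (if w = [] then int n else 0)"
  by (induction n) (auto simp: ncps_nth_1)

lemma ncps_nth_of_int: "ncps_nth (of_int n) w = (if w = [] then n else 0)"
  by (cases n) (auto simp: ncps_nth_of_nat ncps_nth_1)

lemma ncps_nth_of_int_mult [simp]: "ncps_nth (of_int n * f) w = n * ncps_nth f w"
proof -
  have "ncps_nth (of_int n * f) w = (\<Sum>i\<in>{0}. ncps_nth (of_int n) (take i w) * ncps_nth f (drop i w))"
    unfolding ncps_nth_mult by (rule sum.mono_neutral_right) (auto simp: ncps_nth_of_int)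
  then show ?thesis by (simp add: ncps_nth_of_int)
qed

lift_definition ncps_var :: "'a \<Rightarrow> 'a ncps" is "\<lambda>i w. if w = [i] then 1 else 0" .

lemma ncps_nth_var: "ncps_nth (ncps_var i) w = (if w = [i] then 1 else 0)"
  by transfer simp

lemma ncps_nth_mult_Nil [simp]: "ncps_nth (f * g) [] = ncps_nth f [] * ncps_nth g []"
  by (simp add: ncps_nth_mult)

lemma ncps_nth_var_Nil [simp]: "ncps_nth (ncps_var i) [] = 0"
  by (simp add: ncps_nth_var)

text \<open>Right multiplication by a variable appends a letter; this is how Fox derivatives will
  strip words from the right.\<close>

lemma ncps_nth_mult_var_snoc [simp]:
  "ncps_nth (f * ncps_var i) (w @ [j]) = (if i = j then ncps_nth f w else 0)"
proof -
  have "ncps_nth (f * ncps_var i) (w @ [j])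
    = (\<Sum>k\<in>{length w}. ncps_nth f (take k (w @ [j])) * ncps_nth (ncps_var i) (drop k (w @ [j])))"
    unfolding ncps_nth_mult
  proof (rule sum.mono_neutral_right)
    have "k = length w" if "drop k (w @ [j]) = [i]" for k
      using arg_cong[OF that, of length] by simp
    then show "\<forall>k\<in>{..length (w @ [j])} - {length w}. ncps_nth f (take k (w @ [j])) * ncps_nth (ncps_var i) (drop k (w @ [j])) = 0"
      by (auto simp: ncps_nth_var)
  qed auto
  then show ?thesis by (simp add: ncps_nth_var)
qed

text \<open>The inverse \<open>\<Sum>\<^sub>m (-w\<^sub>i)\<^sup>m\<close> of \<open>1 + w\<^sub>i\<close>.\<close>

lift_definition ncps_inv_var :: "'a \<Rightarrow> 'a ncps" is
  "\<lambda>i w. if set w \<subseteq> {i} then (-1) ^ length w else 0" .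

lemma ncps_nth_inv_var: "ncps_nth (ncps_inv_var i) w = (if set w \<subseteq> {i} then (-1) ^ length w else 0)"
  by transfer simp

lemma ncps_inv_var_left: "ncps_inv_var i * (1 + ncps_var i) = 1"
proof (rule ncps_eqI)
  fix w show "ncps_nth (ncps_inv_var i * (1 + ncps_var i)) w = ncps_nth 1 w"
    by (cases w rule: rev_cases) (auto simp: distrib_left ncps_nth_inv_var ncps_nth_1)
qed

lemma ncps_nth_var_mult_Cons:
  "ncps_nth (ncps_var i * f) (j # w) = (if i = j then ncps_nth f w else 0)"
proof -
  have "ncps_nth (ncps_var i * f) (j # w)
    = (\<Sum>k\<in>{1}. ncps_nth (ncps_var i) (take k (j # w)) * ncps_nth f (drop k (j # w)))"
    unfolding ncps_nth_mult
  proof (rule sum.mono_neutral_right)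
    have "k = 1" if "take k (j # w) = [i]" "k \<le> length (j # w)" for k
      using arg_cong[OF that(1), of length] that(2) by (simp split: if_splits)
    then show "\<forall>k\<in>{..length (j # w)} - {1}. ncps_nth (ncps_var i) (take k (j # w)) * ncps_nth f (drop k (j # w)) = 0"
      by (auto simp: ncps_nth_var)
  qed auto
  then show ?thesis by (simp add: ncps_nth_var)
qed

lemma ncps_inv_var_right: "(1 + ncps_var i) * ncps_inv_var i = 1"
proof (rule ncps_eqI)
  fix w show "ncps_nth ((1 + ncps_var i) * ncps_inv_var i) w = ncps_nth 1 w"
    by (cases w) (auto simp: distrib_right ncps_nth_var_mult_Cons ncps_nth_inv_var ncps_nth_1 ncps_nth_var)
qed

text \<open>The two-sided ideal of series that vanish modulo \<open>p\<close> below degree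
  \<open>k\<close>. The letter type can exceed the alphabet, hence the restriction to words over
  \<open>I\<close>.\<close>

definition ncps_ideal :: "'a set \<Rightarrow> int \<Rightarrow> nat \<Rightarrow> 'a ncps set" where
  "ncps_ideal I p k = {f. \<forall>w\<in>lists I. length w < k \<longrightarrow> p dvd ncps_nth f w}"

lemma ncps_idealI: "(\<And>w. w \<in> lists I \<Longrightarrow> length w < k \<Longrightarrow> p dvd ncps_nth f w) \<Longrightarrow> f \<in> ncps_ideal I p k"
  by (simp add: ncps_ideal_def)

lemma ncps_idealD: "f \<in> ncps_ideal I p k \<Longrightarrow> w \<in> lists I \<Longrightarrow> length w < k \<Longrightarrow> p dvd ncps_nth f w"
  by (simp add: ncps_ideal_def)

lemma ncps_ideal_0 [simp]: "0 \<in> ncps_ideal I p k"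
  by (simp add: ncps_ideal_def)

lemma ncps_ideal_add: "f \<in> ncps_ideal I p k \<Longrightarrow> g \<in> ncps_ideal I p k \<Longrightarrow> f + g \<in> ncps_ideal I p k"
  by (simp add: ncps_ideal_def)

lemma ncps_ideal_uminus: "f \<in> ncps_ideal I p k \<Longrightarrow> - f \<in> ncps_ideal I p k"
  by (simp add: ncps_ideal_def)

lemma ncps_ideal_diff: "f \<in> ncps_ideal I p k \<Longrightarrow> g \<in> ncps_ideal I p k \<Longrightarrow> f - g \<in> ncps_ideal I p k"
  by (simp add: ncps_ideal_def)

lemma ncps_ideal_sum: "(\<And>a. a \<in> A \<Longrightarrow> f a \<in> ncps_ideal I p k) \<Longrightarrow> sum f A \<in> ncps_ideal I p k"
  by (induction A rule: infinite_finite_induct) (auto intro: ncps_ideal_add)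

lemma ncps_ideal_mono: "k' \<le> k \<Longrightarrow> f \<in> ncps_ideal I p k \<Longrightarrow> f \<in> ncps_ideal I p k'"
  by (auto simp: ncps_ideal_def)

text \<open>Every cut of a word shorter than \<open>k + l\<close> leaves a left piece shorter than
  \<open>k\<close> or a right piece shorter than \<open>l\<close>.\<close>

lemma ncps_ideal_mult:
  assumes "f \<in> ncps_ideal I p k" "g \<in> ncps_ideal I p l"
  shows "f * g \<in> ncps_ideal I p (k + l)"
proof (rule ncps_idealI)
  fix w assume w: "w \<in> lists I" "length w < k + l"
  have "p dvd ncps_nth f (take i w) * ncps_nth g (drop i w)" if "i \<le> length w" for i
  proof (cases "i < k")
    case True
    have "take i w \<in> lists I" using w(1) by (auto dest: in_set_takeD)
    then show ?thesis using ncps_idealD[OF assms(1), of "take i w"] True that by auto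
  next
    case False
    have "drop i w \<in> lists I" using w(1) by (auto dest: in_set_dropD)
    moreover have "length (drop i w) < l" using w(2) False that by simp
    ultimately show ?thesis using ncps_idealD[OF assms(2), of "drop i w"] by simp
  qed
  then show "p dvd ncps_nth (f * g) w"
    unfolding ncps_nth_mult by (auto intro: dvd_sum)
qed

lemma ncps_ideal_zero [simp]: "f \<in> ncps_ideal I p 0"
  by (simp add: ncps_ideal_def)

lemma ncps_ideal_mult_left: "g \<in> ncps_ideal I p k \<Longrightarrow> f * g \<in> ncps_ideal I p k"
  using ncps_ideal_mult[of f I p 0 g k] by simp

lemma ncps_ideal_mult_right: "f \<in> ncps_ideal I p k \<Longrightarrow> f * g \<in> ncps_ideal I p k"
  using ncps_ideal_mult[of f I p k g 0] by simp

lemma ncps_ideal_of_int: "p dvd n \<Longrightarrow> of_int n * f \<in> ncps_ideal I p k"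
  by (simp add: ncps_ideal_def)

lemma ncps_ideal_of_nat: "p dvd int n \<Longrightarrow> of_nat n * f \<in> ncps_ideal I p k"
  using ncps_ideal_of_int[of p "int n" f I k] by simp

lemma ncps_ideal_power:
  assumes "f \<in> ncps_ideal I p k"
  shows "f ^ n \<in> ncps_ideal I p (n * k)"
  by (induction n) (auto intro: ncps_ideal_mult[OF assms])

text \<open>Valid in a noncommutative ring because only powers of the single element
  \<open>y\<close> occur and integers are central.\<close>

lemma binomial_power:
  fixes y :: "'r::ring_1"
  shows "(1 + y) ^ n = (\<Sum>k\<le>n. of_nat (n choose k) * y ^ k)"
proof (induction n)
  case (Suc n)
  have *: "y * (of_nat c * y ^ k) = of_nat c * y ^ Suc k" for c k
    by (metis mult.assoc mult_of_nat_commute power_Suc)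
  have "(1 + y) ^ Suc n = (1 + y) * (1 + y) ^ n" by simp
  also have "\<dots> = (\<Sum>k\<le>n. of_nat (n choose k) * y ^ k) + (\<Sum>k\<le>n. of_nat (n choose k) * y ^ Suc k)"
    unfolding Suc.IH distrib_right sum_distrib_left * by (simp add: sum.distrib)
  also have "(\<Sum>k\<le>n. of_nat (n choose k) * y ^ k) = (\<Sum>k\<le>Suc n. of_nat (n choose k) * y ^ k)"
    by (subst sum.atMost_Suc) (simp add: binomial_eq_0)
  also have "\<dots> = 1 + (\<Sum>k\<le>n. of_nat (n choose Suc k) * y ^ Suc k)"
    by (subst sum.atMost_Suc_shift) simp
  also have "\<dots> + (\<Sum>k\<le>n. of_nat (n choose k) * y ^ Suc k)
    = 1 + (\<Sum>k\<le>n. of_nat (Suc n choose Suc k) * y ^ Suc k)"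
    by (simp add: sum.distrib[symmetric] distrib_right algebra_simps)
  also have "\<dots> = (\<Sum>k\<le>Suc n. of_nat (Suc n choose k) * y ^ k)"
    by (subst sum.atMost_Suc_shift) simp
  finally show ?case .
qed simp

text \<open>Here the bound on the ideal is irrelevant: the difference is divisible by \<open>p\<close>.\<close>

lemma freshman_ncps:
  fixes y :: "'a ncps"
  assumes "prime p"
  shows "(1 + y) ^ p - (1 + y ^ p) \<in> ncps_ideal I (int p) k"
proof -
  have "(1 + y) ^ p = (\<Sum>k\<in>{0, p} \<union> {1..<p}. of_nat (p choose k) * y ^ k)"
    unfolding binomial_power by (rule sum.cong) auto
  also have "\<dots> = (\<Sum>k\<in>{0, p}. of_nat (p choose k) * y ^ k) + (\<Sum>k\<in>{1..<p}. of_nat (p choose k) * y ^ k)"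
    by (rule sum.union_disjoint) auto
  also have "(\<Sum>k\<in>{0, p}. of_nat (p choose k) * y ^ k) = 1 + y ^ p"
    using prime_gt_0_nat[OF assms] by simp
  finally have "(1 + y) ^ p - (1 + y ^ p) = (\<Sum>k\<in>{1..<p}. of_nat (p choose k) * y ^ k)"
    by simp
  moreover have "int p dvd int (p choose k)" if "k \<in> {1..<p}" for k
    using that dvd_choose_prime[of k p] assms by simp
  ultimately show ?thesis
    by (auto intro!: ncps_ideal_sum ncps_ideal_of_nat)
qed

text \<open>The telescoping keeps powers of \<open>f\<close> on the left and powers of
  \<open>g\<close> on the right, so the two may fail to commute.\<close>

lemma ncps_ideal_power_cong:
  assumes "f - g \<in> ncps_ideal I p k"
  shows "f ^ n - g ^ n \<in> ncps_ideal I p k"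
proof (induction n)
  case (Suc n)
  have "f ^ Suc n - g ^ Suc n = f * (f ^ n - g ^ n) + (f - g) * g ^ n"
    by (simp add: algebra_simps)
  then show ?case using Suc assms
    by (auto intro: ncps_ideal_add ncps_ideal_mult_left ncps_ideal_mult_right)
qed simp

lemma frobenius_ncps:
  fixes y :: "'a ncps"
  assumes "prime p"
  shows "(1 + y) ^ (p ^ j) - (1 + y ^ (p ^ j)) \<in> ncps_ideal I (int p) k"
proof (induction j)
  case (Suc j)
  have "((1 + y) ^ (p ^ j)) ^ p - (1 + y ^ (p ^ j)) ^ p \<in> ncps_ideal I (int p) k"
    using Suc by (rule ncps_ideal_power_cong)
  moreover have "(1 + y ^ (p ^ j)) ^ p - (1 + (y ^ (p ^ j)) ^ p) \<in> ncps_ideal I (int p) k"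
    by (rule freshman_ncps[OF assms])
  ultimately have "((1 + y) ^ (p ^ j)) ^ p - (1 + y ^ (p ^ j)) ^ p
    + ((1 + y ^ (p ^ j)) ^ p - (1 + (y ^ (p ^ j)) ^ p)) \<in> ncps_ideal I (int p) k"
    by (rule ncps_ideal_add)
  then show ?case by (simp only: diff_add_cancel add_diff_eq flip: power_mult) (simp add: mult.commute)
qed simp

text \<open>The shortlex order. Unlike the lexicographic \<open><\<close> it is compatible with
  concatenation on both sides, so leading words of series multiply.\<close>

definition word_before :: "'a::linorder list \<Rightarrow> 'a list \<Rightarrow> bool" where
  "word_before v w \<longleftrightarrow> length v < length w \<or> length v = length w \<and> v < w"

text \<open>The coefficient \<open>c\<close> may be divisible by \<open>p\<close>: \<open>leads I p f w 0\<close> says that \<open>f\<close> vanishes modulo \<open>p\<close>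
  up to and including the word \<open>w\<close>.\<close>

definition leads :: "'a::linorder set \<Rightarrow> int \<Rightarrow> 'a ncps \<Rightarrow> 'a list \<Rightarrow> int \<Rightarrow> bool" where
  "leads I p f w c \<longleftrightarrow> (\<forall>v\<in>lists I. word_before v w \<longrightarrow> p dvd ncps_nth f v) \<and> p dvd ncps_nth f w - c"

lemma word_before_linear: "word_before v w \<or> v = w \<or> word_before w v"
  unfolding word_before_def by auto

lemma word_before_irrefl [simp]: "\<not> word_before w w"
  by (simp add: word_before_def)

lemma word_before_trans: "word_before u v \<Longrightarrow> word_before v w \<Longrightarrow> word_before u w"
  by (auto simp: word_before_def)

lemma word_before_append:
  assumes "\<not> word_before u u'" "\<not> word_before v v'"
  shows "\<not> word_before (u @ v) (u' @ v')" "u @ v = u' @ v' \<Longrightarrow> u = u' \<and> v = v'"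
proof -
  have len: "length u' \<le> length u" "length v' \<le> length v"
    using assms by (auto simp: word_before_def)
  show "\<not> word_before (u @ v) (u' @ v')"
  proof
    assume w: "word_before (u @ v) (u' @ v')"
    then have e: "length u = length u'" "length v = length v'" "u @ v < u' @ v'"
      using len by (auto simp: word_before_def)
    then have "u' \<le> u" "v' \<le> v" using assms by (auto simp: word_before_def not_less)
    then have "u' @ v' \<le> u @ v" using e append_le_append_eq_length[of u' u v' v] by simp
    with e(3) show False by simp
  qed
  show "u = u' \<and> v = v'" if "u @ v = u' @ v'"
  proof -
    have "length u = length u'" using len arg_cong[OF that, of length] by simp
    then show ?thesis using that by simp
  qed
qed

lemma leads_add: "leads I p f w a \<Longrightarrow> leads I p g w b \<Longrightarrow> leads I p (f + g) w (a + b)"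
  unfolding leads_def
  by (auto simp: algebra_simps dest: dvd_add[of p "ncps_nth f w - a" "ncps_nth g w - b"])

lemma leads_diff: "leads I p f w a \<Longrightarrow> leads I p g w b \<Longrightarrow> leads I p (f - g) w (a - b)"
  unfolding leads_def
  by (auto simp: algebra_simps dest: dvd_diff[of p "ncps_nth f w - a" "ncps_nth g w - b"])

lemma leads_uminus: "leads I p f w a \<Longrightarrow> leads I p (- f) w (- a)"
  using leads_diff[of I p 0 w 0 f a] by (simp add: leads_def)

lemma leads_weaken:
  assumes "leads I p f w a" "word_before v w" "v \<in> lists I"
  shows "leads I p f v 0"
  using assms word_before_trans[of _ v w] unfolding leads_def by (auto simp: in_lists_conv_set)

lemma leads_of_ideal:
  assumes "f \<in> ncps_ideal I p k" "length w < k" "w \<in> lists I"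
  shows "leads I p f w 0"
  using assms unfolding leads_def ncps_ideal_def by (auto simp: word_before_def)

lemma leads_mult:
  assumes f: "leads I p f u a" and g: "leads I p g v b" and "u \<in> lists I" "v \<in> lists I"
  shows "leads I p (f * g) (u @ v) (a * b)"
proof -
  \<comment> \<open>Every cut of an earlier word, and every cut of \<open>u @ v\<close> at a
    different place, has a left piece before \<open>u\<close> or a right piece before
    \<open>v\<close>, where one of the series vanishes modulo \<open>p\<close>.\<close>
  have *: "p dvd ncps_nth f (take i w) * ncps_nth g (drop i w)"
    if w: "w \<in> lists I" "i \<le> length w"
      and "word_before w (u @ v) \<or> w = u @ v \<and> i \<noteq> length u" for w i
  proof -
    have I: "take i w \<in> lists I" "drop i w \<in> lists I"
      using w(1) by (auto dest: in_set_takeD in_set_dropD)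
    have "word_before (take i w) u \<or> word_before (drop i w) v"
    proof (rule ccontr)
      assume n: "\<not> ?thesis"
      have "\<not> word_before w (u @ v)" using word_before_append(1)[of "take i w" u "drop i w" v] n by simp
      then have e: "w = u @ v" "i \<noteq> length u" using that(3) by auto
      then have "take i w = u" using word_before_append(2)[of "take i w" u "drop i w" v] n by (metis append_take_drop_id)
      then have "length (take i w) = length u" by simp
      with e w(2) show False by simp
    qed
    then show ?thesis using f g I by (auto simp: leads_def)
  qed
  have "p dvd ncps_nth (f * g) w" if "w \<in> lists I" "word_before w (u @ v)" for w
    unfolding ncps_nth_mult using * that by (auto intro!: dvd_sum)
  moreover have "p dvd ncps_nth (f * g) (u @ v) - a * b"
  proof -
    let ?t = "\<lambda>i. ncps_nth f (take i (u @ v)) * ncps_nth g (drop i (u @ v))"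
    have "ncps_nth (f * g) (u @ v) = ?t (length u) + (\<Sum>i\<in>{..length (u @ v)} - {length u}. ?t i)"
      unfolding ncps_nth_mult by (rule sum.remove) auto
    then have "ncps_nth (f * g) (u @ v) - a * b
      = (ncps_nth f u - a) * ncps_nth g v + a * (ncps_nth g v - b)
        + (\<Sum>i\<in>{..length (u @ v)} - {length u}. ?t i)"
      by (simp add: algebra_simps)
    moreover have "p dvd (\<Sum>i\<in>{..length (u @ v)} - {length u}. ?t i)"
    proof (rule dvd_sum)
      fix i assume "i \<in> {..length (u @ v)} - {length u}"
      then show "p dvd ?t i" using assms(3,4) by (intro *) auto
    qed
    moreover have "p dvd ncps_nth f u - a" "p dvd ncps_nth g v - b" using f g by (auto simp: leads_def)
    ultimately show ?thesis by auto
  qed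
  ultimately show ?thesis by (auto simp: leads_def)
qed

lemma leads_power:
  assumes "leads I p f u 1" "u \<in> lists I"
  shows "leads I p (f ^ n) (word_power u n) 1"
proof (induction n)
  case 0
  show ?case by (simp add: leads_def ncps_nth_1 word_before_def)
next
  case (Suc n)
  have "word_power u n \<in> lists I" using assms(2) set_word_power by fastforce
  from leads_mult[OF assms(1) Suc assms(2) this] show ?case by simp
qed


section \<open>Commutators and the lower central series\<close>

definition commutator :: "('g, 'm) monoid_scheme \<Rightarrow> 'g \<Rightarrow> 'g \<Rightarrow> 'g" where
  "commutator G a c = a \<otimes>\<^bsub>G\<^esub> c \<otimes>\<^bsub>G\<^esub> inv\<^bsub>G\<^esub> a \<otimes>\<^bsub>G\<^esub> inv\<^bsub>G\<^esub> c"

context group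
begin

lemma mult_inv_cancel_left:
  assumes "a \<in> carrier G" "c \<in> carrier G"
  shows "a \<otimes> (inv a \<otimes> c) = c" "inv a \<otimes> (a \<otimes> c) = c"
  using assms by (simp_all flip: m_assoc)

text \<open>Brings a product of elements and inverses into a right-nested form with adjacent
  inverses cancelled, so that identities valid in every group follow by rewriting.\<close>

lemmas group_word_simps = m_assoc inv_mult_group mult_inv_cancel_left

lemma commutator_closed [simp, intro]:
  "a \<in> carrier G \<Longrightarrow> c \<in> carrier G \<Longrightarrow> commutator G a c \<in> carrier G"
  by (simp add: commutator_def)

lemma inv_commutator:
  "a \<in> carrier G \<Longrightarrow> c \<in> carrier G \<Longrightarrow> inv (commutator G a c) = commutator G c a"
  by (simp add: commutator_def group_word_simps)

lemma commutator_self [simp]: "a \<in> carrier G \<Longrightarrow> commutator G a a = \<one>"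
  by (simp add: commutator_def group_word_simps)

lemma commutator_one [simp]:
  "a \<in> carrier G \<Longrightarrow> commutator G \<one> a = \<one>" "a \<in> carrier G \<Longrightarrow> commutator G a \<one> = \<one>"
  by (simp_all add: commutator_def group_word_simps)

text \<open>Bilinearity up to a deeper commutator. Written without conjugates, so that every
  correction is visibly a commutator and its depth can be read off.\<close>

lemma commutator_mult_left:
  assumes "a \<in> carrier G" "c \<in> carrier G" "d \<in> carrier G"
  shows "commutator G (a \<otimes> c) d
    = commutator G a (commutator G c d) \<otimes> commutator G c d \<otimes> commutator G a d"
  using assms by (simp add: commutator_def group_word_simps)

lemma commutator_mult_right:
  assumes "a \<in> carrier G" "c \<in> carrier G" "d \<in> carrier G"
  shows "commutator G d (a \<otimes> c)
    = commutator G d a \<otimes> (commutator G a (commutator G d c) \<otimes> commutator G d c)"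
  using assms by (simp add: commutator_def group_word_simps)

lemma commutator_inv_left:
  assumes "a \<in> carrier G" "d \<in> carrier G"
  shows "commutator G (inv a) d = commutator G (inv a) (commutator G d a) \<otimes> commutator G d a"
  using assms by (simp add: commutator_def group_word_simps)

text \<open>\<open>commutator G b c \<otimes> c\<close> is the conjugate of \<open>c\<close> by
  \<open>b\<close>, so this is the classical identity. The product form lets the extra commutator be
  split off again.\<close>

lemma hall_witt:
  assumes "a \<in> carrier G" "b \<in> carrier G" "c \<in> carrier G"
  shows "commutator G (commutator G a b) (commutator G b c \<otimes> c)
    \<otimes> commutator G (commutator G b c) (commutator G c a \<otimes> a)
    \<otimes> commutator G (commutator G c a) (commutator G a b \<otimes> b) = \<one>"
  using assms by (simp add: commutator_def group_word_simps)

lemma lower_central_Suc: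
  "1 \<le> k \<Longrightarrow> lower_central G (Suc k)
    = generate G {commutator G a c | a c. a \<in> carrier G \<and> c \<in> lower_central G k}"
  by (cases k) (simp_all add: commutator_def)

lemma normal_lower_central: "lower_central G k \<lhd> G"
proof (induction k)
  case 0
  show ?case by (simp add: normal_inv_iff subgroup_self)
next
  case (Suc k)
  show ?case
  proof (cases "k = 0")
    case True
    then show ?thesis by (simp add: normal_inv_iff subgroup_self)
  next
    case False
    have sub: "lower_central G k \<subseteq> carrier G"
      by (rule subgroup.subset[OF normal_imp_subgroup[OF Suc]])
    have "generate G {commutator G a c | a c. a \<in> carrier G \<and> c \<in> lower_central G k} \<lhd> G"
    proof (rule normal_generateI)
      show "{commutator G a c |a c. a \<in> carrier G \<and> c \<in> lower_central G k} \<subseteq> carrier G"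
        using sub by auto
      fix h g assume "h \<in> {commutator G a c |a c. a \<in> carrier G \<and> c \<in> lower_central G k}" and g: "g \<in> carrier G"
      then obtain a c where h: "h = commutator G a c" "a \<in> carrier G" "c \<in> lower_central G k" by auto
      have c: "c \<in> carrier G" using h sub by auto
      have "g \<otimes> h \<otimes> inv g = commutator G (g \<otimes> a \<otimes> inv g) (g \<otimes> c \<otimes> inv g)"
        unfolding h(1) using g h(2) c by (simp add: commutator_def group_word_simps)
      moreover have "g \<otimes> c \<otimes> inv g \<in> lower_central G k"
        using Suc g h(3) by (simp add: normal_inv_iff)
      moreover have "g \<otimes> a \<otimes> inv g \<in> carrier G" using g h by simp
      ultimately show "g \<otimes> h \<otimes> inv g \<in> {commutator G a c |a c. a \<in> carrier G \<and> c \<in> lower_central G k}"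
        by blast
    qed
    then show ?thesis using False lower_central_Suc[of k] by simp
  qed
qed

lemma subgroup_lower_central: "subgroup (lower_central G k) G"
  by (rule normal_imp_subgroup[OF normal_lower_central])

lemma lower_central_closed: "a \<in> lower_central G k \<Longrightarrow> a \<in> carrier G"
  by (rule subgroup.mem_carrier[OF subgroup_lower_central])

lemma lower_central_Suc_subset: "lower_central G (Suc k) \<subseteq> lower_central G k"
proof (cases "k = 0")
  case False
  show ?thesis
    proof (subst lower_central_Suc, use False in simp, rule generate_subgroup_incl[OF _ subgroup_lower_central])
    show "{commutator G a c |a c. a \<in> carrier G \<and> c \<in> lower_central G k} \<subseteq> lower_central G k"
    proof safe
      fix a c assume a: "a \<in> carrier G" "c \<in> lower_central G k"
      then have "a \<otimes> c \<otimes> inv a \<in> lower_central G k"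
        using normal_lower_central by (simp add: normal_inv_iff)
      moreover have "inv c \<in> lower_central G k"
        using a(2) by (rule subgroup.m_inv_closed[OF subgroup_lower_central])
      ultimately show "commutator G a c \<in> lower_central G k"
        unfolding commutator_def by (rule subgroup.m_closed[OF subgroup_lower_central])
    qed
  qed
qed simp

lemma lower_central_mono: "k \<le> l \<Longrightarrow> lower_central G l \<subseteq> lower_central G k"
  using lift_Suc_antimono_le[of "lower_central G", OF lower_central_Suc_subset] .

lemma commutator_lower_central_Suc:
  "1 \<le> k \<Longrightarrow> a \<in> carrier G \<Longrightarrow> c \<in> lower_central G k \<Longrightarrow> commutator G a c \<in> lower_central G (Suc k)"
  unfolding lower_central_Suc by (rule generate.incl) auto

lemma commutator_swap_in:
  assumes "subgroup H G" "commutator G a c \<in> H" "a \<in> carrier G" "c \<in> carrier G"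
  shows "commutator G c a \<in> H"
  using subgroup.m_inv_closed[OF assms(1,2)] assms inv_commutator by metis

text \<open>\<open>commutator G w (s \<otimes> t)\<close> is \<open>commutator G w t\<close> with a
  left factor in \<open>H\<close>. This removes the extra factors carried by the Hall--Witt
  identity.\<close>

lemma commutator_mult_right_in_iff:
  assumes "subgroup H G" "w \<in> carrier G" "s \<in> carrier G" "t \<in> carrier G"
    and "commutator G w s \<in> H" "commutator G s (commutator G w t) \<in> H"
  shows "commutator G w (s \<otimes> t) \<in> H \<longleftrightarrow> commutator G w t \<in> H"
proof -
  have cl: "commutator G w s \<in> carrier G" "commutator G s (commutator G w t) \<in> carrier G" "commutator G w t \<in> carrier G"
    using assms by auto
  define z where "z = commutator G w s \<otimes> commutator G s (commutator G w t)"
  have z: "z \<in> H" "z \<in> carrier G"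
    unfolding z_def using assms(5,6) cl subgroup.m_closed[OF assms(1)] by auto
  have e: "commutator G w (s \<otimes> t) = z \<otimes> commutator G w t"
    unfolding z_def using cl commutator_mult_right[OF assms(3,4,2)] by (simp add: m_assoc)
  have "commutator G w t = inv z \<otimes> (z \<otimes> commutator G w t)"
    using mult_inv_cancel_left(2)[OF z(2) cl(3)] by simp
  then show ?thesis
    unfolding e using z(1) subgroup.m_closed[OF assms(1)] subgroup.m_inv_closed[OF assms(1)] by metis
qed

text \<open>The Jacobi identity modulo \<open>H\<close>; the hypotheses \<open>corr\<close> absorb the error terms of the
  Hall--Witt identity.\<close>

lemma jacobi_in:
  assumes H: "subgroup H G" and cl: "a \<in> carrier G" "b \<in> carrier G" "c \<in> carrier G"
    and w: "u = commutator G a b" "v = commutator G b c" "w = commutator G c a"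
    and corr: "commutator G u v \<in> H" "commutator G v w \<in> H" "commutator G w u \<in> H"
      "commutator G v (commutator G u c) \<in> H" "commutator G w (commutator G v a) \<in> H"
      "commutator G u (commutator G w b) \<in> H"
    and in_H: "commutator G v a \<in> H" "commutator G w b \<in> H"
  shows "commutator G u c \<in> H"
proof -
  have uvw: "u \<in> carrier G" "v \<in> carrier G" "w \<in> carrier G" using w cl by auto
  have hw: "commutator G u (v \<otimes> c) \<otimes> commutator G v (w \<otimes> a) \<otimes> commutator G w (u \<otimes> b) = \<one>"
    unfolding w by (rule hall_witt[OF cl])
  have "commutator G v (w \<otimes> a) \<in> H" "commutator G w (u \<otimes> b) \<in> H"
    using commutator_mult_right_in_iff[OF H uvw(2,3) cl(1) corr(2,5)]
      commutator_mult_right_in_iff[OF H uvw(3,1) cl(2) corr(3,6)] in_H by auto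
  then have "inv (commutator G v (w \<otimes> a) \<otimes> commutator G w (u \<otimes> b)) \<in> H"
    by (intro subgroup.m_closed[OF H] subgroup.m_inv_closed[OF H])
  moreover have "commutator G u (v \<otimes> c) = inv (commutator G v (w \<otimes> a) \<otimes> commutator G w (u \<otimes> b))"
  proof (rule inv_equality[symmetric])
    show "commutator G u (v \<otimes> c) \<otimes> (commutator G v (w \<otimes> a) \<otimes> commutator G w (u \<otimes> b)) = \<one>"
      using hw uvw cl by (simp add: m_assoc)
  qed (use uvw cl in auto)
  ultimately show ?thesis
    using commutator_mult_right_in_iff[OF H uvw(1,2) cl(3) corr(1,4)] by simp
qed

text \<open>For a generator [b, d] of the next term, Hall--Witt trades [[b, d], c] for [[d, c], b]
  and [[c, b], d]. In both of these the inner or the outer commutator involves \<open>d\<close> of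
  depth \<open>i\<close>, where the induction hypothesis applies.\<close>

lemma commutator_lower_central:
  assumes "1 \<le> i" "1 \<le> j" "a \<in> lower_central G i" "c \<in> lower_central G j"
  shows "commutator G a c \<in> lower_central G (i + j)"
  using assms
proof (induction i arbitrary: j a c rule: nat_induct_at_least)
  case base
  then show ?case using commutator_lower_central_Suc by simp
next
  case (Suc i)
  define N where "N = lower_central G (Suc (i + j))"
  have sg: "subgroup N G" unfolding N_def by (rule subgroup_lower_central)
  have cc: "c \<in> carrier G" using Suc.prems lower_central_closed by blast
  have N_Suc: "commutator G u v \<in> N" if "u \<in> carrier G" "v \<in> lower_central G (i + j)" for u v
    unfolding N_def using that Suc.hyps by (intro commutator_lower_central_Suc) auto
  have N_sub: "v \<in> lower_central G (i + j)" if "v \<in> N" for v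
    using that lower_central_Suc_subset unfolding N_def by blast
  have main: "commutator G (commutator G b d) c \<in> N" if b: "b \<in> carrier G" "d \<in> lower_central G i" for b d
  proof -
    have d: "d \<in> carrier G" using b lower_central_closed by blast
    define u v w where "u = commutator G b d" and "v = commutator G d c" and "w = commutator G c b"
    have cl: "u \<in> carrier G" "v \<in> carrier G" "w \<in> carrier G"
      unfolding u_def v_def w_def using b d cc by auto
    have v: "v \<in> lower_central G (i + j)" unfolding v_def using Suc.IH[OF Suc.prems(1) b(2) Suc.prems(3)] .
    have u: "u \<in> lower_central G i"
      unfolding u_def using commutator_lower_central_Suc[OF Suc.hyps b] lower_central_Suc_subset by blast
    have "commutator G b c \<in> lower_central G (Suc j)"
      using commutator_lower_central_Suc[OF Suc.prems(1) b(1) Suc.prems(3)] .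
    then have w: "w \<in> lower_central G (Suc j)"
      unfolding w_def by (rule commutator_swap_in[OF subgroup_lower_central _ b(1) cc])
    \<comment> \<open>The induction hypothesis at \<open>Suc j\<close>; this is why \<open>j\<close>
      is kept general.\<close>
    have uN: "commutator G z w \<in> N" if "z \<in> lower_central G i" for z
      using Suc.IH[OF _ that w] unfolding N_def by simp
    have wd: "commutator G w d \<in> N"
      by (rule commutator_swap_in[OF sg uN[OF b(2)] d cl(3)])
    have vz: "commutator G v z \<in> N" if "z \<in> carrier G" for z
      by (rule commutator_swap_in[OF sg N_Suc[OF that v] that cl(2)])
    have "commutator G u c \<in> N"
    proof (rule jacobi_in[OF sg b(1) d cc u_def v_def w_def])
      show "commutator G u v \<in> N" using N_Suc cl v by blast
      show "commutator G v w \<in> N" "commutator G v (commutator G u c) \<in> N" "commutator G v b \<in> N"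
        using vz cl cc b by auto
      then show "commutator G w (commutator G v b) \<in> N" using N_Suc N_sub cl by blast
      show "commutator G w u \<in> N" by (rule commutator_swap_in[OF sg uN[OF u] cl(1,3)])
      show "commutator G w d \<in> N" by (rule wd)
      then show "commutator G u (commutator G w d) \<in> N" using N_Suc N_sub cl by blast
    qed
    then show ?thesis by (simp add: u_def)
  qed
  have "a \<in> generate G {commutator G b d | b d. b \<in> carrier G \<and> d \<in> lower_central G i}"
    using Suc.prems lower_central_Suc[OF Suc.hyps] by simp
  then have "a \<in> carrier G \<and> commutator G a c \<in> N"
  proof (induction rule: generate.induct)
    case one
    show ?case using cc subgroup.one_closed[OF sg] by simp
  next
    case (incl h)
    then show ?case using main lower_central_closed by auto
  next
    case (inv h)
    then have h: "h \<in> carrier G" "commutator G h c \<in> N" using main lower_central_closed by auto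
    have ch: "commutator G c h \<in> N" by (rule commutator_swap_in[OF sg h(2,1) cc])
    then have "commutator G (inv h) (commutator G c h) \<in> N" using N_Suc[OF _ N_sub] h by simp
    then have "commutator G (inv h) c \<in> N"
      unfolding commutator_inv_left[OF h(1) cc] using ch by (rule subgroup.m_closed[OF sg])
    then show ?case using h by simp
  next
    case (eng h1 h2)
    then have "commutator G h1 (commutator G h2 c) \<in> N" using N_Suc[OF _ N_sub] by blast
    then have "commutator G (h1 \<otimes> h2) c \<in> N"
      using eng.IH cc by (subst commutator_mult_left) (auto intro!: subgroup.m_closed[OF sg])
    then show ?case using eng.IH by simp
  qed
  then show ?case by (simp add: N_def)
qed

end


section \<open>Lyndon commutators generate the lower central series\<close>

text \<open>The standard bracketing. The split only needs length at least 2, not the Lyndon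
  property, so recursion on the length is total; the value at the empty word is unspecified.\<close>

function lyndon_commutator ::
    "('g, 'm) monoid_scheme \<Rightarrow> ('a::linorder \<Rightarrow> 'g) \<Rightarrow> 'a list \<Rightarrow> 'g" where
  "lyndon_commutator G x w =
     (if length w < 2 then x (hd w)
      else commutator G (lyndon_commutator G x (std_prefix w)) (lyndon_commutator G x (std_suffix w)))"
  by auto
termination
  by (relation "Wellfounded.measure (\<lambda>(G, x, w). length w)") (auto simp: length_std_factors)

declare lyndon_commutator.simps [simp del]

lemma lyndon_commutator_singleton [simp]: "lyndon_commutator G x [a] = x a"
  by (subst lyndon_commutator.simps) simp

lemma lyndon_commutator_std:
  "2 \<le> length w \<Longrightarrow> lyndon_commutator G x w
    = commutator G (lyndon_commutator G x (std_prefix w)) (lyndon_commutator G x (std_suffix w))"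
  by (subst lyndon_commutator.simps) simp

lemma std_factors_in_lists:
  assumes "w \<in> lists I" "2 \<le> length w"
  shows "std_prefix w \<in> lists I" "std_suffix w \<in> lists I"
  using assms(1) std_factorization(1)[OF assms(2)] by (metis append_in_lists_conv)+

context group
begin

section \<open>Bilinearity and the Jacobi identity in the graded quotients\<close>

text \<open>On depths \<open>i\<close> and \<open>j\<close> the commutator is bilinear modulo depth
  \<open>i + j + 1\<close>, which lies in \<open>H\<close>. Membership in \<open>H\<close> therefore
  spreads from the generators in \<open>A\<close>; generators of depth \<open>Suc i\<close> give
  commutators in \<open>H\<close> at once.\<close>

lemma commutator_generate_left_in:
  assumes ij: "1 \<le> i" "1 \<le> j" and H: "subgroup H G" "lower_central G (Suc (i + j)) \<subseteq> H"
    and d: "d \<in> lower_central G j" and A: "A \<subseteq> lower_central G i"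
    and AH: "\<And>a. a \<in> A \<Longrightarrow> commutator G a d \<in> H"
    and z: "z \<in> generate G (A \<union> lower_central G (Suc i))"
  shows "commutator G z d \<in> H"
proof -
  have dc: "d \<in> carrier G" using d by (rule lower_central_closed)
  have base: "h \<in> lower_central G i \<and> commutator G h d \<in> H" if "h \<in> A \<union> lower_central G (Suc i)" for h
  proof (cases "h \<in> A")
    case False
    then have h: "h \<in> lower_central G (Suc i)" using that by simp
    then have "commutator G h d \<in> lower_central G (Suc i + j)"
      using ij by (intro commutator_lower_central d) auto
    moreover have "h \<in> lower_central G i" using h lower_central_Suc_subset by blast
    ultimately show ?thesis using H(2) by auto
  qed (use A AH in auto)
  have corr: "commutator G a (commutator G b c) \<in> H"
    if "a \<in> lower_central G i" "commutator G b c \<in> lower_central G (i + j)" for a b c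
  proof -
    have "commutator G a (commutator G b c) \<in> lower_central G (i + (i + j))"
      using ij by (intro commutator_lower_central that) auto
    also have "lower_central G (i + (i + j)) \<subseteq> lower_central G (Suc (i + j))"
      using ij by (intro lower_central_mono) auto
    finally show ?thesis using H(2) by blast
  qed
  have dh: "commutator G d h \<in> lower_central G (i + j)" if "h \<in> lower_central G i" for h
    using commutator_lower_central[OF ij(2,1) d that] by (simp add: add.commute)
  have hd: "commutator G h d \<in> lower_central G (i + j)" if "h \<in> lower_central G i" for h
    by (rule commutator_lower_central[OF ij that d])
  from z have "z \<in> lower_central G i \<and> commutator G z d \<in> H"
  proof (induction rule: generate.induct)
    case one
    show ?case using dc subgroup.one_closed[OF H(1)] subgroup.one_closed[OF subgroup_lower_central] by simp
  next
    case (incl h)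
    then show ?case by (rule base)
  next
    case (inv h)
    note h = base[OF inv]
    then have hc: "h \<in> carrier G" using lower_central_closed by blast
    have ih: "inv h \<in> lower_central G i" using h subgroup.m_inv_closed[OF subgroup_lower_central] by blast
    have "commutator G d h \<in> H" using h commutator_swap_in[OF H(1)] hc dc by blast
    then have "commutator G (inv h) d \<in> H"
      unfolding commutator_inv_left[OF hc dc]
      using h by (intro subgroup.m_closed[OF H(1)] corr ih dh) auto
    then show ?case using ih by simp
  next
    case (eng h1 h2)
    then have hc: "h1 \<in> carrier G" "h2 \<in> carrier G" using lower_central_closed by blast+
    have "commutator G (h1 \<otimes> h2) d \<in> H"
      unfolding commutator_mult_left[OF hc dc]
      using eng.IH by (intro subgroup.m_closed[OF H(1)] corr hd) auto
    then show ?case using eng.IH subgroup.m_closed[OF subgroup_lower_central] by blast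
  qed
  then show ?thesis by simp
qed

lemma commutator_generate_right_in:
  assumes ij: "1 \<le> i" "1 \<le> j" and H: "subgroup H G" "lower_central G (Suc (i + j)) \<subseteq> H"
    and d: "d \<in> lower_central G j" and A: "A \<subseteq> lower_central G i"
    and AH: "\<And>a. a \<in> A \<Longrightarrow> commutator G d a \<in> H"
    and z: "z \<in> generate G (A \<union> lower_central G (Suc i))"
  shows "commutator G d z \<in> H"
proof -
  have dc: "d \<in> carrier G" using d by (rule lower_central_closed)
  have Ac: "A \<union> lower_central G (Suc i) \<subseteq> carrier G" using A lower_central_closed by blast
  have zc: "z \<in> carrier G" by (rule generate_in_carrier[OF Ac z])
  have "commutator G z d \<in> H"
  proof (rule commutator_generate_left_in[OF ij H d A _ z])
    fix a assume "a \<in> A"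
    then show "commutator G a d \<in> H" using AH commutator_swap_in[OF H(1)] dc Ac by blast
  qed
  then show ?thesis using commutator_swap_in[OF H(1)] zc dc by blast
qed

text \<open>The Jacobi identity in the graded Lie ring of the lower central series expresses
  [[a, b], c] through [[a, c], b] and [a, [b, c]]. The error terms of Hall--Witt have depth at least
  \<open>i + j + k + 1\<close> and are absorbed by \<open>H\<close>.\<close>

lemma jacobi_lower_central:
  assumes ijk: "1 \<le> i" "1 \<le> j" "1 \<le> k"
    and abc: "a \<in> lower_central G i" "b \<in> lower_central G j" "c \<in> lower_central G k"
    and H: "subgroup H G" "lower_central G (Suc (i + j + k)) \<subseteq> H"
    and in_H: "commutator G (commutator G a c) b \<in> H" "commutator G a (commutator G b c) \<in> H"
  shows "commutator G (commutator G a b) c \<in> H"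
proof -
  have cl: "a \<in> carrier G" "b \<in> carrier G" "c \<in> carrier G" using abc lower_central_closed by blast+
  define u v w where "u = commutator G a b" and "v = commutator G b c" and "w = commutator G c a"
  have uvw: "u \<in> lower_central G (i + j)" "v \<in> lower_central G (j + k)" "w \<in> lower_central G (k + i)"
    unfolding u_def v_def w_def using ijk abc by (auto intro: commutator_lower_central)
  then have uvwc: "u \<in> carrier G" "v \<in> carrier G" "w \<in> carrier G" using lower_central_closed by blast+
  have N: "z \<in> H" if "z \<in> lower_central G n" "Suc (i + j + k) \<le> n" for z n
    using that lower_central_mono[of "Suc (i + j + k)" n] H(2) by blast
  have C: "commutator G y z \<in> lower_central G (l + m)"
    if "y \<in> lower_central G l" "z \<in> lower_central G m" "1 \<le> l" "1 \<le> m" for y z l m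
    using that commutator_lower_central by blast
  have "commutator G u c \<in> H"
  proof (rule jacobi_in[OF H(1) cl u_def v_def w_def])
    show "commutator G u v \<in> H" using ijk by (intro N[OF C[OF uvw(1,2)]]) auto
    show "commutator G v w \<in> H" using ijk by (intro N[OF C[OF uvw(2,3)]]) auto
    show "commutator G w u \<in> H" using ijk by (intro N[OF C[OF uvw(3,1)]]) auto
    show "commutator G v (commutator G u c) \<in> H"
      using ijk by (intro N[OF C[OF uvw(2) C[OF uvw(1) abc(3)]]]) auto
    show "commutator G w (commutator G v a) \<in> H"
      using ijk by (intro N[OF C[OF uvw(3) C[OF uvw(2) abc(1)]]]) auto
    show "commutator G u (commutator G w b) \<in> H"
      using ijk by (intro N[OF C[OF uvw(1) C[OF uvw(3) abc(2)]]]) auto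
    show "commutator G v a \<in> H"
      using in_H(2) commutator_swap_in[OF H(1)] uvwc cl unfolding v_def by blast
    \<comment> \<open>Hall--Witt produces [c, a], the inverse of the given [a, c]; bilinearity takes
      care of the sign.\<close>
    show "commutator G w b \<in> H"
    proof (rule commutator_generate_left_in[of "k + i" j H b "{commutator G a c}"])
      have "commutator G a c \<in> lower_central G (k + i)"
        using C[OF abc(1,3)] ijk by (simp add: add.commute)
      then show "{commutator G a c} \<subseteq> lower_central G (k + i)" by simp
      show "lower_central G (Suc (k + i + j)) \<subseteq> H" using H(2) by (simp add: ac_simps)
      show "w \<in> generate G ({commutator G a c} \<union> lower_central G (Suc (k + i)))"
        unfolding w_def inv_commutator[OF cl(1,3), symmetric] by (rule generate.inv) simp
    qed (use ijk abc H in_H in auto)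
  qed
  then show ?thesis by (simp add: u_def)
qed

end

locale group_with_letters = group G for G (structure) +
  fixes I :: "'i::linorder set" and x :: "'i \<Rightarrow> 'a"
  assumes finite_letters: "finite I"
    and letters_closed: "x \<in> I \<rightarrow> carrier G"
begin

abbreviation lc :: "'i list \<Rightarrow> 'a" where
  "lc \<equiv> lyndon_commutator G x"

definition lyndon_words :: "nat \<Rightarrow> 'i list set" where
  "lyndon_words m = {w \<in> lists I. lyndon w \<and> length w = m}"

text \<open>Since it contains \<open>lower_central G (Suc m)\<close>, for positive \<open>m\<close>
  it stands for a span inside the abelian quotient of depth \<open>m\<close>.\<close>

definition lyndon_span :: "nat \<Rightarrow> 'i list \<Rightarrow> 'a set" where
  "lyndon_span m v = generate G (lc ` {w \<in> lyndon_words m. w < v} \<union> lower_central G (Suc m))"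

lemma lc_in_lower_central:
  "w \<in> lists I \<Longrightarrow> w \<noteq> [] \<Longrightarrow> lc w \<in> lower_central G (length w)"
proof (induction w rule: measure_induct_rule[of length])
  case (less w)
  show ?case
  proof (cases "2 \<le> length w")
    case True
    note f = std_factorization[OF True] and l = length_std_factors[OF True]
      and i = std_factors_in_lists[OF less.prems(1) True]
    have "commutator G (lc (std_prefix w)) (lc (std_suffix w))
      \<in> lower_central G (length (std_prefix w) + length (std_suffix w))"
      using less.IH[OF l(1) i(1) f(2)] less.IH[OF l(2) i(2) f(3)] f
      by (intro commutator_lower_central) (auto simp: Suc_le_eq)
    then show ?thesis using l(3) lyndon_commutator_std[OF True, of G x] by simp
  next
    case False
    then obtain a where "w = [a]" using less.prems(2) by (cases w) (auto simp: not_le less_Suc_eq)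
    then show ?thesis using less.prems letters_closed by auto
  qed
qed

lemma lc_closed: "w \<in> lists I \<Longrightarrow> w \<noteq> [] \<Longrightarrow> lc w \<in> carrier G"
  using lc_in_lower_central lower_central_closed by blast

lemma lc_lyndon_words_subset: "1 \<le> m \<Longrightarrow> lc ` {w \<in> lyndon_words m. P w} \<subseteq> lower_central G m"
  using lc_in_lower_central unfolding lyndon_words_def by fastforce

lemma subgroup_lyndon_span: "1 \<le> m \<Longrightarrow> subgroup (lyndon_span m v) G"
  unfolding lyndon_span_def using lc_lyndon_words_subset[of m] lower_central_closed
  by (intro generate_is_subgroup) blast

lemma lower_central_subset_lyndon_span: "lower_central G (Suc m) \<subseteq> lyndon_span m v"
  unfolding lyndon_span_def by (auto intro: generate.incl)

lemma lyndon_span_mono: "v \<le> v' \<Longrightarrow> lyndon_span m v \<subseteq> lyndon_span m v'"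
  unfolding lyndon_span_def by (rule mono_generate) auto

text \<open>Bounding the Lyndon words by \<open>v\<close> makes the Jacobi identity decrease the larger of the two
  factors when the total length stays the same.\<close>

lemma commutator_lyndon:
  assumes "lyndon u" "lyndon v" "u \<in> lists I" "v \<in> lists I" "u < v" "length u + length v = m"
  shows "commutator G (lc u) (lc v) \<in> lyndon_span m v"
  using assms
proof (induction m arbitrary: u v rule: less_induct)
  case (less m)
  note shorter = less.IH
  \<comment> \<open>The lexicographic order is not well-founded in general. Bounding the length by
    \<open>m\<close> leaves finitely many words below \<open>v\<close>, and their number is the
    measure of the inner induction.\<close>
  define below where "below = (\<lambda>v. {w \<in> lists I. length w \<le> m \<and> w < v})"
  have fin: "finite (below v)" for v
    unfolding below_def by (rule finite_subset[OF _ finite_lists_length_le[OF finite_letters, of m]]) auto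
  from less.prems show ?case
  proof (induction "card (below v)" arbitrary: u v rule: less_induct)
    case less
    note uv = \<open>lyndon u\<close> \<open>lyndon v\<close> \<open>u \<in> lists I\<close> \<open>v \<in> lists I\<close> \<open>u < v\<close> \<open>length u + length v = m\<close>
    have len: "1 \<le> length u" "1 \<le> length v"
      using uv lyndon_nonempty by (auto simp: Suc_le_eq)
    then have m: "1 \<le> m" using uv by simp
    note sg = subgroup_lyndon_span[OF m, of v]
    have cl: "lc u \<in> carrier G" "lc v \<in> carrier G" using uv lc_closed lyndon_nonempty by auto
    show ?case
    proof (cases "length u = 1 \<or> v \<le> std_suffix u")
      \<comment> \<open>Here (\<open>u\<close>, \<open>v\<close>) is the standard factorization of
        \<open>u @ v\<close>, so the commutator is a single bracketing, and \<open>u @ v < v\<close>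
        by the Lyndon property.\<close>
      case True
      then have "length u = 1 \<or> 2 \<le> length u \<and> v \<le> std_suffix u"
        using len by auto
      then have s: "std_suffix (u @ v) = v"
        using uv lyndon_nonempty by (intro std_suffix_append) auto
      then have p: "std_prefix (u @ v) = u" by (rule std_prefix_append)
      have l: "lyndon (u @ v)" using uv by (intro lyndon_append)
      then have "u @ v < v" using lyndon_less_suffix[of u v] uv lyndon_nonempty by blast
      then have "u @ v \<in> {w \<in> lyndon_words m. w < v}" using l uv by (auto simp: lyndon_words_def)
      then have "lc (u @ v) \<in> lyndon_span m v"
        unfolding lyndon_span_def by (intro generate.incl UnI1 imageI)
      moreover have "2 \<le> length (u @ v)" using len by simp
      from lyndon_commutator_std[OF this, of G x]
      have "lc (u @ v) = commutator G (lc u) (lc v)" unfolding s p .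
      ultimately show ?thesis by (simp only:)
    next
      case False
      \<comment> \<open>Otherwise \<open>u\<close> splits further into \<open>s\<close> and
        \<open>t\<close> with both below \<open>v\<close>, and the Jacobi identity moves
        \<open>v\<close> into the inner bracket.\<close>
      define s t where "s = std_prefix u" and "t = std_suffix u"
      have u2: "2 \<le> length u" using False len by auto
      have st: "lyndon s" "lyndon t" "s \<in> lists I" "t \<in> lists I" "s < t" "t < v"
        "length s + length t = length u" "lc u = commutator G (lc s) (lc t)"
        unfolding s_def t_def
        using lyndon_std_prefix[OF uv(1) u2] lyndon_std_suffix[OF u2] std_factors_in_lists[OF uv(3) u2]
          std_prefix_less[OF uv(1) u2] length_std_factors[OF u2] lyndon_commutator_std[OF u2] False
        by auto
      have slen: "1 \<le> length s" "1 \<le> length t"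
        using st lyndon_nonempty by (auto simp: Suc_le_eq)
      \<comment> \<open>The inner induction: for two words below \<open>v\<close>, the larger of
        them takes over as the bound.\<close>
      have same: "commutator G (lc y) (lc z) \<in> lyndon_span m v"
        if yz: "lyndon y" "lyndon z" "y \<in> lists I" "z \<in> lists I" "length y + length z = m" "y < v" "z < v" for y z
      proof -
        have dec: "card (below w) < card (below v)" if "w \<in> lists I" "length w \<le> m" "w < v" for w
          using that by (intro psubset_card_mono[OF fin]) (auto simp: below_def)
        have yzc: "lc y \<in> carrier G" "lc z \<in> carrier G" using yz lc_closed lyndon_nonempty by auto
        consider "y = z" | "y < z" | "z < y" by fastforce
        then show ?thesis
        proof cases
          case 1
          then show ?thesis using yzc subgroup.one_closed[OF sg] by simp
        next
          case 2
          have "commutator G (lc y) (lc z) \<in> lyndon_span m z"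
            using yz 2 by (intro less.hyps dec) auto
          then show ?thesis using lyndon_span_mono[OF less_imp_le[OF yz(7)]] by blast
        next
          case 3
          have "commutator G (lc z) (lc y) \<in> lyndon_span m y"
            using yz 3 by (intro less.hyps dec) auto
          then have "commutator G (lc z) (lc y) \<in> lyndon_span m v"
            using lyndon_span_mono[OF less_imp_le[OF yz(6)]] by blast
          then show ?thesis by (rule commutator_swap_in[OF sg _ yzc(2,1)])
        qed
      qed
      have sum: "length s + length t + length v = m" using st uv by simp
      have "commutator G (commutator G (lc s) (lc t)) (lc v) \<in> lyndon_span m v"
      proof (rule jacobi_lower_central[of "length s" "length t" "length v"])
        \<comment> \<open>The inner bracket of \<open>s\<close> and \<open>v\<close> has smaller
          total length, so the outer induction expands it in Lyndon words below \<open>v\<close>;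
          each of these is then paired with \<open>t\<close>, which is also below
          \<open>v\<close>.\<close>
        show "commutator G (commutator G (lc s) (lc v)) (lc t) \<in> lyndon_span m v"
        proof (rule commutator_generate_left_in[of "length s + length v" "length t" _ _
            "lc ` {w \<in> lyndon_words (length s + length v). w < v}"])
          show "commutator G (lc s) (lc v)
            \<in> generate G (lc ` {w \<in> lyndon_words (length s + length v). w < v} \<union> lower_central G (Suc (length s + length v)))"
            using shorter[of "length s + length v" s v] st uv slen unfolding lyndon_span_def by auto
          show "lower_central G (Suc (length s + length v + length t)) \<subseteq> lyndon_span m v"
            using sum lower_central_subset_lyndon_span[of m v] by (simp add: ac_simps)
          fix a assume "a \<in> lc ` {w \<in> lyndon_words (length s + length v). w < v}"
          then obtain w where "a = lc w" "w \<in> lyndon_words (length s + length v)" "w < v" by auto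
          then show "commutator G a (lc t) \<in> lyndon_span m v"
            using same[of w t] st sum by (simp add: lyndon_words_def)
        qed (use slen len sg st lc_in_lower_central[of t] lyndon_nonempty lc_lyndon_words_subset in auto)
        show "commutator G (lc s) (commutator G (lc t) (lc v)) \<in> lyndon_span m v"
        proof (rule commutator_generate_right_in[of "length t + length v" "length s" _ _
            "lc ` {w \<in> lyndon_words (length t + length v). w < v}"])
          show "commutator G (lc t) (lc v)
            \<in> generate G (lc ` {w \<in> lyndon_words (length t + length v). w < v} \<union> lower_central G (Suc (length t + length v)))"
            using shorter[of "length t + length v" t v] st uv slen unfolding lyndon_span_def by auto
          show "lower_central G (Suc (length t + length v + length s)) \<subseteq> lyndon_span m v"
            using sum lower_central_subset_lyndon_span[of m v] by (simp add: ac_simps)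
          fix a assume "a \<in> lc ` {w \<in> lyndon_words (length t + length v). w < v}"
          then obtain w where "a = lc w" "w \<in> lyndon_words (length t + length v)" "w < v" by auto
          then show "commutator G (lc s) a \<in> lyndon_span m v"
            using same[of s w] st sum by (simp add: lyndon_words_def)
        qed (use slen len sg st lc_in_lower_central[of s] lyndon_nonempty lc_lyndon_words_subset in auto)
        show "lower_central G (Suc (length s + length t + length v)) \<subseteq> lyndon_span m v"
          using sum lower_central_subset_lyndon_span[of m v] by simp
      qed (use slen len sg st uv lc_in_lower_central lyndon_nonempty in auto)
      then show ?thesis using st by simp
    qed
  qed
qed

text \<open>Expand \<open>commutator G a z\<close> bilinearly, \<open>a\<close> in the letters and
  \<open>z\<close> in bracketings of depth \<open>m\<close>. What remains are commutators of a
  letter with a bracketing, which \<open>commutator_lyndon\<close> rewrites after the two words are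
  put in increasing order.\<close>

lemma lower_central_subset_generate:
  assumes gen: "carrier G \<subseteq> generate G (x ` I)" and "1 \<le> m"
  shows "lower_central G m \<subseteq> generate G (lc ` lyndon_words m \<union> lower_central G (Suc m))"
  using assms(2)
proof (induction m rule: nat_induct_at_least)
  case base
  have "x ` I \<subseteq> lc ` lyndon_words 1"
  proof
    fix y assume "y \<in> x ` I"
    then obtain i where "y = lc [i]" "i \<in> I" by auto
    moreover from this have "[i] \<in> lyndon_words 1" by (simp add: lyndon_words_def)
    ultimately show "y \<in> lc ` lyndon_words 1" by blast
  qed
  then have "generate G (x ` I) \<subseteq> generate G (lc ` lyndon_words 1 \<union> lower_central G (Suc 1))"
    by (intro mono_generate) auto
  then show ?case using gen by simp
next
  case (Suc m)
  define H where "H = generate G (lc ` lyndon_words (Suc m) \<union> lower_central G (Suc (Suc m)))"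
  have lw: "lc ` lyndon_words n \<subseteq> lower_central G n" if "1 \<le> n" for n
    using lc_lyndon_words_subset[OF that, of "\<lambda>_. True"] by simp
  have H: "subgroup H G"
    unfolding H_def
    by (intro generate_is_subgroup Un_least subset_trans[OF lw] subgroup.subset[OF subgroup_lower_central])
      simp
  have NH: "lower_central G (Suc (Suc m)) \<subseteq> H"
    unfolding H_def by (auto intro: generate.incl)
  have spanH: "lyndon_span (Suc m) v \<subseteq> H" for v
    unfolding H_def lyndon_span_def by (rule mono_generate) auto
  have letters: "commutator G (lc [i]) (lc w) \<in> H" if i: "i \<in> I" and w: "w \<in> lyndon_words m" for i w
  proof -
    have w': "lyndon w" "w \<in> lists I" "length w = m" using w by (auto simp: lyndon_words_def)
    have cl: "lc [i] \<in> carrier G" "lc w \<in> carrier G"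
      using i w' lc_closed[of "[i]"] lc_closed[of w] lyndon_nonempty by auto
    consider "w = [i]" | "[i] < w" | "w < [i]" by fastforce
    then show ?thesis
    proof cases
      case 1
      then show ?thesis using cl subgroup.one_closed[OF H] by simp
    next
      case 2
      then have "commutator G (lc [i]) (lc w) \<in> lyndon_span (Suc m) w"
        using i w' by (intro commutator_lyndon) auto
      then show ?thesis using spanH by blast
    next
      case 3
      then have "commutator G (lc w) (lc [i]) \<in> lyndon_span (Suc m) [i]"
        using i w' by (intro commutator_lyndon) auto
      then have "commutator G (lc w) (lc [i]) \<in> H" using spanH by blast
      then show ?thesis by (rule commutator_swap_in[OF H _ cl(2,1)])
    qed
  qed
  have main: "commutator G a z \<in> H" if a: "a \<in> carrier G" and z: "z \<in> lower_central G m" for a z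
  proof (rule commutator_generate_left_in[of 1 m H z "x ` I"])
    have "a \<in> generate G (x ` I)" using a gen by blast
    then show "a \<in> generate G (x ` I \<union> lower_central G (Suc 1))"
      using mono_generate[of "x ` I" "x ` I \<union> lower_central G (Suc 1)"] by blast
    fix y assume "y \<in> x ` I"
    then obtain i where i: "y = lc [i]" "i \<in> I" by auto
    show "commutator G y z \<in> H"
    proof (rule commutator_generate_right_in[of m 1 H y "lc ` lyndon_words m"])
      show "z \<in> generate G (lc ` lyndon_words m \<union> lower_central G (Suc m))" using Suc z by blast
      show "y \<in> lower_central G 1" using i letters_closed by auto
      show "\<And>b. b \<in> lc ` lyndon_words m \<Longrightarrow> commutator G y b \<in> H" using letters i by auto
    qed (use Suc H NH lw in auto)
  qed (use Suc H NH z letters_closed in auto)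
  show ?case
    unfolding lower_central_Suc[OF Suc.hyps] H_def[symmetric]
    by (rule generate_subgroup_incl[OF _ H]) (use main in auto)
qed

lemma finite_lyndon_words: "finite (lyndon_words m)"
  unfolding lyndon_words_def
  by (rule finite_subset[OF _ finite_lists_length_eq[OF finite_letters, of m]]) auto

section \<open>Ordered products of powers of Lyndon commutators\<close>

definition lyndon_product :: "('i list \<Rightarrow> int) \<Rightarrow> 'i list list \<Rightarrow> 'a" where
  "lyndon_product e L = foldr (\<lambda>w a. lc w [^] e w \<otimes> a) L \<one>"

lemma lyndon_product_Nil [simp]: "lyndon_product e [] = \<one>"
  and lyndon_product_Cons [simp]: "lyndon_product e (w # L) = lc w [^] e w \<otimes> lyndon_product e L"
  by (simp_all add: lyndon_product_def)

lemma lyndon_product_in: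
  assumes "subgroup H G" "lc ` set L \<subseteq> H"
  shows "lyndon_product e L \<in> H"
  using assms(2)
proof (induction L)
  case Nil
  show ?case using subgroup.one_closed[OF assms(1)] by simp
next
  case (Cons w L)
  then show ?case
    using subgroup.m_closed[OF assms(1)] subgroup_int_pow_closed[OF assms(1)] by simp
qed

lemma lyndon_product_append:
  assumes "lc ` set (L @ M) \<subseteq> carrier G"
  shows "lyndon_product e (L @ M) = lyndon_product e L \<otimes> lyndon_product e M"
  using assms
proof (induction L)
  case Nil
  then show ?case using lyndon_product_in[OF subgroup_self, of M e] by simp
next
  case (Cons w L)
  then show ?case
    using lyndon_product_in[OF subgroup_self, of M e] lyndon_product_in[OF subgroup_self, of L e]
    by (simp add: m_assoc image_Un)
qed

lemma lyndon_product_cong: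
  "(\<And>w. w \<in> set L \<Longrightarrow> e w = f w) \<Longrightarrow> lyndon_product e L = lyndon_product f L"
  by (induction L) auto

lemma lyndon_product_single:
  assumes "distinct L" "w \<in> set L" "lc ` set L \<subseteq> carrier G"
  shows "lyndon_product (\<lambda>v. if v = w then k else 0) L = lc w [^] k"
proof -
  have zero: "lyndon_product (\<lambda>v. if v = w then k else 0) L = \<one>"
    if "w \<notin> set L" "lc ` set L \<subseteq> carrier G" for L
    using that by (induction L) auto
  show ?thesis using assms
  proof (induction L)
    case (Cons v L)
    then show ?case using zero[of L] by (cases "v = w") auto
  qed simp
qed

lemma lyndon_product_zero: "lc ` set L \<subseteq> carrier G \<Longrightarrow> lyndon_product (\<lambda>_. 0) L = \<one>"
  by (induction L) auto

text \<open>\<open>K\<close> is abelian modulo \<open>N\<close>, so exponents add. Moving a power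
  past the remaining product costs a commutator in \<open>N\<close>, which normality carries to the
  right end.\<close>

lemma lyndon_product_mult:
  assumes K: "subgroup K G" and N: "N \<lhd> G"
    and comm: "\<And>a c. a \<in> K \<Longrightarrow> c \<in> K \<Longrightarrow> commutator G a c \<in> N" and L: "lc ` set L \<subseteq> K"
  shows "\<exists>r\<in>N. lyndon_product e L \<otimes> lyndon_product f L = lyndon_product (\<lambda>w. e w + f w) L \<otimes> r"
  using L
proof (induction L)
  case Nil
  show ?case using subgroup.one_closed[OF normal_imp_subgroup[OF N]]
    by (intro bexI[of _ "\<one>"]) simp_all
next
  case (Cons w L)
  have Kc: "\<And>a. a \<in> K \<Longrightarrow> a \<in> carrier G" using subgroup.mem_carrier[OF K] .
  have Nc: "\<And>a. a \<in> N \<Longrightarrow> a \<in> carrier G" using subgroup.mem_carrier[OF normal_imp_subgroup[OF N]] .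
  define A B S where "A = lyndon_product e L" and "B = lyndon_product f L"
    and "S = lyndon_product (\<lambda>w. e w + f w) L"
  define a b where "a = lc w [^] e w" and "b = lc w [^] f w"
  have inK: "A \<in> K" "B \<in> K" "S \<in> K" "a \<in> K" "b \<in> K"
    unfolding A_def B_def S_def a_def b_def
    using Cons.prems lyndon_product_in[OF K] subgroup_int_pow_closed[OF K] by auto
  note c = inK[THEN Kc]
  obtain r where r: "r \<in> N" "A \<otimes> B = S \<otimes> r"
    using Cons unfolding A_def B_def S_def by auto
  define q where "q = commutator G (inv A) (inv b)"
  have q: "q \<in> N" unfolding q_def using comm inK subgroup.m_inv_closed[OF K] by blast
  define q' where "q' = inv B \<otimes> q \<otimes> B"
  have q': "q' \<in> N" unfolding q'_def using normal.inv_op_closed1[OF N] q c by simp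
  note rc = r(1)[THEN Nc] q[THEN Nc] q'[THEN Nc]
  have "A \<otimes> b = b \<otimes> A \<otimes> q"
    unfolding q_def using c by (simp add: commutator_def group_word_simps)
  moreover have "a \<otimes> A \<otimes> (b \<otimes> B) = a \<otimes> (A \<otimes> b) \<otimes> B"
    using c by (simp add: m_assoc)
  ultimately have "a \<otimes> A \<otimes> (b \<otimes> B) = a \<otimes> (b \<otimes> A \<otimes> q) \<otimes> B"
    by simp
  also have "\<dots> = a \<otimes> b \<otimes> (A \<otimes> B) \<otimes> q'"
    unfolding q'_def using c rc by (simp add: group_word_simps)
  also have "\<dots> = (a \<otimes> b \<otimes> S) \<otimes> (r \<otimes> q')"
    unfolding r(2) using c rc by (simp add: m_assoc)
  also have "a \<otimes> b = lc w [^] (e w + f w)"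
    unfolding a_def b_def using Cons.prems Kc by (simp add: int_pow_mult)
  finally have "a \<otimes> A \<otimes> (b \<otimes> B) = lc w [^] (e w + f w) \<otimes> S \<otimes> (r \<otimes> q')" .
  moreover have "r \<otimes> q' \<in> N" using r q' subgroup.m_closed[OF normal_imp_subgroup[OF N]] by blast
  ultimately show ?case unfolding a_def b_def A_def B_def S_def by auto
qed

text \<open>The generators commute modulo the next term, so products of their powers in the fixed
  order \<open>L\<close> are closed under multiplication up to a remainder.\<close>

lemma lower_central_factorization:
  assumes gen: "carrier G \<subseteq> generate G (x ` I)" and m: "1 \<le> m"
    and L: "distinct L" "set L = lyndon_words m" and z: "z \<in> lower_central G m"
  shows "\<exists>e. \<exists>r\<in>lower_central G (Suc m). z = lyndon_product e L \<otimes> r"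
proof -
  define N where "N = lower_central G (Suc m)"
  have N: "N \<lhd> G" unfolding N_def by (rule normal_lower_central)
  note sN = normal_imp_subgroup[OF N]
  have Nc: "\<And>a. a \<in> N \<Longrightarrow> a \<in> carrier G" using subgroup.mem_carrier[OF sN] .
  have LK: "lc ` set L \<subseteq> lower_central G m"
    using lc_lyndon_words_subset[OF m, of "\<lambda>_. True"] L by simp
  then have Lc: "lc ` set L \<subseteq> carrier G" using lower_central_closed by blast
  note P = lyndon_product_in[OF subgroup_self Lc]
  have comm: "commutator G a c \<in> N" if "a \<in> lower_central G m" "c \<in> lower_central G m" for a c
    unfolding N_def using that commutator_lower_central_Suc[OF m] lower_central_closed by blast
  have single: "lc w [^] (k::int) = lyndon_product (\<lambda>v. if v = w then k else 0) L \<otimes> \<one>" if "w \<in> lyndon_words m" for w k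
    using lyndon_product_single[OF L(1) _ Lc, of w k] that L P[of "\<lambda>v. if v = w then k else 0"] by simp
  have pure: "r = lyndon_product (\<lambda>_. 0) L \<otimes> r" if "r \<in> N" for r
    using lyndon_product_zero[OF Lc] Nc[OF that] by simp
  have "z \<in> generate G (lc ` lyndon_words m \<union> N)"
    using lower_central_subset_generate[OF gen m] z unfolding N_def by blast
  then have "\<exists>e. \<exists>r\<in>N. z = lyndon_product e L \<otimes> r"
  proof (induction rule: generate.induct)
    case one
    show ?case using pure[OF subgroup.one_closed[OF sN]] subgroup.one_closed[OF sN] by blast
  next
    case (incl h)
    then show ?case
    proof
      assume "h \<in> lc ` lyndon_words m"
      then obtain w where w: "h = lc w" "w \<in> lyndon_words m" by auto
      then have "h = lc w [^] (1::int)" using Lc L by auto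
      then show ?case using single[OF w(2), of 1] subgroup.one_closed[OF sN] by metis
    next
      assume "h \<in> N"
      then show ?case using pure by blast
    qed
  next
    case (inv h)
    then show ?case
    proof
      assume "h \<in> lc ` lyndon_words m"
      then obtain w where w: "h = lc w" "w \<in> lyndon_words m" by auto
      then have "inv h = lc w [^] (-1::int)" using Lc L by (auto simp: int_pow_neg)
      then show ?case using single[OF w(2), of "-1"] subgroup.one_closed[OF sN] by metis
    next
      assume "h \<in> N"
      then show ?case using pure subgroup.m_inv_closed[OF sN] by blast
    qed
  next
    case (eng h1 h2)
    then obtain e r f s where h: "r \<in> N" "s \<in> N" "h1 = lyndon_product e L \<otimes> r" "h2 = lyndon_product f L \<otimes> s"
      by blast
    define A B where "A = lyndon_product e L" and "B = lyndon_product f L"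
    obtain t where t: "t \<in> N" "A \<otimes> B = lyndon_product (\<lambda>w. e w + f w) L \<otimes> t"
      using lyndon_product_mult[OF subgroup_lower_central N comm LK, of e f] unfolding A_def B_def by blast
    define r' where "r' = inv B \<otimes> r \<otimes> B"
    have c: "A \<in> carrier G" "B \<in> carrier G" unfolding A_def B_def by (rule P)+
    have r': "r' \<in> N" unfolding r'_def using normal.inv_op_closed1[OF N] h c by simp
    note rc = h(1)[THEN Nc] h(2)[THEN Nc] t(1)[THEN Nc] r'[THEN Nc]
    have "h1 \<otimes> h2 = A \<otimes> B \<otimes> (r' \<otimes> s)"
      unfolding h(3,4) A_def[symmetric] B_def[symmetric] r'_def
      using c rc by (simp add: group_word_simps)
    also have "\<dots> = lyndon_product (\<lambda>w. e w + f w) L \<otimes> (t \<otimes> (r' \<otimes> s))"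
      unfolding t(2) using rc P by (simp add: m_assoc)
    finally show ?case using t h r' subgroup.m_closed[OF sN] by blast
  qed
  then show ?thesis by (simp add: N_def)
qed

text \<open>One layer at a time: the remainder of depth \<open>k\<close> is itself a product over
  the Lyndon words of length \<open>k\<close>, up to a deeper remainder.\<close>

lemma lyndon_factorization:
  assumes gen: "carrier G \<subseteq> generate G (x ` I)" and z: "z \<in> carrier G" and "1 \<le> k"
  shows "\<exists>L e. \<exists>r\<in>lower_central G k. distinct L
    \<and> (\<forall>w\<in>set L. w \<in> lists I \<and> lyndon w \<and> length w < k) \<and> z = lyndon_product e L \<otimes> r"
  using \<open>1 \<le> k\<close>
proof (induction k rule: nat_induct_at_least)
  case base
  have "z = lyndon_product (\<lambda>_. 0) [] \<otimes> z" using z by simp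
  then show ?case using z by (intro exI[of _ "[]"] exI[of _ "\<lambda>_. 0"] bexI[of _ z]) auto
next
  case (Suc k)
  then obtain L e r where L: "distinct L" "\<And>w. w \<in> set L \<Longrightarrow> w \<in> lists I \<and> lyndon w \<and> length w < k"
    and r: "r \<in> lower_central G k" "z = lyndon_product e L \<otimes> r" by blast
  obtain M where M: "set M = lyndon_words k" "distinct M"
    using finite_distinct_list[OF finite_lyndon_words] by blast
  obtain f s where s: "s \<in> lower_central G (Suc k)" "r = lyndon_product f M \<otimes> s"
    using lower_central_factorization[OF gen Suc.hyps M(2,1) r(1)] by blast
  \<comment> \<open>Words in \<open>L\<close> are shorter than \<open>k\<close> and words in
    \<open>M\<close> have length \<open>k\<close>, so the two exponent functions can be
    glued.\<close>
  define h where "h = (\<lambda>w. if length w < k then e w else f w)"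
  have c: "lc ` set (L @ M) \<subseteq> carrier G"
  proof (rule image_subsetI)
    fix w assume "w \<in> set (L @ M)"
    then have "w \<in> lists I" "lyndon w" using L(2) M(1) unfolding lyndon_words_def by auto
    then show "lc w \<in> carrier G" using lc_closed lyndon_nonempty by blast
  qed
  have "lyndon_product h L = lyndon_product e L"
    using L(2) by (intro lyndon_product_cong) (simp add: h_def)
  moreover have "lyndon_product h M = lyndon_product f M"
    using M(1) by (intro lyndon_product_cong) (simp add: h_def lyndon_words_def)
  ultimately have "z = lyndon_product h (L @ M) \<otimes> s"
    unfolding lyndon_product_append[OF c] r(2) s(2)
    using c lower_central_closed[OF s(1)] lyndon_product_in[OF subgroup_self, of L]
      lyndon_product_in[OF subgroup_self, of M] by (simp add: m_assoc image_Un)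
  moreover have "distinct (L @ M)" using L M by (auto simp: lyndon_words_def)
  moreover have "\<forall>w\<in>set (L @ M). w \<in> lists I \<and> lyndon w \<and> length w < Suc k"
    using L(2) M(1) by (auto simp: lyndon_words_def less_Suc_eq)
  ultimately show ?case using s(1) by blast
qed

end


section \<open>The group ring\<close>

text \<open>One construction for the augmentation, for the coefficients of Fox derivatives and for
  the Magnus expansion of group ring elements.\<close>

definition lin_ext :: "('g \<Rightarrow> 'r::ring_1) \<Rightarrow> ('g \<Rightarrow> int) \<Rightarrow> 'r" where
  "lin_ext \<phi> u = (\<Sum>a | u a \<noteq> 0. of_int (u a) * \<phi> a)"

lemma lin_ext_superset:
  assumes "finite A" "{a. u a \<noteq> 0} \<subseteq> A"
  shows "lin_ext \<phi> u = (\<Sum>a\<in>A. of_int (u a) * \<phi> a)"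
  unfolding lin_ext_def using assms by (intro sum.mono_neutral_left) auto

lemma lin_ext_0 [simp]: "lin_ext \<phi> (\<lambda>h. 0) = 0"
  by (simp add: lin_ext_def)

lemma lin_ext_elt [simp]: "lin_ext \<phi> (group_ring_elt a) = \<phi> a"
proof -
  have "lin_ext \<phi> (group_ring_elt a) = (\<Sum>b\<in>{a}. of_int (group_ring_elt a b) * \<phi> b)"
    by (rule lin_ext_superset) (auto simp: group_ring_elt_def)
  then show ?thesis by (simp add: group_ring_elt_def)
qed

lemma lin_ext_add:
  assumes "finite {a. u a \<noteq> 0}" "finite {a. v a \<noteq> 0}"
  shows "lin_ext \<phi> (\<lambda>h. u h + v h) = lin_ext \<phi> u + lin_ext \<phi> v"
proof -
  define A where "A = {a. u a \<noteq> 0} \<union> {a. v a \<noteq> 0}"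
  have fin: "finite A" unfolding A_def using assms by (rule finite_UnI)
  have sub: "{a. u a \<noteq> 0} \<subseteq> A" "{a. v a \<noteq> 0} \<subseteq> A" unfolding A_def by blast+
  have "{a. u a + v a \<noteq> 0} \<subseteq> A" unfolding A_def by auto
  then have "lin_ext \<phi> (\<lambda>h. u h + v h) = (\<Sum>a\<in>A. of_int (u a + v a) * \<phi> a)"
    by (rule lin_ext_superset[OF fin])
  also have "\<dots> = lin_ext \<phi> u + lin_ext \<phi> v"
    by (simp only: lin_ext_superset[OF fin sub(1)] lin_ext_superset[OF fin sub(2)]
        of_int_add distrib_right sum.distrib)
  finally show ?thesis .
qed

lemma lin_ext_scale:
  assumes "finite {a. u a \<noteq> 0}"
  shows "lin_ext \<phi> (\<lambda>h. n * u h) = of_int n * lin_ext \<phi> u"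
proof -
  have "lin_ext \<phi> (\<lambda>h. n * u h) = (\<Sum>a | u a \<noteq> 0. of_int (n * u a) * \<phi> a)"
    by (rule lin_ext_superset[OF assms]) auto
  also have "\<dots> = of_int n * lin_ext \<phi> u"
    unfolding lin_ext_def sum_distrib_left by (intro sum.cong) (simp_all add: mult.assoc)
  finally show ?thesis .
qed

lemma lin_ext_diff:
  assumes "finite {a. u a \<noteq> 0}" "finite {a. v a \<noteq> 0}"
  shows "lin_ext \<phi> (\<lambda>h. u h - v h) = lin_ext \<phi> u - lin_ext \<phi> v"
proof -
  have "lin_ext \<phi> (\<lambda>h. u h + (-1) * v h) = lin_ext \<phi> u + lin_ext \<phi> (\<lambda>h. (-1) * v h)"
    using assms by (intro lin_ext_add) auto
  also have "\<dots> = lin_ext \<phi> u - lin_ext \<phi> v"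
    unfolding lin_ext_scale[OF assms(2)] by simp
  finally show ?thesis by simp
qed

lemma augmentation_eq_lin_ext: "augmentation u = lin_ext (\<lambda>_. 1) u"
  by (simp add: augmentation_def lin_ext_def)

context group
begin

lemma group_ring_carrier:
  "u \<in> carrier (group_ring G) \<longleftrightarrow> finite {h. u h \<noteq> 0} \<and> {h. u h \<noteq> 0} \<subseteq> carrier G"
  by (simp add: group_ring_def)

lemma group_ring_finite: "u \<in> carrier (group_ring G) \<Longrightarrow> finite {h. u h \<noteq> 0}"
  by (simp add: group_ring_carrier)

lemma group_ring_off_carrier: "u \<in> carrier (group_ring G) \<Longrightarrow> h \<notin> carrier G \<Longrightarrow> u h = 0"
  by (auto simp: group_ring_carrier)

lemma group_ring_zero_closed [simp]: "(\<lambda>h. 0) \<in> carrier (group_ring G)"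
  by (simp add: group_ring_carrier)

lemma group_ring_elt_closed [simp]: "a \<in> carrier G \<Longrightarrow> group_ring_elt a \<in> carrier (group_ring G)"
  by (auto simp: group_ring_carrier group_ring_elt_def)

lemma group_ring_add_closed [simp]:
  assumes "u \<in> carrier (group_ring G)" "v \<in> carrier (group_ring G)"
  shows "(\<lambda>h. u h + v h) \<in> carrier (group_ring G)"
  unfolding group_ring_carrier
proof
  have sub: "{h. u h + v h \<noteq> 0} \<subseteq> {h. u h \<noteq> 0} \<union> {h. v h \<noteq> 0}" by auto
  show "finite {h. u h + v h \<noteq> 0}"
    by (rule finite_subset[OF sub]) (use assms in \<open>auto simp: group_ring_carrier\<close>)
  show "{h. u h + v h \<noteq> 0} \<subseteq> carrier G"
    using sub assms unfolding group_ring_carrier by blast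
qed

lemma group_ring_scale_closed [simp]:
  "u \<in> carrier (group_ring G) \<Longrightarrow> (\<lambda>h. n * u h) \<in> carrier (group_ring G)"
  by (cases "n = 0") (auto simp: group_ring_carrier)

lemma group_ring_diff_closed [simp]:
  assumes "u \<in> carrier (group_ring G)" "v \<in> carrier (group_ring G)"
  shows "(\<lambda>h. u h - v h) \<in> carrier (group_ring G)"
  using group_ring_add_closed[OF assms(1) group_ring_scale_closed[OF assms(2), of "-1"]] by simp

text \<open>Every element is reached from zero by adding or subtracting single group elements, and
  the sum of the absolute values of its coefficients counts the steps. Identities between additive
  maps thereby reduce to group elements.\<close>

lemma group_ring_induct [consumes 1, case_names zero add diff]:
  assumes u: "u \<in> carrier (group_ring G)"
    and zero: "P (\<lambda>h. 0)"
    and add: "\<And>a u. a \<in> carrier G \<Longrightarrow> u \<in> carrier (group_ring G) \<Longrightarrow> P u \<Longrightarrow> P (\<lambda>h. u h + group_ring_elt a h)"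
    and diff: "\<And>a u. a \<in> carrier G \<Longrightarrow> u \<in> carrier (group_ring G) \<Longrightarrow> P u \<Longrightarrow> P (\<lambda>h. u h - group_ring_elt a h)"
  shows "P u"
  using u
proof (induction "\<Sum>a | u a \<noteq> 0. nat \<bar>u a\<bar>" arbitrary: u rule: less_induct)
  case (less u)
  note fin = group_ring_finite[OF less.prems]
  show ?case
  proof (cases "u = (\<lambda>h. 0)")
    case False
    then obtain a where a: "u a \<noteq> 0" by auto
    then have ac: "a \<in> carrier G" using less.prems by (auto simp: group_ring_carrier)
    define s where "s = sgn (u a)"
    define v where "v = (\<lambda>h. u h - s * group_ring_elt a h)"
    have vin: "v \<in> carrier (group_ring G)"
      unfolding v_def using less.prems ac by (intro group_ring_diff_closed group_ring_scale_closed) auto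
    have va: "\<bar>v a\<bar> = \<bar>u a\<bar> - 1"
      using a by (auto simp: v_def s_def group_ring_elt_def sgn_if)
    have vh: "v h = u h" if "h \<noteq> a" for h
      using that by (simp add: v_def group_ring_elt_def)
    have "(\<Sum>h | v h \<noteq> 0. nat \<bar>v h\<bar>) = (\<Sum>h | u h \<noteq> 0. nat \<bar>v h\<bar>)"
    proof (intro sum.mono_neutral_left fin)
      show "{h. v h \<noteq> 0} \<subseteq> {h. u h \<noteq> 0}"
      proof
        fix h assume "h \<in> {h. v h \<noteq> 0}"
        then show "h \<in> {h. u h \<noteq> 0}" using vh[of h] a by (cases "h = a") auto
      qed
    qed auto
    also have "\<dots> < (\<Sum>h | u h \<noteq> 0. nat \<bar>u h\<bar>)"
    proof (rule sum_strict_mono_ex1[OF fin])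
      show "\<forall>h\<in>{h. u h \<noteq> 0}. nat \<bar>v h\<bar> \<le> nat \<bar>u h\<bar>"
      proof
        fix h show "nat \<bar>v h\<bar> \<le> nat \<bar>u h\<bar>" using va vh[of h] by (cases "h = a") auto
      qed
      show "\<exists>h\<in>{h. u h \<noteq> 0}. nat \<bar>v h\<bar> < nat \<bar>u h\<bar>" using a va by (intro bexI[of _ a]) auto
    qed
    finally have "P v" using less.hyps vin by blast
    consider "s = 1" | "s = -1" using a unfolding s_def sgn_if by presburger
    then show ?thesis
    proof cases
      case 1
      have "P (\<lambda>h. v h + group_ring_elt a h)" by (rule add) fact+
      then show ?thesis by (simp add: v_def 1)
    next
      case 2
      have "P (\<lambda>h. v h - group_ring_elt a h)" by (rule diff) fact+
      then show ?thesis by (simp add: v_def 2)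
    qed
  qed (simp add: zero)
qed

text \<open>Left multiplication by the group element \<open>a\<close>, without the convolution sum,
  so that its identities can be checked pointwise.\<close>

definition translate :: "'a \<Rightarrow> ('a \<Rightarrow> int) \<Rightarrow> 'a \<Rightarrow> int" where
  "translate a v = (\<lambda>h. if h \<in> carrier G then v (inv a \<otimes> h) else 0)"

lemma translate_zero [simp]: "translate a (\<lambda>h. 0) = (\<lambda>h. 0)"
  by (simp add: translate_def fun_eq_iff)

lemma translate_add: "translate a (\<lambda>h. u h + v h) = (\<lambda>h. translate a u h + translate a v h)"
  and translate_diff: "translate a (\<lambda>h. u h - v h) = (\<lambda>h. translate a u h - translate a v h)"
  by (auto simp: translate_def fun_eq_iff)

lemma translate_elt:
  "a \<in> carrier G \<Longrightarrow> c \<in> carrier G \<Longrightarrow> translate a (group_ring_elt c) = group_ring_elt (a \<otimes> c)"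
  by (auto simp: translate_def group_ring_elt_def fun_eq_iff inv_solve_left')

lemma translate_translate:
  "a \<in> carrier G \<Longrightarrow> c \<in> carrier G \<Longrightarrow> translate a (translate c v) = translate (a \<otimes> c) v"
  by (auto simp: translate_def fun_eq_iff inv_mult_group m_assoc)

lemma translate_one: "v \<in> carrier (group_ring G) \<Longrightarrow> translate \<one> v = v"
  by (auto simp: translate_def fun_eq_iff group_ring_off_carrier)

lemma translate_closed [simp]:
  assumes "a \<in> carrier G" "v \<in> carrier (group_ring G)"
  shows "translate a v \<in> carrier (group_ring G)"
  using assms(2)
  by (induction v rule: group_ring_induct) (simp_all add: translate_add translate_diff translate_elt assms(1))

lemma group_ring_mult_superset:
  assumes "finite A" "{a. u a \<noteq> 0} \<subseteq> A" 
  shows "u \<otimes>\<^bsub>group_ring G\<^esub> v = (\<lambda>h. \<Sum>a\<in>A. u a * translate a v h)"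
proof
  fix h
  have "(u \<otimes>\<^bsub>group_ring G\<^esub> v) h = (\<Sum>a | u a \<noteq> 0. u a * translate a v h)"
    by (simp add: group_ring_def translate_def)
  also have "\<dots> = (\<Sum>a\<in>A. u a * translate a v h)"
    by (rule sum.mono_neutral_left) (use assms in auto)
  finally show "(u \<otimes>\<^bsub>group_ring G\<^esub> v) h = (\<Sum>a\<in>A. u a * translate a v h)" .
qed

lemma group_ring_mult_elt:
  "group_ring_elt a \<otimes>\<^bsub>group_ring G\<^esub> v = translate a v"
  by (subst group_ring_mult_superset[of "{a}"]) (auto simp: group_ring_elt_def)

lemma group_ring_mult_zero [simp]: "(\<lambda>h. 0) \<otimes>\<^bsub>group_ring G\<^esub> v = (\<lambda>h. 0)"
  by (subst group_ring_mult_superset[of "{}"]) auto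

lemma group_ring_mult_add:
  assumes "finite {h. u h \<noteq> 0}" "finite {h. u' h \<noteq> 0}"
  shows "(\<lambda>h. u h + u' h) \<otimes>\<^bsub>group_ring G\<^esub> v
    = (\<lambda>h. (u \<otimes>\<^bsub>group_ring G\<^esub> v) h + (u' \<otimes>\<^bsub>group_ring G\<^esub> v) h)"
proof -
  define A where "A = {h. u h \<noteq> 0} \<union> {h. u' h \<noteq> 0}"
  have fin: "finite A" unfolding A_def using assms by (rule finite_UnI)
  have sub: "{h. u h \<noteq> 0} \<subseteq> A" "{h. u' h \<noteq> 0} \<subseteq> A" unfolding A_def by blast+
  have "{h. u h + u' h \<noteq> 0} \<subseteq> A" unfolding A_def by auto
  then have "(\<lambda>h. u h + u' h) \<otimes>\<^bsub>group_ring G\<^esub> v = (\<lambda>h. \<Sum>a\<in>A. (u a + u' a) * translate a v h)"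
    by (rule group_ring_mult_superset[OF fin])
  also have "\<dots> = (\<lambda>h. (u \<otimes>\<^bsub>group_ring G\<^esub> v) h + (u' \<otimes>\<^bsub>group_ring G\<^esub> v) h)"
    by (simp only: group_ring_mult_superset[OF fin sub(1)] group_ring_mult_superset[OF fin sub(2)]
        distrib_right sum.distrib)
  finally show ?thesis .
qed

lemma group_ring_mult_diff:
  assumes "finite {h. u h \<noteq> 0}" "finite {h. u' h \<noteq> 0}"
  shows "(\<lambda>h. u h - u' h) \<otimes>\<^bsub>group_ring G\<^esub> v
    = (\<lambda>h. (u \<otimes>\<^bsub>group_ring G\<^esub> v) h - (u' \<otimes>\<^bsub>group_ring G\<^esub> v) h)"
proof -
  define A where "A = {h. u h \<noteq> 0} \<union> {h. u' h \<noteq> 0}"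
  have fin: "finite A" unfolding A_def using assms by (rule finite_UnI)
  have sub: "{h. u h \<noteq> 0} \<subseteq> A" "{h. u' h \<noteq> 0} \<subseteq> A" unfolding A_def by blast+
  have "{h. u h - u' h \<noteq> 0} \<subseteq> A" unfolding A_def by auto
  then have "(\<lambda>h. u h - u' h) \<otimes>\<^bsub>group_ring G\<^esub> v = (\<lambda>h. \<Sum>a\<in>A. (u a - u' a) * translate a v h)"
    by (rule group_ring_mult_superset[OF fin])
  also have "\<dots> = (\<lambda>h. (u \<otimes>\<^bsub>group_ring G\<^esub> v) h - (u' \<otimes>\<^bsub>group_ring G\<^esub> v) h)"
    by (simp only: group_ring_mult_superset[OF fin sub(1)] group_ring_mult_superset[OF fin sub(2)]
        left_diff_distrib sum_subtractf)
  finally show ?thesis .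
qed

lemma group_ring_mult_closed [simp]:
  assumes "u \<in> carrier (group_ring G)" "v \<in> carrier (group_ring G)"
  shows "u \<otimes>\<^bsub>group_ring G\<^esub> v \<in> carrier (group_ring G)"
  using assms(1)
  by (induction u rule: group_ring_induct)
    (simp_all add: group_ring_mult_add group_ring_mult_diff group_ring_finite group_ring_mult_elt assms(2))

lemma lin_ext_translate:
  assumes a: "a \<in> carrier G" and v: "v \<in> carrier (group_ring G)"
  shows "lin_ext \<phi> (translate a v) = lin_ext (\<lambda>c. \<phi> (a \<otimes> c)) v"
  using v
proof (induction v rule: group_ring_induct)
  case zero
  show ?case by simp
next
  case (add c u)
  then show ?case using a
    by (simp add: translate_add translate_elt lin_ext_add group_ring_finite)
next
  case (diff c u)
  then show ?case using a
    by (simp add: translate_diff translate_elt lin_ext_diff group_ring_finite)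
qed

lemma group_ring_simps:
  "u \<oplus>\<^bsub>group_ring G\<^esub> v = (\<lambda>h. u h + v h)" "\<zero>\<^bsub>group_ring G\<^esub> = (\<lambda>h. 0)"
  "\<one>\<^bsub>group_ring G\<^esub> = group_ring_elt \<one>"
  by (simp_all add: group_ring_def group_ring_elt_def)

lemma lin_ext_fun_cong:
  assumes "u \<in> carrier (group_ring G)" "\<And>a. a \<in> carrier G \<Longrightarrow> \<phi> a = \<psi> a"
  shows "lin_ext \<phi> u = lin_ext \<psi> u"
  unfolding lin_ext_def using assms by (intro sum.cong) (auto simp: group_ring_carrier)

section \<open>The conjugation of the group ring\<close>

lemma group_ring_conj_elt: "a \<in> carrier G \<Longrightarrow> group_ring_conj G (group_ring_elt a) = group_ring_elt (inv a)"
  by (auto simp: group_ring_conj_def group_ring_elt_def fun_eq_iff)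

lemma group_ring_conj_add: "group_ring_conj G (\<lambda>h. u h + v h) = (\<lambda>h. group_ring_conj G u h + group_ring_conj G v h)"
  and group_ring_conj_diff: "group_ring_conj G (\<lambda>h. u h - v h) = (\<lambda>h. group_ring_conj G u h - group_ring_conj G v h)"
  and group_ring_conj_zero [simp]: "group_ring_conj G (\<lambda>h. 0) = (\<lambda>h. 0)"
  by (auto simp: group_ring_conj_def fun_eq_iff)

lemma group_ring_conj_closed [simp]:
  assumes "v \<in> carrier (group_ring G)"
  shows "group_ring_conj G v \<in> carrier (group_ring G)"
  using assms
  by (induction v rule: group_ring_induct)
    (simp_all add: group_ring_conj_add group_ring_conj_diff group_ring_conj_elt)

lemma group_ring_conj_conj:
  "v \<in> carrier (group_ring G) \<Longrightarrow> group_ring_conj G (group_ring_conj G v) = v"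
  by (auto simp: group_ring_conj_def fun_eq_iff group_ring_off_carrier)

lemma lin_ext_conj:
  assumes "v \<in> carrier (group_ring G)"
  shows "lin_ext \<phi> (group_ring_conj G v) = lin_ext (\<lambda>a. \<phi> (inv a)) v"
  using assms
proof (induction v rule: group_ring_induct)
  case zero
  show ?case by simp
next
  case (add c u)
  then show ?case
    by (simp add: group_ring_conj_add group_ring_conj_elt lin_ext_add group_ring_finite)
next
  case (diff c u)
  then show ?case
    by (simp add: group_ring_conj_diff group_ring_conj_elt lin_ext_diff group_ring_finite)
qed

end


section \<open>The Magnus expansion and the Zassenhaus filtration of a free group\<close>

definition reduced_words_on :: "'i set \<Rightarrow> ('i \<times> bool) list set" where
  "reduced_words_on I = {w. set w \<subseteq> I \<times> UNIV \<and> reduced_word w}"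

lemma reduced_word_Cons:
  "reduced_word ((i, s) # w) \<longleftrightarrow> reduced_word w \<and> (\<forall>r. w \<noteq> (i, \<not> s) # r)"
  unfolding reduced_word_def by (cases w) auto

lemma word_value_Nil [simp]: "word_value G x [] = \<one>\<^bsub>G\<^esub>"
  and word_value_Cons [simp]:
    "word_value G x ((i, s) # w) = (if s then x i else inv\<^bsub>G\<^esub> (x i)) \<otimes>\<^bsub>G\<^esub> word_value G x w"
  by (simp_all add: word_value_def)

text \<open>Maps out of the free group are built from actions of words in which a letter and its
  inverse act by mutually inverse maps. The Magnus expansion and the Fox derivatives both arise in
  this way.\<close>

definition word_action :: "('i \<Rightarrow> bool \<Rightarrow> 's \<Rightarrow> 's) \<Rightarrow> ('i \<times> bool) list \<Rightarrow> 's \<Rightarrow> 's" where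
  "word_action T w v = foldr (\<lambda>(i, s). T i s) w v"

lemma word_action_Nil [simp]: "word_action T [] v = v"
  and word_action_Cons [simp]: "word_action T ((i, s) # w) v = T i s (word_action T w v)"
  and word_action_append: "word_action T (w @ w') v = word_action T w (word_action T w' v)"
  by (simp_all add: word_action_def)

locale free_basis_group = group_with_letters G I x for G (structure) and I :: "'i::linorder set" and x +
  assumes basis: "free_basis G I x"
begin

lemma letter_closed [simp]: "i \<in> I \<Longrightarrow> x i \<in> carrier G"
  using letters_closed by auto

lemma word_value_closed [simp]: "set w \<subseteq> I \<times> UNIV \<Longrightarrow> word_value G x w \<in> carrier G"
  by (induction w) auto

lemma word_value_append:
  assumes "set w \<subseteq> I \<times> UNIV" "set w' \<subseteq> I \<times> UNIV"
  shows "word_value G x (w @ w') = word_value G x w \<otimes> word_value G x w'"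
  using assms by (induction w) (auto simp: m_assoc)

definition red :: "'a \<Rightarrow> ('i \<times> bool) list" where
  "red g = the_inv_into (reduced_words_on I) (word_value G x) g"

lemma bij_word_value: "bij_betw (word_value G x) (reduced_words_on I) (carrier G)"
  using basis by (simp add: free_basis_def reduced_words_on_def)

lemma red_in: "g \<in> carrier G \<Longrightarrow> red g \<in> reduced_words_on I"
  unfolding red_def using bij_word_value by (auto simp: bij_betw_def intro!: the_inv_into_into)

lemma red_letters: "g \<in> carrier G \<Longrightarrow> set (red g) \<subseteq> I \<times> UNIV"
  using red_in unfolding reduced_words_on_def by blast

lemma word_value_red [simp]: "g \<in> carrier G \<Longrightarrow> word_value G x (red g) = g"
  unfolding red_def using bij_word_value by (meson f_the_inv_into_f_bij_betw)

lemma red_word_value: "w \<in> reduced_words_on I \<Longrightarrow> red (word_value G x w) = w"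
  unfolding red_def using bij_word_value by (meson bij_betw_def the_inv_into_f_f)

lemma word_induct [consumes 1, case_names one letter inverse]:
  assumes g: "g \<in> carrier G" and one: "P \<one>"
    and letter: "\<And>i h. i \<in> I \<Longrightarrow> h \<in> carrier G \<Longrightarrow> P h \<Longrightarrow> P (x i \<otimes> h)"
    and inverse: "\<And>i h. i \<in> I \<Longrightarrow> h \<in> carrier G \<Longrightarrow> P h \<Longrightarrow> P (inv (x i) \<otimes> h)"
  shows "P g"
proof -
  have "P (word_value G x w)" if "set w \<subseteq> I \<times> UNIV" for w
    using that
  proof (induction w)
    case (Cons l w)
    obtain i s where "l = (i, s)" by (cases l)
    then show ?case using Cons letter[of i "word_value G x w"] inverse[of i "word_value G x w"] by simp
  qed (simp add: one)
  from this[OF red_letters[OF g]] show ?thesis using g by simp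
qed

lemma carrier_subset_generate: "carrier G \<subseteq> generate G (x ` I)"
proof
  fix g assume "g \<in> carrier G"
  then show "g \<in> generate G (x ` I)"
    by (induction g rule: word_induct) (auto intro: generate.intros)
qed

text \<open>Prepending a letter to a reduced word either leaves it reduced or cancels its first
  letter, and in the second case the two inverse maps cancel as well.\<close>

lemma word_action_red:
  assumes T: "\<And>i s v. i \<in> I \<Longrightarrow> v \<in> X \<Longrightarrow> T i s v \<in> X"
    and inverse: "\<And>i s v. i \<in> I \<Longrightarrow> v \<in> X \<Longrightarrow> T i s (T i (\<not> s) v) = v"
    and w: "set w \<subseteq> I \<times> UNIV" and v: "v \<in> X"
  shows "word_action T w v = word_action T (red (word_value G x w)) v"
  using w
proof (induction w)
  case Nil
  have "[] \<in> reduced_words_on I" by (simp add: reduced_words_on_def reduced_word_def)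
  from red_word_value[OF this] show ?case by simp
next
  case (Cons l w)
  obtain i s where l: "l = (i, s)" by (cases l)
  have i: "i \<in> I" and w: "set w \<subseteq> I \<times> UNIV" using Cons.prems l by auto
  define g where "g = word_value G x w"
  have g: "g \<in> carrier G" unfolding g_def using w by simp
  have act_in: "word_action T r v \<in> X" if "set r \<subseteq> I \<times> UNIV" for r
    using that by (induction r) (auto simp: v T)
  have IH: "word_action T w v = word_action T (red g) v" unfolding g_def using Cons w by blast
  show ?case
  proof (cases "\<exists>r. red g = (i, \<not> s) # r")
    case True
    then obtain r where r: "red g = (i, \<not> s) # r" by blast
    have rr: "r \<in> reduced_words_on I"
      using red_in[OF g] unfolding r by (auto simp: reduced_words_on_def reduced_word_Cons)
    have rl: "set r \<subseteq> I \<times> UNIV" using rr by (simp add: reduced_words_on_def)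
    have "g = (if \<not> s then x i else inv (x i)) \<otimes> word_value G x r"
      using word_value_red[OF g] unfolding r by simp
    then have "word_value G x (l # w) = word_value G x r"
      using l i rl by (simp add: g_def[symmetric] mult_inv_cancel_left)
    then have "red (word_value G x (l # w)) = r" using red_word_value[OF rr] by simp
    then show ?thesis using IH r l inverse[OF i act_in[OF rl]] by simp
  next
    case False
    have "(i, s) # red g \<in> reduced_words_on I"
      using red_in[OF g] i False by (auto simp: reduced_words_on_def reduced_word_Cons)
    from red_word_value[OF this] have "red (word_value G x (l # w)) = (i, s) # red g"
      using l g by (simp add: g_def[symmetric])
    then show ?thesis using IH l by simp
  qed
qed

text \<open>The universal property of the free group, stated for actions on a set.\<close>

lemma word_action_mult:
  assumes T: "\<And>i s v. i \<in> I \<Longrightarrow> v \<in> X \<Longrightarrow> T i s v \<in> X"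
    and inverse: "\<And>i s v. i \<in> I \<Longrightarrow> v \<in> X \<Longrightarrow> T i s (T i (\<not> s) v) = v"
    and gh: "g \<in> carrier G" "h \<in> carrier G" and v: "v \<in> X"
  shows "word_action T (red (g \<otimes> h)) v = word_action T (red g) (word_action T (red h) v)"
proof -
  have "word_value G x (red g @ red h) = g \<otimes> h"
    using gh red_letters by (simp add: word_value_append)
  moreover have "word_action T (red g @ red h) v = word_action T (red (word_value G x (red g @ red h))) v"
    using red_letters gh by (intro word_action_red[of X T, OF T inverse _ v]) auto
  ultimately show ?thesis by (simp add: word_action_append)
qed

lemma red_one: "red \<one> = []"
proof -
  have "[] \<in> reduced_words_on I" by (simp add: reduced_words_on_def reduced_word_def)
  from red_word_value[OF this] show ?thesis by simp
qed

lemma red_letter: "i \<in> I \<Longrightarrow> red (x i) = [(i, True)]"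
proof -
  assume i: "i \<in> I"
  then have "[(i, True)] \<in> reduced_words_on I" by (simp add: reduced_words_on_def reduced_word_def)
  from red_word_value[OF this] show ?thesis using i by simp
qed

section \<open>The Magnus expansion\<close>

definition magnus_letter :: "'i \<Rightarrow> bool \<Rightarrow> 'i ncps \<Rightarrow> 'i ncps" where
  "magnus_letter i s f = (if s then 1 + ncps_var i else ncps_inv_var i) * f"

definition magnus :: "'a \<Rightarrow> 'i ncps" where
  "magnus g = word_action magnus_letter (red g) 1"

lemma magnus_one [simp]: "magnus \<one> = 1"
  by (simp add: magnus_def red_one)

lemma magnus_letter [simp]: "i \<in> I \<Longrightarrow> magnus (x i) = 1 + ncps_var i"
  by (simp add: magnus_def red_letter magnus_letter_def)

lemma magnus_mult [simp]:
  assumes "g \<in> carrier G" "h \<in> carrier G"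
  shows "magnus (g \<otimes> h) = magnus g * magnus h"
proof -
  have "word_action magnus_letter (red (g \<otimes> h)) 1
    = word_action magnus_letter (red g) (word_action magnus_letter (red h) 1)"
  proof (rule word_action_mult[of UNIV magnus_letter])
    show "magnus_letter i s (magnus_letter i (\<not> s) v) = v" for i s v
      by (auto simp: magnus_letter_def mult.assoc[symmetric] ncps_inv_var_left ncps_inv_var_right)
  qed (use assms in auto)
  also have "\<dots> = word_action magnus_letter (red g) 1 * word_action magnus_letter (red h) 1"
  proof -
    have "word_action magnus_letter w v = word_action magnus_letter w 1 * v" for w v
      by (induction w) (auto simp: magnus_letter_def mult.assoc)
    then show ?thesis .
  qed
  finally show ?thesis unfolding magnus_def .
qed

lemma magnus_mult_inv: 
  assumes "g \<in> carrier G"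
  shows "magnus g * magnus (inv g) = 1" "magnus (inv g) * magnus g = 1"
  using assms by (simp_all flip: magnus_mult)

lemma magnus_pow: "g \<in> carrier G \<Longrightarrow> magnus (g [^] (n::nat)) = magnus g ^ n"
  by (induction n) (simp_all flip: power_Suc2)

lemma magnus_nth_Nil [simp]: "g \<in> carrier G \<Longrightarrow> ncps_nth (magnus g) [] = 1"
proof (induction g rule: word_induct)
  case (inverse i h)
  then have "magnus (x i) * magnus (inv (x i)) = 1" by (intro magnus_mult_inv) simp
  then have "ncps_nth (magnus (x i) * magnus (inv (x i))) [] = 1" by (simp add: ncps_nth_1)
  then show ?case using inverse by (simp add: ncps_nth_1)
qed (simp_all add: ncps_nth_1)

text \<open>For \<open>p\<close> prime and \<open>k\<close> at least 1 this is the classical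
  dimension subgroup: the \<open>g\<close> for which \<open>g - 1\<close> lies in the
  \<open>k\<close>-th power of the augmentation ideal over the field with \<open>p\<close>
  elements.\<close>

definition dimension_subgroup :: "int \<Rightarrow> nat \<Rightarrow> 'a set" where
  "dimension_subgroup p k = {g \<in> carrier G. magnus g - 1 \<in> ncps_ideal I p k}"

lemma magnus_mult_diff_one:
  "g \<in> carrier G \<Longrightarrow> h \<in> carrier G \<Longrightarrow>
    magnus (g \<otimes> h) - 1 = (magnus g - 1) * (magnus h - 1) + (magnus g - 1) + (magnus h - 1)"
  by (simp add: algebra_simps)

lemma magnus_inv_diff_one:
  "g \<in> carrier G \<Longrightarrow> magnus (inv g) - 1 = - (magnus (inv g) * (magnus g - 1))"
  by (simp add: algebra_simps magnus_mult_inv)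

lemma subgroup_dimension_subgroup: "subgroup (dimension_subgroup p k) G"
proof
  show "dimension_subgroup p k \<subseteq> carrier G" by (auto simp: dimension_subgroup_def)
  show "\<one> \<in> dimension_subgroup p k" by (simp add: dimension_subgroup_def)
  fix g assume g: "g \<in> dimension_subgroup p k"
  then show "inv g \<in> dimension_subgroup p k"
    using magnus_inv_diff_one[of g]
    by (auto simp: dimension_subgroup_def simp del: mult_minus_right intro!: ncps_ideal_uminus ncps_ideal_mult_left)
  fix h assume "h \<in> dimension_subgroup p k"
  then show "g \<otimes> h \<in> dimension_subgroup p k"
    using g unfolding dimension_subgroup_def
    by (auto simp: magnus_mult_diff_one simp del: magnus_mult intro!: ncps_ideal_add ncps_ideal_mult_left)
qed

text \<open>Group commutators become ring commutators up to a factor with constant term 1. Degrees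
  therefore add, and leading words can be read off.\<close>

lemma magnus_commutator_diff_one:
  assumes "g \<in> carrier G" "h \<in> carrier G"
  shows "magnus (commutator G g h) - 1
    = ((magnus g - 1) * (magnus h - 1) - (magnus h - 1) * (magnus g - 1)) * magnus (inv g \<otimes> inv h)"
proof -
  have "magnus (commutator G g h) - 1
    = (magnus g * magnus h - magnus h * magnus g) * magnus (inv g \<otimes> inv h)"
  proof -
    have "h \<otimes> g \<otimes> (inv g \<otimes> inv h) = \<one>" using assms by (simp add: group_word_simps)
    then have "magnus h * magnus g * magnus (inv g \<otimes> inv h) = 1"
      using assms by (metis magnus_mult magnus_one m_closed inv_closed)
    moreover have "magnus (commutator G g h) = magnus g * magnus h * magnus (inv g \<otimes> inv h)"
      using assms by (simp add: commutator_def mult.assoc)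
    ultimately show ?thesis by (simp add: left_diff_distrib)
  qed
  also have "magnus g * magnus h - magnus h * magnus g
    = (magnus g - 1) * (magnus h - 1) - (magnus h - 1) * (magnus g - 1)"
    by (simp add: algebra_simps)
  finally show ?thesis .
qed

lemma carrier_subset_dimension_subgroup: "carrier G \<subseteq> dimension_subgroup p 1"
  by (auto simp: dimension_subgroup_def ncps_ideal_def ncps_nth_1)

lemma lower_central_subset_dimension_subgroup:
  "1 \<le> i \<Longrightarrow> lower_central G i \<subseteq> dimension_subgroup p i"
proof (induction i rule: nat_induct_at_least)
  case base
  then show ?case using carrier_subset_dimension_subgroup by simp
next
  case (Suc i)
  show ?case unfolding lower_central_Suc[OF Suc.hyps]
  proof (rule generate_subgroup_incl[OF _ subgroup_dimension_subgroup], safe)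
    fix a c assume a: "a \<in> carrier G" and c: "c \<in> lower_central G i"
    have cc: "c \<in> carrier G" using c lower_central_closed by blast
    have "magnus a - 1 \<in> ncps_ideal I p 1" "magnus c - 1 \<in> ncps_ideal I p i"
      using a c Suc carrier_subset_dimension_subgroup by (auto simp: dimension_subgroup_def)
    from ncps_ideal_mult[OF this] ncps_ideal_mult[OF this(2,1)]
    have "(magnus a - 1) * (magnus c - 1) \<in> ncps_ideal I p (Suc i)"
      "(magnus c - 1) * (magnus a - 1) \<in> ncps_ideal I p (Suc i)" by simp_all
    then have "magnus (commutator G a c) - 1 \<in> ncps_ideal I p (Suc i)"
      unfolding magnus_commutator_diff_one[OF a cc]
      by (rule ncps_ideal_mult_right[OF ncps_ideal_diff])
    then show "commutator G a c \<in> dimension_subgroup p (Suc i)"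
      using a cc by (simp add: dimension_subgroup_def)
  qed
qed

lemma magnus_prime_power:
  assumes "prime p" "g \<in> carrier G"
  shows "magnus (g [^] (p ^ j)) - 1 - (magnus g - 1) ^ (p ^ j) \<in> ncps_ideal I (int p) k"
  using frobenius_ncps[OF assms(1), of "magnus g - 1" j I k] assms(2)
  by (simp add: magnus_pow diff_diff_eq)

lemma dimension_subgroup_prime_power:
  assumes "prime p" "g \<in> dimension_subgroup (int p) i"
  shows "g [^] (p ^ j) \<in> dimension_subgroup (int p) (i * p ^ j)"
proof -
  have g: "g \<in> carrier G" "magnus g - 1 \<in> ncps_ideal I (int p) i"
    using assms(2) by (auto simp: dimension_subgroup_def)
  have "(magnus g - 1) ^ (p ^ j) \<in> ncps_ideal I (int p) (i * p ^ j)"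
    using ncps_ideal_power[OF g(2), of "p ^ j"] by (simp add: mult.commute)
  from ncps_ideal_add[OF magnus_prime_power[OF assms(1) g(1), of j "i * p ^ j"] this]
  show ?thesis using g by (simp add: dimension_subgroup_def)
qed

lemma zassenhaus_subset_dimension_subgroup:
  assumes "prime p"
  shows "zassenhaus_subgroup G p k \<subseteq> dimension_subgroup (int p) k"
proof -
  have "power_subgroup G (lower_central G i) (p ^ j) \<subseteq> dimension_subgroup (int p) k"
    if "1 \<le> i" "k \<le> i * p ^ j" for i j
    unfolding power_subgroup_def
  proof (rule generate_subgroup_incl[OF _ subgroup_dimension_subgroup], safe)
    fix h assume "h \<in> lower_central G i"
    then have "h [^] (p ^ j) \<in> dimension_subgroup (int p) (i * p ^ j)"
      using lower_central_subset_dimension_subgroup[OF that(1)] dimension_subgroup_prime_power[OF assms] by blast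
    then show "h [^] (p ^ j) \<in> dimension_subgroup (int p) k"
      using ncps_ideal_mono[OF that(2)] by (auto simp: dimension_subgroup_def)
  qed
  then show ?thesis unfolding zassenhaus_subgroup_def
    by (intro generate_subgroup_incl[OF _ subgroup_dimension_subgroup]) auto
qed

text \<open>The product of the two series without constant terms can lead only from
  \<open>w @ w\<close> on, which comes after the nonempty word \<open>w\<close>; so the leading
  coefficients simply add.\<close>

lemma leads_magnus_mult:
  assumes ab: "a \<in> carrier G" "b \<in> carrier G"
    and l: "leads I p (magnus a - 1) w c" "leads I p (magnus b - 1) w d"
    and w: "w \<in> lists I" "w \<noteq> []"
  shows "leads I p (magnus (a \<otimes> b) - 1) w (c + d)"
proof -
  have "leads I p ((magnus a - 1) * (magnus b - 1)) (w @ w) (c * d)"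
    by (rule leads_mult[OF l w(1) w(1)])
  then have "leads I p ((magnus a - 1) * (magnus b - 1)) w 0"
    by (rule leads_weaken) (use w in \<open>auto simp: word_before_def\<close>)
  from leads_add[OF leads_add[OF this l(1)] l(2)]
  show ?thesis unfolding magnus_mult_diff_one[OF ab] by simp
qed

lemma leads_magnus_int_pow:
  assumes g: "g \<in> carrier G" and l: "leads I p (magnus g - 1) w c" and w: "w \<in> lists I" "w \<noteq> []"
  shows "leads I p (magnus (g [^] (e::int)) - 1) w (e * c)"
proof -
  have nat: "leads I p (magnus (g [^] (n::nat)) - 1) w (int n * c)" for n
  proof (induction n)
    case 0
    show ?case by (simp add: leads_def)
  next
    case (Suc n)
    from leads_magnus_mult[OF _ g Suc l w] g show ?case by (simp add: algebra_simps del: magnus_mult)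
  qed
  have inverse: "leads I p (magnus (inv a) - 1) w (- d)"
    if "a \<in> carrier G" "leads I p (magnus a - 1) w d" for a d
  proof -
    have "leads I p (magnus (inv a)) [] 1"
      using that by (simp add: leads_def word_before_def)
    from leads_uminus[OF leads_mult[OF this that(2) _ w(1)]]
    show ?thesis unfolding magnus_inv_diff_one[OF that(1)] by simp
  qed
  show ?thesis
  proof (cases "0 \<le> e")
    case True
    then obtain n where "e = int n" using nonneg_int_cases by blast
    then show ?thesis using nat[of n] by (simp add: int_pow_int)
  next
    case False
    define n where "n = nat (- e)"
    have e: "e = - int n" using False by (simp add: n_def)
    then have "g [^] e = inv (g [^] n)" using g by (simp add: int_pow_neg int_pow_int)
    then show ?thesis using inverse[OF _ nat[of n]] g e by simp
  qed
qed

text \<open>For \<open>w = u @ v\<close> the two products in the ring commutator lead with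
  \<open>u @ v\<close> and \<open>v @ u\<close>, which have equal length, and
  \<open>w < v \<le> v @ u\<close> shows that the first one wins.\<close>

lemma leads_lyndon_commutator:
  "w \<in> lists I \<Longrightarrow> lyndon w \<Longrightarrow> leads I p (magnus (lc w) - 1) w 1"
proof (induction w rule: measure_induct_rule[of length])
  case (less w)
  show ?case
  proof (cases "2 \<le> length w")
    case True
    define u v where "u = std_prefix w" and "v = std_suffix w"
    note f = std_factorization[OF True, folded u_def v_def]
      and l = length_std_factors[OF True, folded u_def v_def]
      and i = std_factors_in_lists[OF less.prems(1) True, folded u_def v_def]
      and ly = lyndon_std_prefix[OF less.prems(2) True, folded u_def v_def]
        lyndon_std_suffix[OF True, folded u_def v_def]
    have c: "lc u \<in> carrier G" "lc v \<in> carrier G" using f i lc_closed by auto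
    note A = less.IH[OF l(1) i(1) ly(1)] and B = less.IH[OF l(2) i(2) ly(2)]
    have "w < v" using less.prems(2) f lyndon_less_suffix[of u v] by simp
    then have "w < v @ u" using le_append_self[of v u] by (rule less_le_trans)
    then have wb: "word_before w (v @ u)" using l(3) by (simp add: word_before_def)
    have "leads I p ((magnus (lc v) - 1) * (magnus (lc u) - 1)) (v @ u) (1 * 1)"
      by (rule leads_mult[OF B A i(2,1)])
    then have "leads I p ((magnus (lc v) - 1) * (magnus (lc u) - 1)) w 0"
      by (rule leads_weaken) (use wb less.prems in auto)
    moreover have "leads I p ((magnus (lc u) - 1) * (magnus (lc v) - 1)) w 1"
      using leads_mult[OF A B i(1,2)] f(1) by simp
    ultimately have D: "leads I p ((magnus (lc u) - 1) * (magnus (lc v) - 1)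
        - (magnus (lc v) - 1) * (magnus (lc u) - 1)) w (1 - 0)"
      by (rule leads_diff[rotated])
    have "leads I p (magnus (inv (lc u) \<otimes> inv (lc v))) [] 1"
      using c magnus_nth_Nil[of "inv (lc u) \<otimes> inv (lc v)"]
      by (simp add: leads_def word_before_def del: magnus_mult magnus_nth_Nil)
    from leads_mult[OF D this less.prems(1)]
    show ?thesis
      using lyndon_commutator_std[OF True, of G x, folded u_def v_def] magnus_commutator_diff_one[OF c]
      by simp
  next
    case False
    then obtain a where w: "w = [a]" using less.prems(2) lyndon_nonempty
      by (cases w) (auto simp: not_le less_Suc_eq)
    then show ?thesis using less.prems
      by (auto simp: leads_def word_before_def ncps_nth_var)
  qed
qed

lemma zassenhaus_subgroup_is_subgroup: "subgroup (zassenhaus_subgroup G p k) G"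
  unfolding zassenhaus_subgroup_def
proof (rule generate_is_subgroup, safe)
  fix i j g assume "g \<in> power_subgroup G (lower_central G i) (p ^ j)"
  then show "g \<in> carrier G"
    unfolding power_subgroup_def using lower_central_closed
    by (elim generate_in_carrier[rotated]) auto
qed

lemma prime_power_in_zassenhaus:
  assumes "1 \<le> i" "k \<le> i * p ^ j" "g \<in> lower_central G i"
  shows "g [^] (p ^ j) \<in> zassenhaus_subgroup G p k"
proof -
  have "g [^] (p ^ j) \<in> power_subgroup G (lower_central G i) (p ^ j)"
    unfolding power_subgroup_def using assms(3) by (auto intro: generate.incl)
  then show ?thesis
    unfolding zassenhaus_subgroup_def using assms(1,2) by (intro generate.incl) auto
qed

lemma exists_first_word:
  assumes "finite A" "A \<noteq> {}"
  shows "\<exists>a\<in>A. \<forall>b\<in>A. \<not> word_before (f b) (f a)"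
  using assms
proof (induction A rule: finite_ne_induct)
  case (insert a A)
  then obtain m where m: "m \<in> A" "\<forall>b\<in>A. \<not> word_before (f b) (f m)" by blast
  show ?case
  proof (cases "word_before (f a) (f m)")
    case True
    then have "\<forall>b\<in>insert a A. \<not> word_before (f b) (f a)" using m word_before_trans by fastforce
    then show ?thesis by blast
  qed (use m in auto)
qed simp

text \<open>The leading words \<open>w\<^bsup>q\<^esup>\<close>, with \<open>w\<close> Lyndon and \<open>q\<close> a power of \<open>p\<close>, are pairwise distinct, so
  the first one in a Lyndon factorization cannot be cancelled.\<close>

theorem dimension_subgroup_subset_zassenhaus:
  assumes p: "prime p" and k: "1 \<le> k"
  shows "dimension_subgroup (int p) k \<subseteq> zassenhaus_subgroup G p k"
proof
  fix g assume "g \<in> dimension_subgroup (int p) k"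
  then have g: "g \<in> carrier G" "magnus g - 1 \<in> ncps_ideal I (int p) k"
    by (auto simp: dimension_subgroup_def)
  obtain L e r where L: "distinct L" "\<And>w. w \<in> set L \<Longrightarrow> w \<in> lists I \<and> lyndon w \<and> length w < k"
    and r: "r \<in> lower_central G k" "g = lyndon_product e L \<otimes> r"
    using lyndon_factorization[OF carrier_subset_generate g(1) k] by blast
  have p1: "\<not> is_unit (int p)" and p2: "2 \<le> p" using prime_ge_2_nat[OF p] by auto
  \<comment> \<open>\<open>multiplicity\<close> is 0 at 0, so the factorization \<open>ee\<close>
    also covers vanishing exponents; only \<open>e'p\<close> has to exclude them.\<close>
  define j where "j = (\<lambda>w. multiplicity (int p) (e w))"
  define e' where "e' = (\<lambda>w. e w div int p ^ j w)"
  define W where "W = (\<lambda>w. word_power w (p ^ j w))"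
  have ee: "e w = int (p ^ j w) * e' w" for w
    unfolding e'_def j_def using multiplicity_dvd[of "int p" "e w"] by simp
  have e'p: "\<not> int p dvd e' w" if "e w \<noteq> 0" for w
    unfolding e'_def j_def by (rule multiplicity_decompose[OF that p1])
  have cl: "lc w \<in> carrier G" if "w \<in> set L" for w
    using L(2)[OF that] lc_closed lyndon_nonempty by blast
  have WI: "W w \<in> lists I" "W w \<noteq> []" if "w \<in> set L" for w
  proof -
    show "W w \<in> lists I" unfolding W_def using L(2)[OF that] set_word_power by fastforce
    have "length (W w) \<noteq> 0" unfolding W_def using L(2)[OF that] p2 lyndon_nonempty[of w] by simp
    then show "W w \<noteq> []" by simp
  qed
  have pow: "lc w [^] e w = (lc w [^] (p ^ j w)) [^] e' w" if "w \<in> set L" for w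
    using int_pow_pow[OF cl[OF that], of "int (p ^ j w)" "e' w"] ee[of w] by (simp add: int_pow_int del: of_nat_power)
  have lead: "leads I (int p) (magnus (lc w [^] e w) - 1) (W w) (e' w)" if "w \<in> set L" for w
  proof -
    have "leads I (int p) ((magnus (lc w) - 1) ^ (p ^ j w)) (W w) 1"
      unfolding W_def using L(2)[OF that] by (intro leads_power leads_lyndon_commutator) auto
    \<comment> \<open>The Frobenius error is divisible by \<open>p\<close> in every degree, so its
      bound is free; \<open>lessI\<close> places it just above the length of
      \<open>W w\<close>.\<close>
    moreover have "leads I (int p)
      (magnus (lc w [^] (p ^ j w)) - 1 - (magnus (lc w) - 1) ^ (p ^ j w)) (W w) 0"
      by (rule leads_of_ideal[OF magnus_prime_power[OF p cl[OF that]] lessI WI(1)[OF that]])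
    ultimately have "leads I (int p) (magnus (lc w [^] (p ^ j w)) - 1) (W w) 1"
      using leads_add by fastforce
    then have "leads I (int p) (magnus ((lc w [^] (p ^ j w)) [^] e' w) - 1) (W w) (e' w * 1)"
      using cl[OF that] WI[OF that] by (intro leads_magnus_int_pow) auto
    then show ?thesis unfolding pow[OF that] by simp
  qed
  \<comment> \<open>If some leading word were shorter than \<open>k\<close>, so would be the first
    one, \<open>W v\<close>. Its coefficient in \<open>magnus g - 1\<close> is congruent to
    \<open>e' v\<close> and would have to vanish modulo \<open>p\<close>.\<close>
  have deep: "k \<le> length (W w)" if "w \<in> set L" "e w \<noteq> 0" for w
  proof (rule ccontr)
    assume shallow: "\<not> k \<le> length (W w)"
    have "{w \<in> set L. e w \<noteq> 0} \<noteq> {}" using that by blast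
    then obtain v where v: "v \<in> set L" "e v \<noteq> 0"
      and first: "\<And>u. u \<in> set L \<Longrightarrow> e u \<noteq> 0 \<Longrightarrow> \<not> word_before (W u) (W v)"
      using exists_first_word[of "{w \<in> set L. e w \<noteq> 0}" W] by auto
    have short: "length (W v) < k"
      using first[OF that] shallow by (auto simp: word_before_def)
    \<comment> \<open>The other factors begin strictly later: their leading words differ from
      \<open>W v\<close> and none comes before it.\<close>
    have lead0: "leads I (int p) (magnus (lc u [^] e u) - 1) (W v) 0" if u: "u \<in> set L" "u \<noteq> v" for u
    proof (cases "e u = 0")
      case True
      then show ?thesis by (simp add: leads_def)
    next
      case False
      have "W u \<noteq> W v"
        unfolding W_def using lyndon_word_power_eq[of u v p "j u" "j v"] L(2) u v p2 by blast
      then have "word_before (W v) (W u)"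
        using first[OF u(1) False] word_before_linear by blast
      then show ?thesis by (rule leads_weaken[OF lead[OF u(1)] _ WI(1)[OF v(1)]])
    qed
    have prod: "lyndon_product e M \<in> carrier G
      \<and> leads I (int p) (magnus (lyndon_product e M) - 1) (W v) (if v \<in> set M then e' v else 0)"
      if "distinct M" "set M \<subseteq> set L" for M
      using that
    proof (induction M)
      case Nil
      show ?case by (simp add: leads_def)
    next
      case (Cons u M)
      have u: "u \<in> set L" using Cons by simp
      have M: "lyndon_product e M \<in> carrier G"
        "leads I (int p) (magnus (lyndon_product e M) - 1) (W v) (if v \<in> set M then e' v else 0)"
        using Cons by auto
      have "leads I (int p) (magnus (lc u [^] e u) - 1) (W v) (if u = v then e' v else 0)"
        using lead[OF u] lead0[OF u] by (cases "u = v") auto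
      from leads_magnus_mult[OF int_pow_closed[OF cl[OF u]] M(1) this M(2) WI[OF v(1)]]
      have "leads I (int p) (magnus (lc u [^] e u \<otimes> lyndon_product e M) - 1) (W v)
        ((if u = v then e' v else 0) + (if v \<in> set M then e' v else 0))" .
      moreover have "(if u = v then e' v else 0) + (if v \<in> set M then e' v else 0)
        = (if v \<in> set (u # M) then e' v else 0)"
        using Cons.prems(1) by auto
      ultimately show ?case using M(1) cl[OF u] by (simp only: lyndon_product_Cons int_pow_closed m_closed)
    qed
    have "magnus r - 1 \<in> ncps_ideal I (int p) k"
      using lower_central_subset_dimension_subgroup[OF k] r(1) by (auto simp: dimension_subgroup_def)
    from leads_of_ideal[OF this short WI(1)[OF v(1)]] prod[OF L(1)]
    have "leads I (int p) (magnus g - 1) (W v) (e' v + 0)"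
      unfolding r(2) using v(1) WI[OF v(1)] lower_central_closed[OF r(1)]
      by (intro leads_magnus_mult) auto
    moreover have "int p dvd ncps_nth (magnus g - 1) (W v)"
      by (rule ncps_idealD[OF g(2) WI(1)[OF v(1)] short])
    ultimately have "int p dvd e' v"
      unfolding leads_def by (metis add.right_neutral dvd_diffD1 dvd_diff_right_iff)
    then show False using e'p[OF v(2)] by simp
  qed
  note Z = zassenhaus_subgroup_is_subgroup[of p k]
  have "lc w [^] e w \<in> zassenhaus_subgroup G p k" if "w \<in> set L" for w
  proof (cases "e w = 0")
    case True
    then show ?thesis using subgroup.one_closed[OF Z] by simp
  next
    case False
    have "1 \<le> length w" using L(2)[OF that] lyndon_nonempty by (auto simp: Suc_le_eq)
    moreover have "k \<le> length w * p ^ j w"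
      using deep[OF that False] by (simp add: W_def mult.commute)
    moreover have "lc w \<in> lower_central G (length w)"
      using L(2)[OF that] lyndon_nonempty lc_in_lower_central by blast
    ultimately show ?thesis
      unfolding pow[OF that] by (intro subgroup_int_pow_closed[OF Z] prime_power_in_zassenhaus)
  qed
  then have "lyndon_product e L \<in> zassenhaus_subgroup G p k"
    using subgroup.one_closed[OF Z] subgroup.m_closed[OF Z]
    by (induction L) auto
  \<comment> \<open>Taking \<open>i = k\<close> and \<open>j = 0\<close> in the definition puts
    \<open>lower_central G k\<close> itself into the Zassenhaus subgroup.\<close>
  moreover have "r \<in> zassenhaus_subgroup G p k"
    using prime_power_in_zassenhaus[of k k p 0 r] k r(1) lower_central_closed[OF r(1)] by simp
  ultimately show "g \<in> zassenhaus_subgroup G p k"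
    unfolding r(2) by (rule subgroup.m_closed[OF Z])
qed

end


section \<open>Fox calculus\<close>

lemma lin_ext_mult_left: "lin_ext (\<lambda>a. m * \<phi> a) u = m * lin_ext \<phi> u"
  unfolding lin_ext_def sum_distrib_left
  by (intro sum.cong refl) (metis mult.assoc mult_of_int_commute)

lemma lin_ext_mult_right: "lin_ext (\<lambda>a. \<phi> a * m) u = lin_ext \<phi> u * m"
  unfolding lin_ext_def sum_distrib_right by (simp only: mult.assoc)

locale fox_group = free_basis_group G I x for G (structure) and I :: "nat set" and x +
  fixes n :: nat
  assumes letters_eq: "I = {1..n}"
begin

text \<open>The product rule for left multiplication by a letter, read as an affine map on the
  derivative \<open>v\<close> of the rest of the word. The second case reflects that the derivative
  of the inverse of \<open>x j\<close> is minus that inverse.\<close>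

definition fox_letter :: "nat \<Rightarrow> nat \<Rightarrow> bool \<Rightarrow> ('a \<Rightarrow> int) \<Rightarrow> 'a \<Rightarrow> int" where
  "fox_letter j i s v =
     (if s then (\<lambda>h. (if i = j then group_ring_elt \<one> h else 0) + translate (x i) v h)
      else (\<lambda>h. translate (inv (x i)) v h - (if i = j then group_ring_elt (inv (x i)) h else 0)))"

definition fox :: "nat \<Rightarrow> 'a \<Rightarrow> 'a \<Rightarrow> int" where
  "fox j g = word_action (fox_letter j) (red g) (\<lambda>h. 0)"

lemma fox_letter_closed:
  assumes "i \<in> I" "v \<in> carrier (group_ring G)"
  shows "fox_letter j i s v \<in> carrier (group_ring G)"
proof -
  have "(\<lambda>h. if i = j then group_ring_elt a h else 0) \<in> carrier (group_ring G)" if "a \<in> carrier G" for a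
    using that by (cases "i = j") auto
  then show ?thesis using assms unfolding fox_letter_def by auto
qed

lemma fox_letter_inverse:
  assumes "i \<in> I" "v \<in> carrier (group_ring G)"
  shows "fox_letter j i s (fox_letter j i (\<not> s) v) = v"
  using assms translate_elt[of "x i" "inv (x i)"] translate_elt[of "inv (x i)" "\<one>"]
  by (cases "i = j"; cases s)
    (simp_all add: fox_letter_def translate_add translate_diff translate_translate translate_one)

lemma word_action_fox_closed:
  "set w \<subseteq> I \<times> UNIV \<Longrightarrow> v \<in> carrier (group_ring G) \<Longrightarrow>
    word_action (fox_letter j) w v \<in> carrier (group_ring G)"
  by (induction w) (auto intro: fox_letter_closed)

lemma fox_closed [simp]: "g \<in> carrier G \<Longrightarrow> fox j g \<in> carrier (group_ring G)"
  unfolding fox_def by (intro word_action_fox_closed red_letters) auto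

text \<open>Each letter acts by an affine map whose linear part is a translation; composing these
  translations gives the translation by the value of the word.\<close>

lemma word_action_fox:
  assumes "set w \<subseteq> I \<times> UNIV" and v: "v \<in> carrier (group_ring G)"
  shows "word_action (fox_letter j) w v
    = (\<lambda>h. word_action (fox_letter j) w (\<lambda>h. 0) h + translate (word_value G x w) v h)"
  using assms(1)
proof (induction w)
  case Nil
  show ?case using v by (simp add: translate_one)
next
  case (Cons l w)
  obtain i s where l: "l = (i, s)" by (cases l)
  have "set w \<subseteq> I \<times> UNIV" "i \<in> I" using Cons.prems l by auto
  note IH = Cons.IH[OF this(1)] and this
  then show ?case
    unfolding l word_action_Cons
    by (subst IH) (auto simp: fox_letter_def translate_add translate_translate fun_eq_iff)
qed

lemma fox_mult:
  assumes "g \<in> carrier G" "h \<in> carrier G"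
  shows "fox j (g \<otimes> h) = (\<lambda>y. fox j g y + translate g (fox j h) y)"
proof -
  have "fox j (g \<otimes> h) = word_action (fox_letter j) (red g) (fox j h)"
    unfolding fox_def
    by (rule word_action_mult[of "carrier (group_ring G)"])
      (use assms fox_letter_closed fox_letter_inverse in auto)
  also have "\<dots> = (\<lambda>y. fox j g y + translate g (fox j h) y)"
    using word_action_fox[OF red_letters[OF assms(1)] fox_closed[OF assms(2)], of j] assms(1)
    unfolding fox_def[of j g] by simp
  finally show ?thesis .
qed

lemma fox_one [simp]: "fox j \<one> = (\<lambda>h. 0)"
  by (simp add: fox_def red_one)

lemma fox_generator: "i \<in> I \<Longrightarrow> fox j (x i) = (if i = j then group_ring_elt \<one> else (\<lambda>h. 0))"
  by (auto simp: fox_def red_letter fox_letter_def fun_eq_iff)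

definition fox_ext :: "nat \<Rightarrow> ('a \<Rightarrow> int) \<Rightarrow> 'a \<Rightarrow> int" where
  "fox_ext j u = (\<lambda>h. lin_ext (\<lambda>a. fox j a h) u)"

lemma fox_ext_zero [simp]: "fox_ext j (\<lambda>h. 0) = (\<lambda>h. 0)"
  by (simp add: fox_ext_def)

lemma fox_ext_elt [simp]: "fox_ext j (group_ring_elt a) = fox j a"
  by (simp add: fox_ext_def)

lemma fox_ext_add:
  "u \<in> carrier (group_ring G) \<Longrightarrow> v \<in> carrier (group_ring G) \<Longrightarrow>
    fox_ext j (\<lambda>h. u h + v h) = (\<lambda>h. fox_ext j u h + fox_ext j v h)"
  unfolding fox_ext_def by (intro ext lin_ext_add group_ring_finite)

lemma fox_ext_diff:
  "u \<in> carrier (group_ring G) \<Longrightarrow> v \<in> carrier (group_ring G) \<Longrightarrow>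
    fox_ext j (\<lambda>h. u h - v h) = (\<lambda>h. fox_ext j u h - fox_ext j v h)"
  unfolding fox_ext_def by (intro ext lin_ext_diff group_ring_finite)

lemma fox_ext_closed [simp]: "u \<in> carrier (group_ring G) \<Longrightarrow> fox_ext j u \<in> carrier (group_ring G)"
  by (induction u rule: group_ring_induct) (simp_all add: fox_ext_add fox_ext_diff)

lemma augmentation_zero: "augmentation (\<lambda>h. 0) = 0"
  and augmentation_elt: "augmentation (group_ring_elt a) = 1"
  by (simp_all add: augmentation_eq_lin_ext)

lemma augmentation_add:
  "u \<in> carrier (group_ring G) \<Longrightarrow> v \<in> carrier (group_ring G) \<Longrightarrow>
    augmentation (\<lambda>h. u h + v h) = augmentation u + augmentation v"
  and augmentation_diff:
  "u \<in> carrier (group_ring G) \<Longrightarrow> v \<in> carrier (group_ring G) \<Longrightarrow>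
    augmentation (\<lambda>h. u h - v h) = augmentation u - augmentation v"
  unfolding augmentation_eq_lin_ext by (simp_all add: lin_ext_add lin_ext_diff group_ring_finite)

lemma fox_ext_translate:
  assumes "a \<in> carrier G" "v \<in> carrier (group_ring G)"
  shows "fox_ext j (translate a v) = (\<lambda>h. augmentation v * fox j a h + translate a (fox_ext j v) h)"
  using assms(2)
proof (induction v rule: group_ring_induct)
  case zero
  show ?case by (simp add: augmentation_zero)
next
  case (add c u)
  then show ?case using assms(1)
    by (simp add: translate_add translate_elt fox_ext_add fox_mult augmentation_add augmentation_elt
        distrib_right fun_eq_iff)
next
  case (diff c u)
  then show ?case using assms(1)
    by (simp add: translate_diff translate_elt fox_ext_diff fox_mult augmentation_diff augmentation_elt
        left_diff_distrib fun_eq_iff)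
qed

lemma fox_ext_mult:
  assumes u: "u \<in> carrier (group_ring G)" and v: "v \<in> carrier (group_ring G)"
  shows "fox_ext j (u \<otimes>\<^bsub>group_ring G\<^esub> v)
    = (\<lambda>h. augmentation v * fox_ext j u h + (u \<otimes>\<^bsub>group_ring G\<^esub> fox_ext j v) h)"
  using u
proof (induction u rule: group_ring_induct)
  case zero
  show ?case by simp
next
  case (add a u)
  then show ?case using v
    by (simp add: group_ring_mult_add group_ring_finite group_ring_mult_elt fox_ext_add
        fox_ext_translate distrib_left fun_eq_iff)
next
  case (diff a u)
  then show ?case using v
    by (simp add: group_ring_mult_diff group_ring_finite group_ring_mult_elt fox_ext_diff
        fox_ext_translate right_diff_distrib fun_eq_iff)
qed

lemma is_fox_derivative_fox_ext:
  "is_fox_derivative G n x j (restrict (fox_ext j) (carrier (group_ring G)))"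
  unfolding is_fox_derivative_def Let_def group_ring_simps letters_eq[symmetric]
  by (auto simp: fox_ext_add fox_ext_mult fox_generator)

text \<open>Additivity reduces the claim to group elements and the product rule reduces it to
  letters. Values involving an inverse letter are forced because translation by \<open>x i\<close>
  is injective.\<close>

lemma is_fox_derivative_unique:
  assumes D: "is_fox_derivative G n x j D" and u: "u \<in> carrier (group_ring G)"
  shows "D u = fox_ext j u"
proof -
  let ?R = "carrier (group_ring G)"
  have closed: "D v \<in> ?R" if "v \<in> ?R" for v
    using D that unfolding is_fox_derivative_def Let_def by auto
  have add: "D (\<lambda>h. u h + v h) = (\<lambda>h. D u h + D v h)" if "u \<in> ?R" "v \<in> ?R" for u v
    using D that unfolding is_fox_derivative_def Let_def group_ring_simps by auto
  have gen: "D (group_ring_elt (x i)) = fox j (x i)" if "i \<in> I" for i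
    using D that unfolding is_fox_derivative_def Let_def group_ring_simps letters_eq[symmetric]
    by (auto simp: fox_generator)
  have mult: "D (group_ring_elt (a \<otimes> c)) = (\<lambda>h. D (group_ring_elt a) h + translate a (D (group_ring_elt c)) h)"
    if "a \<in> carrier G" "c \<in> carrier G" for a c
  proof -
    have "D (group_ring_elt a \<otimes>\<^bsub>group_ring G\<^esub> group_ring_elt c)
      = (\<lambda>h. augmentation (group_ring_elt c) * D (group_ring_elt a) h
           + (group_ring_elt a \<otimes>\<^bsub>group_ring G\<^esub> D (group_ring_elt c)) h)"
      using D that unfolding is_fox_derivative_def Let_def group_ring_simps by auto
    then show ?thesis using that by (simp add: group_ring_mult_elt translate_elt augmentation_elt)
  qed
  have diff: "D (\<lambda>h. u h - v h) = (\<lambda>h. D u h - D v h)" if "u \<in> ?R" "v \<in> ?R" for u v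
    using add[OF group_ring_diff_closed[OF that] that(2)] by (simp add: fun_eq_iff)
  \<comment> \<open>The product rule at \<open>\<one> \<otimes> \<one>\<close> makes the value equal
    to twice itself.\<close>
  have one: "D (group_ring_elt \<one>) = (\<lambda>h. 0)"
    using mult[of \<one> \<one>] closed[of "group_ring_elt \<one>"] by (simp add: translate_one fun_eq_iff)
  have zero: "D (\<lambda>h. 0) = (\<lambda>h. 0)"
    using add[of "\<lambda>h. 0" "\<lambda>h. 0"] by (simp add: fun_eq_iff)
  have elt: "D (group_ring_elt g) = fox j g" if "g \<in> carrier G" for g
    using that
  proof (induction g rule: word_induct)
    case one
    show ?case using \<open>D (group_ring_elt \<one>) = (\<lambda>h. 0)\<close> by simp
  next
    case (letter i h)
    then show ?case using mult[of "x i" h] gen by (simp add: fox_mult)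
  next
    case (inverse i h)
    define k where "k = inv (x i) \<otimes> h"
    have c: "x i \<in> carrier G" "k \<in> carrier G" "h = x i \<otimes> k"
      using inverse by (simp_all add: k_def mult_inv_cancel_left)
    have "translate (x i) (D (group_ring_elt k)) = translate (x i) (fox j k)"
      using mult[OF c(1,2)] fox_mult[OF c(1,2), of j] gen[OF inverse(1)] inverse(3) c(3)
      by (simp add: fun_eq_iff)
    then have "translate (inv (x i)) (translate (x i) (D (group_ring_elt k)))
      = translate (inv (x i)) (translate (x i) (fox j k))" by simp
    then have "D (group_ring_elt k) = fox j k"
      using c closed[of "group_ring_elt k"] by (simp add: translate_translate translate_one)
    then show ?case by (simp add: k_def)
  qed
  show ?thesis using u
    by (induction u rule: group_ring_induct)
      (simp_all add: zero add diff elt fox_ext_add fox_ext_diff)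
qed

lemma fox_derivative_eq: "fox_derivative G n x j = restrict (fox_ext j) (carrier (group_ring G))"
  unfolding fox_derivative_def
proof (rule the_equality)
  show "is_fox_derivative G n x j (restrict (fox_ext j) (carrier (group_ring G)))
    \<and> restrict (fox_ext j) (carrier (group_ring G)) \<in> extensional (carrier (group_ring G))"
    using is_fox_derivative_fox_ext by simp
  fix D assume "is_fox_derivative G n x j D \<and> D \<in> extensional (carrier (group_ring G))"
  then show "D = restrict (fox_ext j) (carrier (group_ring G))"
    using is_fox_derivative_unique by (auto simp: extensional_def fun_eq_iff)
qed

abbreviation magnus_ext :: "('a \<Rightarrow> int) \<Rightarrow> nat ncps" where
  "magnus_ext \<equiv> lin_ext magnus"

text \<open>The Magnus expansion composed with inversion, an antihomomorphism. Extended linearly it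
  expands the conjugate of an element without any Fox derivative of a conjugate having to be
  computed.\<close>

definition conj_magnus :: "'a \<Rightarrow> nat ncps" where
  "conj_magnus g = magnus (inv g)"

lemma conj_magnus_mult:
  "g \<in> carrier G \<Longrightarrow> h \<in> carrier G \<Longrightarrow> conj_magnus (g \<otimes> h) = conj_magnus h * conj_magnus g"
  by (simp add: conj_magnus_def inv_mult_group)

lemma fox_letter_mult:
  assumes "i \<in> I" "h \<in> carrier G"
  shows "lin_ext \<phi> (fox j (x i \<otimes> h)) = (if i = j then \<phi> \<one> else 0) + lin_ext (\<lambda>c. \<phi> (x i \<otimes> c)) (fox j h)"
  using assms
  by (simp add: fox_mult lin_ext_add group_ring_finite fox_generator lin_ext_translate)

text \<open>The fundamental formula of Fox calculus, g - 1 = sum of (dg/dx_j)(x_j - 1), transported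
  by the Magnus expansion, which sends x_j - 1 to the variable.\<close>

lemma magnus_eq_sum_fox:
  assumes "g \<in> carrier G"
  shows "magnus g = 1 + (\<Sum>j\<in>I. magnus_ext (fox j g) * ncps_var j)"
  using assms
proof (induction g rule: word_induct)
  have *: "1 + (\<Sum>j\<in>I. magnus_ext (fox j (x i \<otimes> h)) * ncps_var j)
    = magnus (x i) * (1 + (\<Sum>j\<in>I. magnus_ext (fox j h) * ncps_var j))"
    if ih: "i \<in> I" "h \<in> carrier G" for i h
  proof -
    have "magnus_ext (fox j (x i \<otimes> h)) * ncps_var j
      = (if i = j then ncps_var j else 0) + magnus (x i) * (magnus_ext (fox j h) * ncps_var j)" for j
    proof -
      have "lin_ext (\<lambda>c. magnus (x i \<otimes> c)) (fox j h) = lin_ext (\<lambda>c. magnus (x i) * magnus c) (fox j h)"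
        using ih by (intro lin_ext_fun_cong) auto
      then show ?thesis
        using ih fox_letter_mult[of i h magnus j]
        by (simp add: lin_ext_mult_left distrib_right mult.assoc del: magnus_letter)
    qed
    then have "(\<Sum>j\<in>I. magnus_ext (fox j (x i \<otimes> h)) * ncps_var j)
      = ncps_var i + magnus (x i) * (\<Sum>j\<in>I. magnus_ext (fox j h) * ncps_var j)"
      using ih finite_letters by (simp add: sum.distrib sum_distrib_left del: magnus_letter)
    then show ?thesis using ih by (simp add: distrib_left)
  qed
  case one
  show ?case by simp
  case (letter i h)
  then show ?case using *[of i h] by (simp del: magnus_letter)
  case (inverse i h)
  \<comment> \<open>An inverse letter is handled backwards: the identity for
    \<open>h = x i \<otimes> k\<close> gives the one for \<open>k\<close> after cancelling the unit
    \<open>magnus (x i)\<close>.\<close>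
  define k where "k = inv (x i) \<otimes> h"
  have c: "x i \<in> carrier G" "k \<in> carrier G" "h = x i \<otimes> k"
    using inverse by (simp_all add: k_def mult_inv_cancel_left)
  have "magnus (x i) * magnus k = magnus (x i) * (1 + (\<Sum>j\<in>I. magnus_ext (fox j k) * ncps_var j))"
    using *[OF inverse(1) c(2)] inverse(3) c by (simp del: magnus_letter)
  then have "magnus (inv (x i)) * (magnus (x i) * magnus k)
    = magnus (inv (x i)) * (magnus (x i) * (1 + (\<Sum>j\<in>I. magnus_ext (fox j k) * ncps_var j)))"
    by simp
  then show ?case
    using c magnus_mult_inv(2)[OF c(1)] unfolding k_def[symmetric] mult.assoc[symmetric]
    by (simp del: magnus_letter)
qed

text \<open>The same fundamental formula under an antihomomorphism: the factors change places, and
  x_j - 1 turns into the expansion of the inverse of x_j minus 1.\<close>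

lemma conj_magnus_eq_sum_fox:
  assumes "g \<in> carrier G"
  shows "conj_magnus g = 1 + (\<Sum>j\<in>I. (conj_magnus (x j) - 1) * lin_ext conj_magnus (fox j g))"
  using assms
proof (induction g rule: word_induct)
  let ?S = "\<lambda>h. 1 + (\<Sum>j\<in>I. (conj_magnus (x j) - 1) * lin_ext conj_magnus (fox j h))"
  have *: "?S (x i \<otimes> h) = ?S h * conj_magnus (x i)" if ih: "i \<in> I" "h \<in> carrier G" for i h
  proof -
    have "(conj_magnus (x j) - 1) * lin_ext conj_magnus (fox j (x i \<otimes> h))
      = (if i = j then conj_magnus (x j) - 1 else 0)
        + ((conj_magnus (x j) - 1) * lin_ext conj_magnus (fox j h)) * conj_magnus (x i)" for j
    proof -
      have "lin_ext (\<lambda>c. conj_magnus (x i \<otimes> c)) (fox j h) = lin_ext (\<lambda>c. conj_magnus c * conj_magnus (x i)) (fox j h)"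
        using ih by (intro lin_ext_fun_cong) (auto simp: conj_magnus_mult)
      moreover have "conj_magnus \<one> = 1" by (simp add: conj_magnus_def)
      ultimately show ?thesis
        using ih fox_letter_mult[of i h conj_magnus j]
        by (simp add: lin_ext_mult_right distrib_left mult.assoc)
    qed
    then have "(\<Sum>j\<in>I. (conj_magnus (x j) - 1) * lin_ext conj_magnus (fox j (x i \<otimes> h)))
      = conj_magnus (x i) - 1
        + (\<Sum>j\<in>I. (conj_magnus (x j) - 1) * lin_ext conj_magnus (fox j h)) * conj_magnus (x i)"
      using ih finite_letters by (simp add: sum.distrib sum_distrib_right)
    then show ?thesis by (simp add: distrib_right)
  qed
  case one
  show ?case by (simp add: conj_magnus_def)
  case (letter i h)
  then show ?case using *[of i h] by (simp add: conj_magnus_mult)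
  case (inverse i h)
  define k where "k = inv (x i) \<otimes> h"
  have c: "x i \<in> carrier G" "k \<in> carrier G" "h = x i \<otimes> k"
    using inverse by (simp_all add: k_def mult_inv_cancel_left)
  have "conj_magnus k * conj_magnus (x i) = ?S k * conj_magnus (x i)"
    using *[OF inverse(1) c(2)] inverse(3) c conj_magnus_mult[OF c(1,2)] by simp
  then have "conj_magnus k * (conj_magnus (x i) * magnus (x i)) = ?S k * (conj_magnus (x i) * magnus (x i))"
    unfolding mult.assoc[symmetric] by simp
  moreover have "conj_magnus (x i) * magnus (x i) = 1"
    unfolding conj_magnus_def by (rule magnus_mult_inv(2)[OF c(1)])
  ultimately show ?case by (simp add: k_def)
qed

text \<open>One step of the Taylor expansion: the augmentation is the constant term, and the
  coefficients of words ending in \<open>j\<close> are those of the \<open>j\<close>-th Fox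
  derivative.\<close>

lemma magnus_ext_expand:
  assumes "u \<in> carrier (group_ring G)"
  shows "magnus_ext u = of_int (augmentation u) + (\<Sum>j\<in>I. magnus_ext (fox_ext j u) * ncps_var j)"
  using assms
proof (induction u rule: group_ring_induct)
  case zero
  show ?case by (simp add: augmentation_zero)
next
  case (add a u)
  then show ?case
    by (simp add: lin_ext_add group_ring_finite fox_ext_add augmentation_add augmentation_elt
        distrib_right sum.distrib) (simp add: magnus_eq_sum_fox algebra_simps)
next
  case (diff a u)
  then show ?case
    by (simp add: lin_ext_diff group_ring_finite fox_ext_diff augmentation_diff augmentation_elt
        left_diff_distrib sum_subtractf) (simp add: magnus_eq_sum_fox algebra_simps)
qed

lemma conj_magnus_ext_expand:
  assumes "u \<in> carrier (group_ring G)"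
  shows "lin_ext conj_magnus u = of_int (augmentation u)
    + (\<Sum>j\<in>I. (conj_magnus (x j) - 1) * lin_ext conj_magnus (fox_ext j u))"
  using assms
proof (induction u rule: group_ring_induct)
  case zero
  show ?case by (simp add: augmentation_zero)
next
  case (add a u)
  then show ?case
    by (simp add: lin_ext_add group_ring_finite fox_ext_add augmentation_add augmentation_elt
        distrib_left sum.distrib) (simp add: conj_magnus_eq_sum_fox)
next
  case (diff a u)
  then show ?case
    by (simp add: lin_ext_diff group_ring_finite fox_ext_diff augmentation_diff augmentation_elt
        right_diff_distrib sum_subtractf) (simp add: conj_magnus_eq_sum_fox)
qed

text \<open>\<open>foldr\<close> differentiates by the last letter first and
  \<open>magnus_ext_expand\<close> strips the last letter, hence the induction from the
  right.\<close>

lemma ncps_nth_magnus_ext: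
  assumes "u \<in> carrier (group_ring G)" "w \<in> lists I"
  shows "augmentation (foldr (fox_derivative G n x) w u) = ncps_nth (magnus_ext u) w"
  using assms
proof (induction w arbitrary: u rule: rev_induct)
  case Nil
  then show ?case by (simp add: magnus_ext_expand ncps_nth_of_int)
next
  case (snoc j w)
  then have j: "j \<in> I" by auto
  have "augmentation (foldr (fox_derivative G n x) (w @ [j]) u)
    = augmentation (foldr (fox_derivative G n x) w (fox_ext j u))"
    using snoc.prems by (simp add: fox_derivative_eq)
  also have "\<dots> = ncps_nth (magnus_ext (fox_ext j u)) w"
    using snoc by auto
  also have "\<dots> = ncps_nth (magnus_ext u) (w @ [j])"
    using j finite_letters by (simp add: magnus_ext_expand[OF snoc.prems(1)] ncps_nth_of_int)
  finally show ?case .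
qed

text \<open>If \<open>u\<close> vanishes below degree \<open>k + 1\<close>, its Fox derivatives
  vanish below degree \<open>k\<close>. In \<open>conj_magnus_ext_expand\<close> the factor
  \<open>conj_magnus (x j) - 1\<close> has no constant term and restores the lost degree.\<close>

lemma conj_ncps_ideal:
  assumes "u \<in> carrier (group_ring G)" "magnus_ext u \<in> ncps_ideal I p k"
  shows "magnus_ext (group_ring_conj G u) \<in> ncps_ideal I p k"
proof -
  have "lin_ext conj_magnus u \<in> ncps_ideal I p k"
    using assms
  proof (induction k arbitrary: u)
    case (Suc k)
    have e: "p dvd augmentation u"
      using ncps_idealD[OF Suc.prems(2), of "[]"] by (simp add: magnus_ext_expand[OF Suc.prems(1)] ncps_nth_of_int)
    have "magnus_ext (fox_ext j u) \<in> ncps_ideal I p k" if j: "j \<in> I" for j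
    proof (rule ncps_idealI)
      fix w assume w: "w \<in> lists I" "length w < k"
      have "p dvd ncps_nth (magnus_ext u) (w @ [j])"
        using w j by (intro ncps_idealD[OF Suc.prems(2)]) auto
      then show "p dvd ncps_nth (magnus_ext (fox_ext j u)) w"
        using j finite_letters by (simp add: magnus_ext_expand[OF Suc.prems(1)] ncps_nth_of_int)
    qed
    then have N: "lin_ext conj_magnus (fox_ext j u) \<in> ncps_ideal I p k" if "j \<in> I" for j
      using Suc that by simp
    have "conj_magnus (x j) - 1 \<in> ncps_ideal I p 1" if "j \<in> I" for j
    proof -
      have "inv (x j) \<in> dimension_subgroup p 1"
        using that by (intro subsetD[OF carrier_subset_dimension_subgroup]) simp
      then show ?thesis by (simp add: conj_magnus_def dimension_subgroup_def)
    qed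
    from ncps_ideal_mult[OF this N]
    have "(\<Sum>j\<in>I. (conj_magnus (x j) - 1) * lin_ext conj_magnus (fox_ext j u)) \<in> ncps_ideal I p (1 + k)"
      by (intro ncps_ideal_sum) simp
    moreover have "of_int (augmentation u) \<in> ncps_ideal I p (1 + k)"
      using ncps_ideal_of_int[OF e, of 1 I "1 + k"] by simp
    ultimately show ?case
      unfolding conj_magnus_ext_expand[OF Suc.prems(1)] by (simp add: ncps_ideal_add)
  qed simp
  then show ?thesis
    using lin_ext_conj[OF assms(1), of magnus] by (simp add: conj_magnus_def[abs_def])
qed

lemma conj_ncps_ideal_iff:
  assumes "u \<in> carrier (group_ring G)"
  shows "magnus_ext (group_ring_conj G u) \<in> ncps_ideal I p k \<longleftrightarrow> magnus_ext u \<in> ncps_ideal I p k"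
  using conj_ncps_ideal[OF assms] conj_ncps_ideal[of "group_ring_conj G u"] assms
  by (auto simp: group_ring_conj_conj)

text \<open>Passing to residues changes \<open>u\<close> by \<open>p\<close> times the element with
  coefficients \<open>u h div int p\<close>, and the expansion is additive.\<close>

lemma taylor_mod_eq:
  assumes "u \<in> carrier (group_ring G)" "w \<in> lists I" "0 < p"
  shows "taylor_mod G n x p (\<lambda>h. u h mod int p) w = ncps_nth (magnus_ext u) w mod int p"
proof -
  have R: "(\<lambda>h. u h mod int p) \<in> carrier (group_ring G)" "(\<lambda>h. u h div int p) \<in> carrier (group_ring G)"
    using assms(1) unfolding group_ring_carrier
    by (auto elim!: rev_finite_subset intro!: Collect_mono) 
  have "magnus_ext (\<lambda>h. u h mod int p + int p * (u h div int p))
    = magnus_ext (\<lambda>h. u h mod int p) + of_int (int p) * magnus_ext (\<lambda>h. u h div int p)"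
    using R by (simp only: lin_ext_add lin_ext_scale group_ring_finite group_ring_scale_closed)
  then have "magnus_ext u = magnus_ext (\<lambda>h. u h mod int p) + of_int (int p) * magnus_ext (\<lambda>h. u h div int p)"
    by simp
  then have "ncps_nth (magnus_ext u) w mod int p = ncps_nth (magnus_ext (\<lambda>h. u h mod int p)) w mod int p"
    by (simp del: of_int_of_nat_eq)
  moreover have "set w \<subseteq> I" using assms(2) by auto
  ultimately show ?thesis
    using ncps_nth_magnus_ext[OF R(1) assms(2)] unfolding taylor_mod_def letters_eq[symmetric] by simp
qed

section \<open>From Fox matrices to congruences for endomorphisms\<close>

lemma magnus_fox_difference:
  assumes "g \<in> carrier G" "j \<in> I"
  shows "magnus g - magnus (x j)
    = (\<Sum>i\<in>I. magnus_ext (\<lambda>h. fox i g h - (if i = j then group_ring_elt \<one> h else 0)) * ncps_var i)"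
proof -
  have "magnus_ext (\<lambda>h. fox i g h - (if i = j then group_ring_elt \<one> h else 0)) * ncps_var i
    = magnus_ext (fox i g) * ncps_var i - (if i = j then ncps_var i else 0)" for i
    using assms(1) by (cases "i = j") (simp_all add: lin_ext_diff group_ring_finite left_diff_distrib)
  then show ?thesis
    using magnus_eq_sum_fox[OF assms(1)] assms(2) finite_letters by (simp add: sum_subtractf)
qed

text \<open>The summands of \<open>magnus_fox_difference\<close> consist of words with different
  last letters, so they cannot cancel, and each variable adds one degree.\<close>

lemma magnus_difference_iff:
  assumes g: "g \<in> carrier G" and j: "j \<in> I"
  shows "magnus g - magnus (x j) \<in> ncps_ideal I p (Suc k) \<longleftrightarrow>
    (\<forall>i\<in>I. magnus_ext (\<lambda>h. fox i g h - (if i = j then group_ring_elt \<one> h else 0)) \<in> ncps_ideal I p k)"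
    (is "?L \<longleftrightarrow> (\<forall>i\<in>I. ?d i \<in> _)")
proof
  assume ?L
  show "\<forall>i\<in>I. ?d i \<in> ncps_ideal I p k"
  proof (intro ballI ncps_idealI)
    fix i w assume i: "i \<in> I" and w: "w \<in> lists I" "length w < k"
    have "p dvd ncps_nth (magnus g - magnus (x j)) (w @ [i])"
      using i w by (intro ncps_idealD[OF \<open>?L\<close>]) auto
    then show "p dvd ncps_nth (?d i) w"
      unfolding magnus_fox_difference[OF g j] using i finite_letters by simp
  qed
next
  assume d: "\<forall>i\<in>I. ?d i \<in> ncps_ideal I p k"
  have "ncps_var i \<in> ncps_ideal I p 1" for i
    by (auto simp: ncps_ideal_def)
  then have "?d i * ncps_var i \<in> ncps_ideal I p (k + 1)" if "i \<in> I" for i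
    using d that by (intro ncps_ideal_mult) auto
  then show ?L
    unfolding magnus_fox_difference[OF g j] by (intro ncps_ideal_sum) simp
qed

text \<open>\<open>magnus h\<close> is a unit, and right multiplication by it or its inverse
  preserves the ideal.\<close>

lemma mult_inv_in_dimension_subgroup_iff:
  assumes "g \<in> carrier G" "h \<in> carrier G"
  shows "g \<otimes> inv h \<in> dimension_subgroup p k \<longleftrightarrow> magnus g - magnus h \<in> ncps_ideal I p k"
proof -
  have "magnus (g \<otimes> inv h) - 1 = (magnus g - magnus h) * magnus (inv h)"
    using assms by (simp add: left_diff_distrib magnus_mult_inv)
  moreover have "magnus g - magnus h = (magnus (g \<otimes> inv h) - 1) * magnus h"
    using assms by (simp add: left_diff_distrib mult.assoc magnus_mult_inv)
  ultimately show ?thesis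
    using assms ncps_ideal_mult_right by (metis (no_types, lifting) dimension_subgroup_def inv_closed m_closed mem_Collect_eq)
qed

text \<open>Congruence modulo a two-sided ideal is compatible with products, so the letters control
  the whole group; for an inverse letter the unit \<open>magnus (f (x i))\<close> is
  cancelled.\<close>

lemma endomorphism_congruence_iff:
  assumes f: "f \<in> hom G G"
  shows "(\<forall>y\<in>carrier G. f y \<otimes> inv y \<in> dimension_subgroup p k)
    \<longleftrightarrow> (\<forall>j\<in>I. magnus (f (x j)) - magnus (x j) \<in> ncps_ideal I p k)"
proof -
  have fc: "\<And>y. y \<in> carrier G \<Longrightarrow> f y \<in> carrier G" and fm: "\<And>y z. y \<in> carrier G \<Longrightarrow> z \<in> carrier G \<Longrightarrow> f (y \<otimes> z) = f y \<otimes> f z"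
    using f by (auto simp: hom_def)
  have "magnus (f y) - magnus y \<in> ncps_ideal I p k"
    if letters: "\<And>j. j \<in> I \<Longrightarrow> magnus (f (x j)) - magnus (x j) \<in> ncps_ideal I p k" and "y \<in> carrier G" for y
    using \<open>y \<in> carrier G\<close>
  proof (induction y rule: word_induct)
    case one
    have "f \<one> = \<one>" using fc[of \<one>] fm[of \<one> \<one>] by (simp add: l_cancel_one)
    then show ?case by simp
  next
    case (letter i h)
    have "magnus (f (x i \<otimes> h)) - magnus (x i \<otimes> h)
      = (magnus (f (x i)) - magnus (x i)) * magnus (f h) + magnus (x i) * (magnus (f h) - magnus h)"
      using letter fc fm by (simp add: algebra_simps)
    then show ?case
      using letter letters by (simp only: ncps_ideal_add ncps_ideal_mult_left ncps_ideal_mult_right)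
  next
    case (inverse i h)
    define z where "z = inv (x i) \<otimes> h"
    have c: "x i \<in> carrier G" "z \<in> carrier G" "h = x i \<otimes> z"
      using inverse by (simp_all add: z_def mult_inv_cancel_left)
    have "magnus (f (x i)) * magnus (f z) - magnus (x i) * magnus z \<in> ncps_ideal I p k"
      using inverse(3) c fc fm by (simp del: magnus_letter)
    then have "magnus (f (x i)) * magnus (f z) - magnus (x i) * magnus z
      - (magnus (f (x i)) - magnus (x i)) * magnus z \<in> ncps_ideal I p k"
      by (rule ncps_ideal_diff[OF _ ncps_ideal_mult_right[OF letters[OF inverse(1)]]])
    then have "magnus (inv (f (x i))) * (magnus (f (x i)) * magnus (f z) - magnus (x i) * magnus z
      - (magnus (f (x i)) - magnus (x i)) * magnus z) \<in> ncps_ideal I p k"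
      by (rule ncps_ideal_mult_left)
    also have "magnus (f (x i)) * magnus (f z) - magnus (x i) * magnus z
      - (magnus (f (x i)) - magnus (x i)) * magnus z = magnus (f (x i)) * (magnus (f z) - magnus z)"
      by (simp add: algebra_simps del: magnus_letter)
    also have "magnus (inv (f (x i))) * (magnus (f (x i)) * (magnus (f z) - magnus z)) = magnus (f z) - magnus z"
      using magnus_mult_inv(2)[OF fc[OF c(1)]] unfolding mult.assoc[symmetric] by simp
    finally show ?case by (simp only: z_def)
  qed
  then show ?thesis
    using fc by (auto simp: mult_inv_in_dimension_subgroup_iff simp del: magnus_letter)
qed

lemma conj_fox_coefficients_iff:
  assumes u: "u \<in> carrier (group_ring G)" and p: "1 < p"
  shows "(\<forall>w\<in>lists I. length w < k \<longrightarrow>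
      taylor_mod G n x p (\<lambda>h. group_ring_conj G u h mod int p) w = (if i = j \<and> w = [] then 1 else 0))
    \<longleftrightarrow> magnus_ext (\<lambda>h. u h - (if i = j then group_ring_elt \<one> h else 0)) \<in> ncps_ideal I (int p) k"
proof -
  let ?d = "\<lambda>h. if i = j then group_ring_elt \<one> h else 0"
  have d: "?d \<in> carrier (group_ring G)" by (cases "i = j") auto
  \<comment> \<open>Conjugation fixes the identity of the group ring, so the entry of the identity
    matrix may be subtracted before or after conjugating.\<close>
  have "group_ring_conj G (\<lambda>h. u h - ?d h) = (\<lambda>h. group_ring_conj G u h - ?d h)"
    by (cases "i = j") (simp_all add: group_ring_conj_diff group_ring_conj_elt)
  then have "magnus_ext (group_ring_conj G (\<lambda>h. u h - ?d h))
    = magnus_ext (group_ring_conj G u) - (if i = j then 1 else 0)"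
    using u d by (cases "i = j") (simp_all add: lin_ext_diff group_ring_finite)
  then have nth: "ncps_nth (magnus_ext (group_ring_conj G (\<lambda>h. u h - ?d h))) w
    = ncps_nth (magnus_ext (group_ring_conj G u)) w - (if i = j \<and> w = [] then 1 else 0)" for w
    by (simp add: ncps_nth_1)
  have T: "taylor_mod G n x p (\<lambda>h. group_ring_conj G u h mod int p) w
      = ncps_nth (magnus_ext (group_ring_conj G u)) w mod int p" if "w \<in> lists I" for w
    using u p that by (intro taylor_mod_eq) auto
  \<comment> \<open>Since \<open>1 < p\<close>, both 0 and 1 are their own residues.\<close>
  have "c mod int p = (if P then 1 else 0) \<longleftrightarrow> int p dvd c - (if P then 1 else 0)" for c :: int and P
    using p mod_eq_dvd_iff[of c "int p" "if P then 1 else 0"] by (simp split: if_splits)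
  then have "(\<forall>w\<in>lists I. length w < k \<longrightarrow>
      taylor_mod G n x p (\<lambda>h. group_ring_conj G u h mod int p) w = (if i = j \<and> w = [] then 1 else 0))
    \<longleftrightarrow> magnus_ext (group_ring_conj G (\<lambda>h. u h - ?d h)) \<in> ncps_ideal I (int p) k"
    unfolding ncps_ideal_def mem_Collect_eq nth using T by (simp only: cong: ball_cong)
  also have "\<dots> \<longleftrightarrow> magnus_ext (\<lambda>h. u h - ?d h) \<in> ncps_ideal I (int p) k"
    using u d by (intro conj_ncps_ideal_iff group_ring_diff_closed)
  finally show ?thesis .
qed

text \<open>The comparison in purely algebraic form. Topology enters afterwards, to show that loops
  form a group on which mapping classes act by endomorphisms.\<close>

theorem conj_fox_matrix_iff_zassenhaus:
  assumes f: "f \<in> hom G G" and p: "prime p"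
  shows "(\<forall>i\<in>I. \<forall>j\<in>I. \<forall>w\<in>lists I. length w < k \<longrightarrow>
      taylor_mod G n x p
        (\<lambda>h. group_ring_conj G (fox_derivative G n x i (group_ring_elt (f (x j)))) h mod int p) w
      = (if i = j \<and> w = [] then 1 else 0))
    \<longleftrightarrow> (\<forall>y\<in>carrier G. f y \<otimes> inv y \<in> zassenhaus_subgroup G p (k + 1))"
proof -
  have fc: "f (x j) \<in> carrier G" if "j \<in> I" for j using f that by (auto simp: hom_def)
  have D: "fox_derivative G n x i (group_ring_elt (f (x j))) = fox i (f (x j))" if "j \<in> I" for i j
    using fc[OF that] by (simp add: fox_derivative_eq)
  have "(\<forall>w\<in>lists I. length w < k \<longrightarrow>
      taylor_mod G n x p
        (\<lambda>h. group_ring_conj G (fox_derivative G n x i (group_ring_elt (f (x j)))) h mod int p) w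
      = (if i = j \<and> w = [] then 1 else 0))
    \<longleftrightarrow> magnus_ext (\<lambda>h. fox i (f (x j)) h - (if i = j then group_ring_elt \<one> h else 0)) \<in> ncps_ideal I (int p) k"
    if "j \<in> I" for i j
    unfolding D[OF that] by (rule conj_fox_coefficients_iff) (use fc[OF that] prime_gt_1_nat[OF p] in auto)
  then have "?thesis \<longleftrightarrow> ((\<forall>j\<in>I. magnus (f (x j)) - magnus (x j) \<in> ncps_ideal I (int p) (Suc k))
    \<longleftrightarrow> (\<forall>y\<in>carrier G. f y \<otimes> inv y \<in> zassenhaus_subgroup G p (k + 1)))"
    using fc by (auto simp: magnus_difference_iff simp del: magnus_letter)
  moreover have "zassenhaus_subgroup G p (k + 1) = dimension_subgroup (int p) (Suc k)"
    using zassenhaus_subset_dimension_subgroup[OF p, of "k + 1"] dimension_subgroup_subset_zassenhaus[OF p, of "k + 1"]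
    by auto
  ultimately show ?thesis using endomorphism_congruence_iff[OF f, of "int p" "Suc k"] by simp
qed

end


section \<open>The fundamental group and the action of the mapping class group\<close>

text \<open>Straight-line paths make no sense in a general topological space, so the homotopy is
  taken for the identity path of the unit interval and pushed forward along
  \<open>\<gamma>\<close>.\<close>

lemma homotopic_paths_const_lid:
  assumes "path \<gamma>" "path_image \<gamma> \<subseteq> S" "pathstart \<gamma> = b"
  shows "homotopic_paths S ((\<lambda>_. b) +++ \<gamma>) \<gamma>"
proof -
  have "homotopic_paths {0..1} (linepath (0::real) 0 +++ id) id"
    by (rule homotopic_paths_lid') (auto simp: path_def path_image_def pathstart_def)
  then have "homotopic_paths S (\<gamma> \<circ> (linepath 0 0 +++ id)) (\<gamma> \<circ> id)"
    by (rule homotopic_paths_continuous_image) (use assms in \<open>auto simp: path_def path_image_def\<close>)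
  moreover have "\<gamma> \<circ> linepath 0 0 = (\<lambda>_. b)" using assms(3) by (auto simp: linepath_def pathstart_def)
  ultimately show ?thesis by (simp add: path_compose_join)
qed

lemma homotopic_paths_const_linv:
  assumes "path \<gamma>" "path_image \<gamma> \<subseteq> S" "pathfinish \<gamma> = b"
  shows "homotopic_paths S (reversepath \<gamma> +++ \<gamma>) (\<lambda>_. b)"
proof -
  have "homotopic_paths {0..1} (reversepath id +++ id) (linepath (pathfinish id) (pathfinish (id::real \<Rightarrow> real)))"
    by (rule homotopic_paths_linv) (auto simp: path_def path_image_def)
  then have "homotopic_paths {0..1} (reversepath id +++ id) (linepath 1 (1::real))"
    by (simp add: pathfinish_def)
  then have "homotopic_paths S (\<gamma> \<circ> (reversepath id +++ id)) (\<gamma> \<circ> linepath 1 1)"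
    by (rule homotopic_paths_continuous_image) (use assms in \<open>auto simp: path_def path_image_def\<close>)
  moreover have "\<gamma> \<circ> linepath 1 1 = (\<lambda>_. b)" using assms(3) by (auto simp: linepath_def pathfinish_def)
  moreover have "\<gamma> \<circ> reversepath id = reversepath \<gamma>" by (auto simp: reversepath_def)
  ultimately show ?thesis by (simp add: path_compose_join)
qed

definition path_class :: "'a::topological_space set \<Rightarrow> (real \<Rightarrow> 'a) \<Rightarrow> (real \<Rightarrow> 'a) set" where
  "path_class S \<gamma> = {\<delta>. homotopic_paths S \<gamma> \<delta>}"

lemma path_class_eqI: "homotopic_paths S \<gamma> \<delta> \<Longrightarrow> path_class S \<gamma> = path_class S \<delta>"
  unfolding path_class_def by (auto intro: homotopic_paths_trans homotopic_paths_sym)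

lemma loops_atD:
  assumes "\<gamma> \<in> loops_at S b"
  shows "path \<gamma>" "path_image \<gamma> \<subseteq> S" "pathstart \<gamma> = b" "pathfinish \<gamma> = b"
  using assms by (auto simp: loops_at_def)

lemma const_loop: "b \<in> S \<Longrightarrow> (\<lambda>_. b) \<in> loops_at S b"
  by (auto simp: loops_at_def path_def path_image_def pathstart_def pathfinish_def)

lemma join_loops: "\<gamma> \<in> loops_at S b \<Longrightarrow> \<delta> \<in> loops_at S b \<Longrightarrow> \<gamma> +++ \<delta> \<in> loops_at S b"
  by (auto simp: loops_at_def path_image_join)

lemma reverse_loop: "\<gamma> \<in> loops_at S b \<Longrightarrow> reversepath \<gamma> \<in> loops_at S b"
  by (auto simp: loops_at_def)

lemma fundamental_group_carrier: "carrier (fundamental_group S b) = path_class S ` loops_at S b"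
  by (auto simp: fundamental_group_def quotient_def path_class_def)

lemma fundamental_group_one: "\<one>\<^bsub>fundamental_group S b\<^esub> = path_class S (\<lambda>_. b)"
  by (simp add: fundamental_group_def path_class_def)

lemma fundamental_group_mult:
  assumes "\<gamma> \<in> loops_at S b" "\<delta> \<in> loops_at S b"
  shows "path_class S \<gamma> \<otimes>\<^bsub>fundamental_group S b\<^esub> path_class S \<delta> = path_class S (\<gamma> +++ \<delta>)"
proof -
  have "homotopic_paths S (\<gamma> +++ \<delta>) \<epsilon>"
    if "homotopic_paths S \<gamma> \<alpha>" "homotopic_paths S \<delta> \<beta>" "homotopic_paths S (\<alpha> +++ \<beta>) \<epsilon>" for \<alpha> \<beta> \<epsilon>
    using homotopic_paths_trans[OF homotopic_paths_join[OF that(1,2)] that(3)] loops_atD[OF assms(1)] loops_atD[OF assms(2)]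
    by simp
  moreover have "homotopic_paths S \<gamma> \<gamma>" "homotopic_paths S \<delta> \<delta>"
    using loops_atD[OF assms(1)] loops_atD[OF assms(2)] by simp_all
  ultimately show ?thesis
    by (auto simp: fundamental_group_def path_class_def simp del: homotopic_paths_refl)
qed

lemma group_fundamental_group:
  assumes b: "b \<in> S"
  shows "group (fundamental_group S b)"
proof (rule groupI)
  let ?G = "fundamental_group S b"
  show "\<one>\<^bsub>?G\<^esub> \<in> carrier ?G"
    using const_loop[OF b] by (auto simp: fundamental_group_one fundamental_group_carrier)
  fix A assume "A \<in> carrier ?G"
  then obtain \<alpha> where \<alpha>: "A = path_class S \<alpha>" "\<alpha> \<in> loops_at S b"
    by (auto simp: fundamental_group_carrier)
  note \<alpha>' = loops_atD[OF \<alpha>(2)]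
  show "\<one>\<^bsub>?G\<^esub> \<otimes>\<^bsub>?G\<^esub> A = A"
    unfolding \<alpha>(1) fundamental_group_one fundamental_group_mult[OF const_loop[OF b] \<alpha>(2)]
    using \<alpha>' by (intro path_class_eqI homotopic_paths_const_lid)
  have "path_class S (reversepath \<alpha>) \<otimes>\<^bsub>?G\<^esub> A = \<one>\<^bsub>?G\<^esub>"
    unfolding \<alpha>(1) fundamental_group_one fundamental_group_mult[OF reverse_loop[OF \<alpha>(2)] \<alpha>(2)]
    using \<alpha>' by (intro path_class_eqI homotopic_paths_const_linv)
  then show "\<exists>B\<in>carrier ?G. B \<otimes>\<^bsub>?G\<^esub> A = \<one>\<^bsub>?G\<^esub>"
    using reverse_loop[OF \<alpha>(2)] by (auto simp: fundamental_group_carrier)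
  fix B assume "B \<in> carrier ?G"
  then obtain \<beta> where \<beta>: "B = path_class S \<beta>" "\<beta> \<in> loops_at S b"
    by (auto simp: fundamental_group_carrier)
  note \<beta>' = loops_atD[OF \<beta>(2)]
  show "A \<otimes>\<^bsub>?G\<^esub> B \<in> carrier ?G"
    using join_loops[OF \<alpha>(2) \<beta>(2)] unfolding \<alpha>(1) \<beta>(1) fundamental_group_mult[OF \<alpha>(2) \<beta>(2)]
    by (auto simp: fundamental_group_carrier)
  fix C assume "C \<in> carrier ?G"
  then obtain \<gamma> where \<gamma>: "C = path_class S \<gamma>" "\<gamma> \<in> loops_at S b"
    by (auto simp: fundamental_group_carrier)
  have "homotopic_paths S (\<alpha> +++ (\<beta> +++ \<gamma>)) ((\<alpha> +++ \<beta>) +++ \<gamma>)"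
    using \<alpha>' \<beta>' loops_atD[OF \<gamma>(2)] by (intro homotopic_paths_assoc) auto
  then show "A \<otimes>\<^bsub>?G\<^esub> B \<otimes>\<^bsub>?G\<^esub> C = A \<otimes>\<^bsub>?G\<^esub> (B \<otimes>\<^bsub>?G\<^esub> C)"
    unfolding \<alpha>(1) \<beta>(1) \<gamma>(1)
    by (simp add: fundamental_group_mult join_loops \<alpha>(2) \<beta>(2) \<gamma>(2) path_class_eqI)
qed

lemma mcg_homeo_continuous:
  assumes "f \<in> mcg_homeos S"
  shows "continuous_on S f" "f ` S = S" "\<And>y. y \<in> surface_boundary S \<Longrightarrow> f y = y"
  using assms by (auto simp: mcg_homeos_def rel_boundary_homeo_def homeomorphism_def)

lemma mcg_homeo_loop:
  assumes f: "f \<in> mcg_homeos S" and b: "b \<in> surface_boundary S" and \<gamma>: "\<gamma> \<in> loops_at S b"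
  shows "f \<circ> \<gamma> \<in> loops_at S b"
proof -
  note \<gamma> = loops_atD[OF \<gamma>] and f = mcg_homeo_continuous[OF f]
  have "path (f \<circ> \<gamma>)" using \<gamma> f by (meson path_continuous_image continuous_on_subset)
  moreover have "path_image (f \<circ> \<gamma>) \<subseteq> S" using \<gamma> f by (auto simp: path_image_compose)
  ultimately show ?thesis using \<gamma> f(3)[OF b] by (simp add: loops_at_def pathstart_compose pathfinish_compose)
qed

text \<open>An isotopy relative to the boundary fixes \<open>b\<close> at all times, so composing it
  with \<open>\<gamma>\<close> gives a homotopy with fixed endpoints. Hence any representative
  \<open>f\<close> computes the action.\<close>

lemma mcg_action_path_class:
  assumes f: "f \<in> mcg_homeos S" and \<phi>: "\<phi> = isotopy_rel S `` {f}"
    and b: "b \<in> surface_boundary S" and \<gamma>: "\<gamma> \<in> loops_at S b"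
  shows "mcg_action S \<phi> (path_class S \<gamma>) = path_class S (f \<circ> \<gamma>)"
proof -
  note \<gamma>' = loops_atD[OF \<gamma>]
  have refl: "f \<in> \<phi>"
    using f mcg_homeo_continuous[OF f] unfolding \<phi> isotopy_rel_def mcg_homeos_def by auto
  have "homotopic_paths S (f \<circ> \<gamma>) (f' \<circ> \<delta>)"
    if f': "f' \<in> \<phi>" and \<delta>: "homotopic_paths S \<gamma> \<delta>" for f' \<delta>
  proof (rule homotopic_paths_trans)
    have f'h: "f' \<in> mcg_homeos S" and
      h: "homotopic_with (rel_boundary_homeo S) (top_of_set S) (top_of_set S) f f'"
      using f' unfolding \<phi> isotopy_rel_def by auto
    have fb: "j b = b" if "rel_boundary_homeo S j" for j
      using that b by (simp add: rel_boundary_homeo_def)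
    have "continuous_map (top_of_set {0..1}) (top_of_set S) \<gamma>"
      using \<gamma>' by (auto simp: path_def path_image_def)
    then show "homotopic_paths S (f \<circ> \<gamma>) (f' \<circ> \<gamma>)"
      unfolding homotopic_paths_def
      by (rule homotopic_with_compose_continuous_map_right[OF h])
        (use \<gamma>' fb mcg_homeo_continuous(3)[OF f b] in \<open>simp add: pathstart_compose pathfinish_compose\<close>)
    show "homotopic_paths S (f' \<circ> \<gamma>) (f' \<circ> \<delta>)"
      using mcg_homeo_continuous[OF f'h] by (intro homotopic_paths_continuous_image[OF \<delta>]) auto
  qed
  moreover have "homotopic_paths S \<gamma> \<gamma>" using \<gamma>' by simp
  ultimately show ?thesis
    using refl unfolding mcg_action_def path_class_def
    by (auto intro: homotopic_paths_trans simp del: homotopic_paths_refl)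
qed

lemma mcg_action_hom:
  assumes \<phi>: "\<phi> \<in> carrier (mapping_class_group S)" and b: "b \<in> surface_boundary S"
  shows "mcg_action S \<phi> \<in> hom (fundamental_group S b) (fundamental_group S b)"
proof -
  obtain f where f: "f \<in> mcg_homeos S" "\<phi> = isotopy_rel S `` {f}"
    using \<phi> by (auto simp: mapping_class_group_def quotient_def)
  note act = mcg_action_path_class[OF f b]
  show ?thesis
  proof (rule homI)
    let ?G = "fundamental_group S b"
    fix A assume "A \<in> carrier ?G"
    then obtain \<alpha> where \<alpha>: "A = path_class S \<alpha>" "\<alpha> \<in> loops_at S b"
      by (auto simp: fundamental_group_carrier)
    show "mcg_action S \<phi> A \<in> carrier ?G"
      using mcg_homeo_loop[OF f(1) b \<alpha>(2)] by (simp add: \<alpha>(1) act[OF \<alpha>(2)] fundamental_group_carrier)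
    fix B assume "B \<in> carrier ?G"
    then obtain \<beta> where \<beta>: "B = path_class S \<beta>" "\<beta> \<in> loops_at S b"
      by (auto simp: fundamental_group_carrier)
    show "mcg_action S \<phi> (A \<otimes>\<^bsub>?G\<^esub> B) = mcg_action S \<phi> A \<otimes>\<^bsub>?G\<^esub> mcg_action S \<phi> B"
      using \<alpha> \<beta> mcg_homeo_loop[OF f(1) b]
      by (simp add: fundamental_group_mult join_loops act path_compose_join)
  qed
qed


section \<open>The two filtrations\<close>

text \<open>The conditions degree by degree merge into one condition on words shorter than
  \<open>k\<close>; as \<open>1 \<le> k\<close>, the empty word is among them and accounts for the
  part of degree 0.\<close>

lemma perron_johnson_iff:
  assumes "1 \<le> k"
  shows "\<phi> \<in> perron_johnson S b n x p k \<longleftrightarrow> \<phi> \<in> carrier (mapping_class_group S) \<and>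
    (\<forall>i\<in>{1..n}. \<forall>j\<in>{1..n}. \<forall>w\<in>lists {1..n}. length w < k \<longrightarrow>
      taylor_mod (fundamental_group S b) n x p (fox_matrix_mod S b n x p \<phi> i j) w
        = (if i = j \<and> w = [] then 1 else 0))"
proof -
  let ?T = "\<lambda>i j. taylor_mod (fundamental_group S b) n x p (fox_matrix_mod S b n x p \<phi> i j)"
  \<comment> \<open>Words with a letter outside the alphabet have coefficient 0 by definition, so it
    suffices to quantify over words in \<open>{1..n}\<close>.\<close>
  have off: "?T i j w = 0" if "w \<notin> lists {1..n}" for i j w
    using that by (auto simp: taylor_mod_def)
  define P where "P = (\<lambda>i j. ?T i j [] = (if i = j then 1 else 0))"
  define Q where "Q = (\<lambda>l i j. \<forall>w\<in>lists {1..n}. length w = l \<longrightarrow> ?T i j w = 0)"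
  have zero: "fox_matrix_part S b n x p 0 \<phi> i j = (\<lambda>w. if i = j \<and> w = [] then 1 else 0) \<longleftrightarrow> P i j" for i j
    unfolding P_def by (auto simp: fox_matrix_part_def homogeneous_part_def fun_eq_iff)
  have pos: "fox_matrix_part S b n x p l \<phi> i j = (\<lambda>w. 0) \<longleftrightarrow> Q l i j" for i j l
    unfolding Q_def fox_matrix_part_def homogeneous_part_def fun_eq_iff using off[of _ i j] by meson
  have all: "(\<forall>w\<in>lists {1..n}. length w < k \<longrightarrow> ?T i j w = (if i = j \<and> w = [] then 1 else 0))
    \<longleftrightarrow> P i j \<and> (\<forall>l\<in>{1..k-1}. Q l i j)" (is "?L = ?R") for i j
    unfolding P_def Q_def
  proof
    assume L: ?L
    show "?T i j [] = (if i = j then 1 else 0)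
      \<and> (\<forall>l\<in>{1..k-1}. \<forall>w\<in>lists {1..n}. length w = l \<longrightarrow> ?T i j w = 0)"
    proof (intro conjI ballI impI)
      show "?T i j [] = (if i = j then 1 else 0)" using L assms by simp
      fix l w assume "l \<in> {1..k-1}" "w \<in> lists {1..n}" "length w = l"
      then show "?T i j w = 0" using L[rule_format, of w] by auto
    qed
  next
    assume R: "?T i j [] = (if i = j then 1 else 0)
      \<and> (\<forall>l\<in>{1..k-1}. \<forall>w\<in>lists {1..n}. length w = l \<longrightarrow> ?T i j w = 0)"
    show ?L
    proof (intro ballI impI)
      fix w assume w: "w \<in> lists {1..n}" "length w < k"
      show "?T i j w = (if i = j \<and> w = [] then 1 else 0)"
      proof (cases "w = []")
        case False
        then have "length w \<in> {1..k-1}" using w(2) by (cases w) auto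
        then have "?T i j w = 0" using R w(1) by blast
        then show ?thesis using False by simp
      qed (use R in simp)
    qed
  qed
  show ?thesis
    unfolding perron_johnson_def mem_Collect_eq zero pos all by blast
qed

theorem theorem4p7:
  fixes S :: "'a::topological_space set" and b :: 'a and g p k :: nat
    and x :: "nat \<Rightarrow> (real \<Rightarrow> 'a) set"
  assumes "prime p" and "odd p"
    and "surface_one_boundary S g"
    and "b \<in> surface_boundary S"
    and "free_basis (fundamental_group S b) {1..2 * g} x"
    and "1 \<le> k"
  shows "perron_johnson S b (2 * g) x p k = zassenhaus_johnson S b p k"
proof -
  let ?G = "fundamental_group S b"
  have "b \<in> S" using assms(4) by (simp add: surface_boundary_def)
  then have "group ?G" by (rule group_fundamental_group)
  then interpret fox_group ?G "{1..2 * g}" x "2 * g"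
    using assms(5)
    by (intro fox_group.intro free_basis_group.intro group_with_letters.intro
        group_with_letters_axioms.intro free_basis_group_axioms.intro fox_group_axioms.intro)
      (auto simp: free_basis_def)
  have "\<phi> \<in> perron_johnson S b (2 * g) x p k \<longleftrightarrow> \<phi> \<in> zassenhaus_johnson S b p k" for \<phi>
  proof (cases "\<phi> \<in> carrier (mapping_class_group S)")
    case True
    show ?thesis
      using conj_fox_matrix_iff_zassenhaus[OF mcg_action_hom[OF True assms(4)] assms(1), of k] True
      unfolding perron_johnson_iff[OF assms(6)] zassenhaus_johnson_def Let_def fox_matrix_mod_def fox_matrix_def
      by blast
  next
    case False
    then show ?thesis by (simp add: perron_johnson_def zassenhaus_johnson_def Let_def)
  qed
  then show ?thesis by blast
qed

end
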